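(* Let $G=\langle S\rangle$ and $\widetilde G=\langle\widetilde S\rangle$ be finite groups with finite symmetric generating sets, and let $H\le G$, $\widetilde H\le\widetilde G$ be non-trivial subgroups of index two with an isomorphism $H\cong\widetilde H$. Suppose $G$ is a Dedekind group (every subgroup of $G$ is normal in $G$). Then the Cayley graph $\Gamma(G\ast_H\widetilde G, S\cup\widetilde S)$ of the free product of $G$ and $\widetilde G$ amalgamated along $H\cong\widetilde H$ has a Hamilton circle.
   Context: Generating sets are symmetric ($s\in S\Rightarrow s^{-1}\in S$). For a locally finite graph $\Gamma$, $|\Gamma|$ denotes its Freudenthal compactification (the graph together with its ends). A Hamilton circle of $\Gamma$ is a subspace of $|\Gamma|$ homeomorphic to $S^1$ containing every vertex of $\Gamma$. *)

theory Defs
  imports "HOL-Analysis.Analysis" "HOL-Algebra.Generated_Groups"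
begin

subsection \<open>Group-theoretic notions\<close>

definition dedekind_group :: "('a, 'm) monoid_scheme \<Rightarrow> bool" where
  "dedekind_group G \<longleftrightarrow> group G \<and> (\<forall>K. subgroup K G \<longrightarrow> K \<lhd> G)"

definition symmetric_generating_set :: "('a, 'm) monoid_scheme \<Rightarrow> 'a set \<Rightarrow> bool" where
  "symmetric_generating_set G S \<longleftrightarrow>
     S \<subseteq> carrier G \<and> (\<forall>s\<in>S. inv\<^bsub>G\<^esub> s \<in> S) \<and> generate G S = carrier G"

subsection \<open>Free products with amalgamation\<close>

text \<open>
  For a subgroup \<open>H\<close> of \<open>G\<close> and an embedding \<open>\<phi>\<close> of \<open>H\<close> into \<open>G'\<close>, the amalgam consists of the
  words with letters in the disjoint union of \<open>G\<close> and \<open>G'\<close>, modulo the congruence generated by the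
  relations that hold in \<open>G\<close>, those that hold in \<open>G'\<close>, and \<open>h = \<phi> h\<close> for \<open>h \<in> H\<close>. It is the
  pushout of the two groups: see \<open>group_amalgam\<close> and \<open>amalgam_universal\<close> below.
\<close>

definition amalgam_words :: "('a, 'm) monoid_scheme \<Rightarrow> ('b, 'n) monoid_scheme \<Rightarrow> ('a + 'b) list set"
  where "amalgam_words G G' = lists (carrier G <+> carrier G')"

inductive amalgam_eq ::
  "('a, 'm) monoid_scheme \<Rightarrow> ('b, 'n) monoid_scheme \<Rightarrow> 'a set \<Rightarrow> ('a \<Rightarrow> 'b)
    \<Rightarrow> ('a + 'b) list \<Rightarrow> ('a + 'b) list \<Rightarrow> bool"
  for G G' H \<phi> where
  refl: "w \<in> amalgam_words G G' \<Longrightarrow> amalgam_eq G G' H \<phi> w w"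
| sym: "amalgam_eq G G' H \<phi> v w \<Longrightarrow> amalgam_eq G G' H \<phi> w v"
| trans: "amalgam_eq G G' H \<phi> u v \<Longrightarrow> amalgam_eq G G' H \<phi> v w \<Longrightarrow> amalgam_eq G G' H \<phi> u w"
| one_left: "u \<in> amalgam_words G G' \<Longrightarrow> v \<in> amalgam_words G G' \<Longrightarrow>
    amalgam_eq G G' H \<phi> (u @ [Inl \<one>\<^bsub>G\<^esub>] @ v) (u @ v)"
| one_right: "u \<in> amalgam_words G G' \<Longrightarrow> v \<in> amalgam_words G G' \<Longrightarrow>
    amalgam_eq G G' H \<phi> (u @ [Inr \<one>\<^bsub>G'\<^esub>] @ v) (u @ v)"
| mult_left: "u \<in> amalgam_words G G' \<Longrightarrow> v \<in> amalgam_words G G' \<Longrightarrow>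
    x \<in> carrier G \<Longrightarrow> y \<in> carrier G \<Longrightarrow>
    amalgam_eq G G' H \<phi> (u @ [Inl x, Inl y] @ v) (u @ [Inl (x \<otimes>\<^bsub>G\<^esub> y)] @ v)"
| mult_right: "u \<in> amalgam_words G G' \<Longrightarrow> v \<in> amalgam_words G G' \<Longrightarrow>
    x \<in> carrier G' \<Longrightarrow> y \<in> carrier G' \<Longrightarrow>
    amalgam_eq G G' H \<phi> (u @ [Inr x, Inr y] @ v) (u @ [Inr (x \<otimes>\<^bsub>G'\<^esub> y)] @ v)"
| glue: "u \<in> amalgam_words G G' \<Longrightarrow> v \<in> amalgam_words G G' \<Longrightarrow> h \<in> H \<Longrightarrow>
    amalgam_eq G G' H \<phi> (u @ [Inl h] @ v) (u @ [Inr (\<phi> h)] @ v)"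

definition amalgam_class ::
  "('a, 'm) monoid_scheme \<Rightarrow> ('b, 'n) monoid_scheme \<Rightarrow> 'a set \<Rightarrow> ('a \<Rightarrow> 'b)
    \<Rightarrow> ('a + 'b) list \<Rightarrow> ('a + 'b) list set" where
  "amalgam_class G G' H \<phi> w = {v. amalgam_eq G G' H \<phi> w v}"

definition amalgam ::
  "('a, 'm) monoid_scheme \<Rightarrow> ('b, 'n) monoid_scheme \<Rightarrow> 'a set \<Rightarrow> ('a \<Rightarrow> 'b)
    \<Rightarrow> ('a + 'b) list set monoid" where
  "amalgam G G' H \<phi> =
     \<lparr>carrier = amalgam_class G G' H \<phi> ` amalgam_words G G',
      mult = (\<lambda>A B. \<Union>u\<in>A. \<Union>v\<in>B. amalgam_class G G' H \<phi> (u @ v)),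
      one = amalgam_class G G' H \<phi> []\<rparr>"

definition amalgam_inl ::
  "('a, 'm) monoid_scheme \<Rightarrow> ('b, 'n) monoid_scheme \<Rightarrow> 'a set \<Rightarrow> ('a \<Rightarrow> 'b)
    \<Rightarrow> 'a \<Rightarrow> ('a + 'b) list set" where
  "amalgam_inl G G' H \<phi> x = amalgam_class G G' H \<phi> [Inl x]"

definition amalgam_inr ::
  "('a, 'm) monoid_scheme \<Rightarrow> ('b, 'n) monoid_scheme \<Rightarrow> 'a set \<Rightarrow> ('a \<Rightarrow> 'b)
    \<Rightarrow> 'b \<Rightarrow> ('a + 'b) list set" where
  "amalgam_inr G G' H \<phi> y = amalgam_class G G' H \<phi> [Inr y]"

lemma amalgam_words_simps [simp]:
  "[] \<in> amalgam_words G G'"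
  "u @ v \<in> amalgam_words G G' \<longleftrightarrow> u \<in> amalgam_words G G' \<and> v \<in> amalgam_words G G'"
  "Inl x # u \<in> amalgam_words G G' \<longleftrightarrow> x \<in> carrier G \<and> u \<in> amalgam_words G G'"
  "Inr y # u \<in> amalgam_words G G' \<longleftrightarrow> y \<in> carrier G' \<and> u \<in> amalgam_words G G'"
  by (simp_all add: amalgam_words_def Plus_def image_iff)

context
  fixes G :: "('a, 'm) monoid_scheme" and G' :: "('b, 'n) monoid_scheme"
    and H :: "'a set" and \<phi> :: "'a \<Rightarrow> 'b"
  assumes G: "group G" and G': "group G'"
    and H: "H \<subseteq> carrier G" and \<phi>: "\<phi> ` H \<subseteq> carrier G'"
begin

interpretation G: group G by (fact G)
interpretation G': group G' by (fact G')

lemma amalgam_eq_words: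
  assumes "amalgam_eq G G' H \<phi> u v"
  shows "u \<in> amalgam_words G G'" "v \<in> amalgam_words G G'"
proof -
  have "u \<in> amalgam_words G G' \<and> v \<in> amalgam_words G G'"
    using assms
  proof (induction rule: amalgam_eq.induct)
    case (glue u v h)
    then have "h \<in> carrier G" "\<phi> h \<in> carrier G'" using H \<phi> by auto
    with glue show ?case by simp
  qed simp_all
  then show "u \<in> amalgam_words G G'" "v \<in> amalgam_words G G'" by simp_all
qed

lemma amalgam_eq_append_left:
  assumes "amalgam_eq G G' H \<phi> u v" "w \<in> amalgam_words G G'"
  shows "amalgam_eq G G' H \<phi> (w @ u) (w @ v)"
  using assms
proof (induction rule: amalgam_eq.induct)
  case (one_left u v)
  then show ?case using amalgam_eq.one_left[of "w @ u" G G' v] by simp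
next
  case (one_right u v)
  then show ?case using amalgam_eq.one_right[of "w @ u" G G' v] by simp
next
  case (mult_left u v x y)
  then show ?case using amalgam_eq.mult_left[of "w @ u" G G' v x y] by simp
next
  case (mult_right u v x y)
  then show ?case using amalgam_eq.mult_right[of "w @ u" G G' v x y] by simp
next
  case (glue u v h)
  then show ?case using amalgam_eq.glue[of "w @ u" G G' v h] by simp
next
  case (refl v)
  then show ?case by (simp add: amalgam_eq.refl)
next
  case (sym u v)
  then show ?case using amalgam_eq.sym by blast
next
  case (trans u u' v)
  then show ?case using amalgam_eq.trans by blast
qed

lemma amalgam_eq_append_right:
  assumes "amalgam_eq G G' H \<phi> u v" "w \<in> amalgam_words G G'"
  shows "amalgam_eq G G' H \<phi> (u @ w) (v @ w)"
  using assms
proof (induction rule: amalgam_eq.induct)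
  case (one_left u v)
  then show ?case using amalgam_eq.one_left[of u G G' "v @ w"] by simp
next
  case (one_right u v)
  then show ?case using amalgam_eq.one_right[of u G G' "v @ w"] by simp
next
  case (mult_left u v x y)
  then show ?case using amalgam_eq.mult_left[of u G G' "v @ w" x y] by simp
next
  case (mult_right u v x y)
  then show ?case using amalgam_eq.mult_right[of u G G' "v @ w" x y] by simp
next
  case (glue u v h)
  then show ?case using amalgam_eq.glue[of u G G' "v @ w" h] by simp
next
  case (refl v)
  then show ?case by (simp add: amalgam_eq.refl)
next
  case (sym u v)
  then show ?case using amalgam_eq.sym by blast
next
  case (trans u u' v)
  then show ?case using amalgam_eq.trans by blast
qed

lemma amalgam_eq_append:
  assumes "amalgam_eq G G' H \<phi> u u'" "amalgam_eq G G' H \<phi> v v'"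
  shows "amalgam_eq G G' H \<phi> (u @ v) (u' @ v')"
  using amalgam_eq_append_right[OF assms(1) amalgam_eq_words(1)[OF assms(2)]]
    amalgam_eq_append_left[OF assms(2) amalgam_eq_words(2)[OF assms(1)]]
  by (rule amalgam_eq.trans)

lemma amalgam_class_eq_iff:
  assumes "u \<in> amalgam_words G G'"
  shows "amalgam_class G G' H \<phi> u = amalgam_class G G' H \<phi> v \<longleftrightarrow> amalgam_eq G G' H \<phi> u v"
proof
  assume "amalgam_class G G' H \<phi> u = amalgam_class G G' H \<phi> v"
  moreover have "u \<in> amalgam_class G G' H \<phi> u"
    by (simp add: amalgam_class_def amalgam_eq.refl assms)
  ultimately show "amalgam_eq G G' H \<phi> u v"
    unfolding amalgam_class_def using amalgam_eq.sym by blast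
next
  assume "amalgam_eq G G' H \<phi> u v"
  then show "amalgam_class G G' H \<phi> u = amalgam_class G G' H \<phi> v"
    unfolding amalgam_class_def using amalgam_eq.sym amalgam_eq.trans by blast
qed

lemma amalgam_mult_class:
  assumes "u \<in> amalgam_words G G'" "v \<in> amalgam_words G G'"
  shows "amalgam_class G G' H \<phi> u \<otimes>\<^bsub>amalgam G G' H \<phi>\<^esub> amalgam_class G G' H \<phi> v =
         amalgam_class G G' H \<phi> (u @ v)"
proof -
  have "amalgam_class G G' H \<phi> (u' @ v') = amalgam_class G G' H \<phi> (u @ v)"
    if "u' \<in> amalgam_class G G' H \<phi> u" "v' \<in> amalgam_class G G' H \<phi> v" for u' v'
    using that amalgam_eq_append[of u u' v v'] assms amalgam_class_eq_iff[of "u @ v" "u' @ v'"]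
    by (auto simp: amalgam_class_def)
  moreover have "u \<in> amalgam_class G G' H \<phi> u" "v \<in> amalgam_class G G' H \<phi> v"
    using assms by (auto simp: amalgam_class_def intro: amalgam_eq.refl)
  ultimately have "(\<Union>u'\<in>amalgam_class G G' H \<phi> u. \<Union>v'\<in>amalgam_class G G' H \<phi> v.
      amalgam_class G G' H \<phi> (u' @ v')) = amalgam_class G G' H \<phi> (u @ v)"
    by blast
  then show ?thesis by (simp add: amalgam_def)
qed

lemma amalgam_left_inverse:
  "w \<in> amalgam_words G G' \<Longrightarrow>
   \<exists>v\<in>amalgam_words G G'. amalgam_eq G G' H \<phi> (v @ w) []"
proof (induction w)
  case Nil
  then show ?case by (auto intro!: bexI[of _ "[]"] amalgam_eq.refl)
next
  case (Cons a w)
  obtain b where b: "[b] \<in> amalgam_words G G'" "amalgam_eq G G' H \<phi> [b, a] []"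
  proof (cases a)
    case (Inl x)
    then have x: "x \<in> carrier G" using Cons.prems by simp
    have "amalgam_eq G G' H \<phi> [Inl (inv\<^bsub>G\<^esub> x), Inl x] [Inl \<one>\<^bsub>G\<^esub>]"
      using amalgam_eq.mult_left[of "[]" G G' "[]" "inv\<^bsub>G\<^esub> x" x] x by simp
    moreover have "amalgam_eq G G' H \<phi> [Inl \<one>\<^bsub>G\<^esub>] []"
      using amalgam_eq.one_left[of "[]" G G' "[]"] by simp
    ultimately have "amalgam_eq G G' H \<phi> [Inl (inv\<^bsub>G\<^esub> x), Inl x] []" by (rule amalgam_eq.trans)
    then show thesis using that[of "Inl (inv\<^bsub>G\<^esub> x)"] x Inl by simp
  next
    case (Inr x)
    then have x: "x \<in> carrier G'" using Cons.prems by simp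
    have "amalgam_eq G G' H \<phi> [Inr (inv\<^bsub>G'\<^esub> x), Inr x] [Inr \<one>\<^bsub>G'\<^esub>]"
      using amalgam_eq.mult_right[of "[]" G G' "[]" "inv\<^bsub>G'\<^esub> x" x] x by simp
    moreover have "amalgam_eq G G' H \<phi> [Inr \<one>\<^bsub>G'\<^esub>] []"
      using amalgam_eq.one_right[of "[]" G G' "[]"] by simp
    ultimately have "amalgam_eq G G' H \<phi> [Inr (inv\<^bsub>G'\<^esub> x), Inr x] []" by (rule amalgam_eq.trans)
    then show thesis using that[of "Inr (inv\<^bsub>G'\<^esub> x)"] x Inr by simp
  qed
  have w: "w \<in> amalgam_words G G'" using Cons.prems by (auto simp: amalgam_words_def)
  then obtain v where v: "v \<in> amalgam_words G G'" "amalgam_eq G G' H \<phi> (v @ w) []"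
    using Cons.IH by blast
  have "amalgam_eq G G' H \<phi> (v @ [b, a] @ w) (v @ w)"
    using amalgam_eq_append_left[OF amalgam_eq_append_right[OF b(2) w] v(1)] by simp
  then have "amalgam_eq G G' H \<phi> ((v @ [b]) @ a # w) []"
    using amalgam_eq.trans[OF _ v(2)] by simp
  then show ?case using b(1) v(1) by (intro bexI[of _ "v @ [b]"]) auto
qed

lemma group_amalgam: "group (amalgam G G' H \<phi>)"
proof (rule groupI)
  show "\<one>\<^bsub>amalgam G G' H \<phi>\<^esub> \<in> carrier (amalgam G G' H \<phi>)"
    by (simp add: amalgam_def)
next
  fix A B assume "A \<in> carrier (amalgam G G' H \<phi>)" "B \<in> carrier (amalgam G G' H \<phi>)"
  then obtain u v where "A = amalgam_class G G' H \<phi> u" "u \<in> amalgam_words G G'"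
      "B = amalgam_class G G' H \<phi> v" "v \<in> amalgam_words G G'"
    by (auto simp: amalgam_def)
  then have "A \<otimes>\<^bsub>amalgam G G' H \<phi>\<^esub> B = amalgam_class G G' H \<phi> (u @ v)"
      "u @ v \<in> amalgam_words G G'"
    by (simp_all add: amalgam_mult_class)
  then show "A \<otimes>\<^bsub>amalgam G G' H \<phi>\<^esub> B \<in> carrier (amalgam G G' H \<phi>)"
    by (simp add: amalgam_def)
next
  fix A B C
  assume "A \<in> carrier (amalgam G G' H \<phi>)" "B \<in> carrier (amalgam G G' H \<phi>)"
    "C \<in> carrier (amalgam G G' H \<phi>)"
  then obtain u v w where "A = amalgam_class G G' H \<phi> u" "u \<in> amalgam_words G G'"
      "B = amalgam_class G G' H \<phi> v" "v \<in> amalgam_words G G'"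
      "C = amalgam_class G G' H \<phi> w" "w \<in> amalgam_words G G'"
    by (auto simp: amalgam_def)
  then show "A \<otimes>\<^bsub>amalgam G G' H \<phi>\<^esub> B \<otimes>\<^bsub>amalgam G G' H \<phi>\<^esub> C =
      A \<otimes>\<^bsub>amalgam G G' H \<phi>\<^esub> (B \<otimes>\<^bsub>amalgam G G' H \<phi>\<^esub> C)"
    by (simp add: amalgam_mult_class)
next
  fix A assume "A \<in> carrier (amalgam G G' H \<phi>)"
  then obtain u where u: "A = amalgam_class G G' H \<phi> u" "u \<in> amalgam_words G G'"
    by (auto simp: amalgam_def)
  have one: "\<one>\<^bsub>amalgam G G' H \<phi>\<^esub> = amalgam_class G G' H \<phi> []"
    by (simp add: amalgam_def)
  show "\<one>\<^bsub>amalgam G G' H \<phi>\<^esub> \<otimes>\<^bsub>amalgam G G' H \<phi>\<^esub> A = A"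
    using u amalgam_mult_class[of "[]" u] by (simp add: one)
  obtain v where v: "v \<in> amalgam_words G G'" "amalgam_eq G G' H \<phi> (v @ u) []"
    using amalgam_left_inverse u(2) by blast
  then have "amalgam_class G G' H \<phi> v \<otimes>\<^bsub>amalgam G G' H \<phi>\<^esub> A = \<one>\<^bsub>amalgam G G' H \<phi>\<^esub>"
    using u amalgam_mult_class[of v u] by (simp add: one amalgam_class_eq_iff)
  then show "\<exists>B\<in>carrier (amalgam G G' H \<phi>). B \<otimes>\<^bsub>amalgam G G' H \<phi>\<^esub> A = \<one>\<^bsub>amalgam G G' H \<phi>\<^esub>"
  proof (rule bexI)
    show "amalgam_class G G' H \<phi> v \<in> carrier (amalgam G G' H \<phi>)"
      using v(1) by (simp add: amalgam_def)
  qed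
qed

lemma amalgam_inl_hom: "amalgam_inl G G' H \<phi> \<in> hom G (amalgam G G' H \<phi>)"
proof (rule homI)
  fix x assume "x \<in> carrier G"
  then have "[Inl x] \<in> amalgam_words G G'" by simp
  then show "amalgam_inl G G' H \<phi> x \<in> carrier (amalgam G G' H \<phi>)"
    unfolding amalgam_inl_def amalgam_def partial_object.simps by (rule imageI)
next
  fix x y assume x: "x \<in> carrier G" and y: "y \<in> carrier G"
  have "amalgam_eq G G' H \<phi> [Inl x, Inl y] [Inl (x \<otimes>\<^bsub>G\<^esub> y)]"
    using amalgam_eq.mult_left[of "[]" G G' "[]" x y H \<phi>] x y by simp
  then have "amalgam_class G G' H \<phi> [Inl (x \<otimes>\<^bsub>G\<^esub> y)] =
      amalgam_class G G' H \<phi> [Inl x, Inl y]"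
    using amalgam_class_eq_iff[of "[Inl x, Inl y]" "[Inl (x \<otimes>\<^bsub>G\<^esub> y)]"] x y by simp
  also have "\<dots> = amalgam_class G G' H \<phi> [Inl x] \<otimes>\<^bsub>amalgam G G' H \<phi>\<^esub> amalgam_class G G' H \<phi> [Inl y]"
    using amalgam_mult_class[of "[Inl x]" "[Inl y]"] x y by simp
  finally show "amalgam_inl G G' H \<phi> (x \<otimes>\<^bsub>G\<^esub> y) =
      amalgam_inl G G' H \<phi> x \<otimes>\<^bsub>amalgam G G' H \<phi>\<^esub> amalgam_inl G G' H \<phi> y"
    by (simp only: amalgam_inl_def)
qed

lemma amalgam_inr_hom: "amalgam_inr G G' H \<phi> \<in> hom G' (amalgam G G' H \<phi>)"
proof (rule homI)
  fix x assume "x \<in> carrier G'"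
  then have "[Inr x] \<in> amalgam_words G G'" by simp
  then show "amalgam_inr G G' H \<phi> x \<in> carrier (amalgam G G' H \<phi>)"
    unfolding amalgam_inr_def amalgam_def partial_object.simps by (rule imageI)
next
  fix x y assume x: "x \<in> carrier G'" and y: "y \<in> carrier G'"
  have "amalgam_eq G G' H \<phi> [Inr x, Inr y] [Inr (x \<otimes>\<^bsub>G'\<^esub> y)]"
    using amalgam_eq.mult_right[of "[]" G G' "[]" x y H \<phi>] x y by simp
  then have "amalgam_class G G' H \<phi> [Inr (x \<otimes>\<^bsub>G'\<^esub> y)] =
      amalgam_class G G' H \<phi> [Inr x, Inr y]"
    using amalgam_class_eq_iff[of "[Inr x, Inr y]" "[Inr (x \<otimes>\<^bsub>G'\<^esub> y)]"] x y by simp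
  also have "\<dots> = amalgam_class G G' H \<phi> [Inr x] \<otimes>\<^bsub>amalgam G G' H \<phi>\<^esub> amalgam_class G G' H \<phi> [Inr y]"
    using amalgam_mult_class[of "[Inr x]" "[Inr y]"] x y by simp
  finally show "amalgam_inr G G' H \<phi> (x \<otimes>\<^bsub>G'\<^esub> y) =
      amalgam_inr G G' H \<phi> x \<otimes>\<^bsub>amalgam G G' H \<phi>\<^esub> amalgam_inr G G' H \<phi> y"
    by (simp only: amalgam_inr_def)
qed

lemma amalgam_inl_eq_inr:
  "h \<in> H \<Longrightarrow> amalgam_inl G G' H \<phi> h = amalgam_inr G G' H \<phi> (\<phi> h)"
  unfolding amalgam_inl_def amalgam_inr_def
  using amalgam_eq.glue[of "[]" G G' "[]" h H \<phi>] H
  by (subst amalgam_class_eq_iff) auto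

lemma amalgam_universal:
  fixes K :: "('c, 'k) monoid_scheme"
  assumes K: "group K" and f: "f \<in> hom G K" and g: "g \<in> hom G' K"
    and fg: "\<And>h. h \<in> H \<Longrightarrow> f h = g (\<phi> h)"
  shows "\<exists>k\<in>hom (amalgam G G' H \<phi>) K.
           (\<forall>x\<in>carrier G. k (amalgam_inl G G' H \<phi> x) = f x) \<and>
           (\<forall>y\<in>carrier G'. k (amalgam_inr G G' H \<phi> y) = g y)"
proof -
  interpret K: group K by (fact K)
  define ev where "ev w = foldr (\<lambda>a z. case_sum f g a \<otimes>\<^bsub>K\<^esub> z) w \<one>\<^bsub>K\<^esub>" for w :: "('a + 'b) list"
  have fc: "f x \<in> carrier K" if "x \<in> carrier G" for x using f that by (auto simp: hom_def)
  have gc: "g x \<in> carrier K" if "x \<in> carrier G'" for x using g that by (auto simp: hom_def)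
  have ev_simps: "ev [] = \<one>\<^bsub>K\<^esub>" "ev (Inl x # w) = f x \<otimes>\<^bsub>K\<^esub> ev w" "ev (Inr y # w) = g y \<otimes>\<^bsub>K\<^esub> ev w"
    for x y w by (simp_all add: ev_def)
  have ev_closed: "w \<in> amalgam_words G G' \<Longrightarrow> ev w \<in> carrier K" for w
  proof (induction w)
    case (Cons a w)
    then show ?case by (cases a) (auto simp: ev_simps fc gc)
  qed (simp add: ev_simps)
  have ev_append: "u \<in> amalgam_words G G' \<Longrightarrow> v \<in> amalgam_words G G' \<Longrightarrow>
      ev (u @ v) = ev u \<otimes>\<^bsub>K\<^esub> ev v" for u v
  proof (induction u)
    case (Cons a u)
    then show ?case by (cases a) (auto simp: ev_simps fc gc ev_closed K.m_assoc)
  qed (simp add: ev_simps ev_closed)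
  have f1: "f \<one>\<^bsub>G\<^esub> = \<one>\<^bsub>K\<^esub>" using hom_one[OF f G K] .
  have g1: "g \<one>\<^bsub>G'\<^esub> = \<one>\<^bsub>K\<^esub>" using hom_one[OF g G' K] .
  have ev_eq: "ev u = ev v" if "amalgam_eq G G' H \<phi> u v" for u v
    using that
  proof (induction rule: amalgam_eq.induct)
    case (mult_left u v x y)
    then show ?case using hom_mult[OF f, of x y]
      by (simp add: ev_append ev_simps ev_closed fc K.m_assoc)
  next
    case (mult_right u v x y)
    then show ?case using hom_mult[OF g, of x y]
      by (simp add: ev_append ev_simps ev_closed gc K.m_assoc)
  next
    case (glue u v h)
    then have "h \<in> carrier G" "\<phi> h \<in> carrier G'" using H \<phi> by auto
    with glue show ?case by (simp add: ev_append ev_simps fg)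
  qed (auto simp: ev_append ev_simps ev_closed f1 g1)
  define k where "k A = ev (SOME w. w \<in> A)" for A
  have k_class: "k (amalgam_class G G' H \<phi> w) = ev w" if w: "w \<in> amalgam_words G G'" for w
  proof -
    have "w \<in> amalgam_class G G' H \<phi> w"
      using w by (simp add: amalgam_class_def amalgam_eq.refl)
    then have "(SOME v. v \<in> amalgam_class G G' H \<phi> w) \<in> amalgam_class G G' H \<phi> w"
      by (rule someI)
    then show ?thesis using ev_eq by (auto simp: k_def amalgam_class_def)
  qed
  have "k \<in> hom (amalgam G G' H \<phi>) K"
  proof (rule homI)
    fix A assume "A \<in> carrier (amalgam G G' H \<phi>)"
    then show "k A \<in> carrier K" by (auto simp: amalgam_def k_class ev_closed)
  next
    fix A B assume "A \<in> carrier (amalgam G G' H \<phi>)" "B \<in> carrier (amalgam G G' H \<phi>)"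
    then obtain u v where "A = amalgam_class G G' H \<phi> u" "u \<in> amalgam_words G G'"
        "B = amalgam_class G G' H \<phi> v" "v \<in> amalgam_words G G'"
      by (auto simp: amalgam_def)
    then show "k (A \<otimes>\<^bsub>amalgam G G' H \<phi>\<^esub> B) = k A \<otimes>\<^bsub>K\<^esub> k B"
      by (simp add: amalgam_mult_class k_class ev_append)
  qed
  moreover have "k (amalgam_inl G G' H \<phi> x) = f x" if "x \<in> carrier G" for x
    using that by (simp add: amalgam_inl_def k_class ev_simps fc)
  moreover have "k (amalgam_inr G G' H \<phi> y) = g y" if "y \<in> carrier G'" for y
    using that by (simp add: amalgam_inr_def k_class ev_simps gc)
  ultimately show ?thesis by blast
qed

end

subsection \<open>Cayley graphs\<close>

text \<open>Graphs are undirected and simple; an edge is the two-element set of its end vertices.\<close>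

record 'v ugraph =
  verts :: "'v set"
  edges :: "'v set set"

definition cayley_graph :: "('a, 'm) monoid_scheme \<Rightarrow> 'a set \<Rightarrow> 'a ugraph" where
  "cayley_graph G S =
     \<lparr>verts = carrier G, edges = {{g, g \<otimes>\<^bsub>G\<^esub> s} |g s. g \<in> carrier G \<and> s \<in> S \<and> s \<noteq> \<one>\<^bsub>G\<^esub>}\<rparr>"

subsection \<open>Ends of a graph\<close>

definition component_of :: "'v ugraph \<Rightarrow> 'v set \<Rightarrow> 'v \<Rightarrow> 'v set" where
  "component_of \<Gamma> X v =
     {w. (v, w) \<in> {(x, y). {x, y} \<in> edges \<Gamma> \<and> x \<in> verts \<Gamma> - X \<and> y \<in> verts \<Gamma> - X}\<^sup>*}"

text \<open>The vertex sets of the components of \<open>\<Gamma> - X\<close>:\<close>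

definition components_minus :: "'v ugraph \<Rightarrow> 'v set \<Rightarrow> 'v set set" where
  "components_minus \<Gamma> X = component_of \<Gamma> X ` (verts \<Gamma> - X)"

definition rays :: "'v ugraph \<Rightarrow> (nat \<Rightarrow> 'v) set" where
  "rays \<Gamma> = {r. inj r \<and> range r \<subseteq> verts \<Gamma> \<and> (\<forall>n. {r n, r (Suc n)} \<in> edges \<Gamma>)}"

definition has_tail_in :: "(nat \<Rightarrow> 'v) \<Rightarrow> 'v set \<Rightarrow> bool" where
  "has_tail_in r C \<longleftrightarrow> (\<exists>N. \<forall>n\<ge>N. r n \<in> C)"

definition ray_equiv :: "'v ugraph \<Rightarrow> ((nat \<Rightarrow> 'v) \<times> (nat \<Rightarrow> 'v)) set" where
  "ray_equiv \<Gamma> =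
     {(r, r'). r \<in> rays \<Gamma> \<and> r' \<in> rays \<Gamma> \<and>
        (\<forall>X. finite X \<and> X \<subseteq> verts \<Gamma> \<longrightarrow>
           (\<exists>C\<in>components_minus \<Gamma> X. has_tail_in r C \<and> has_tail_in r' C))}"

definition graph_ends :: "'v ugraph \<Rightarrow> (nat \<Rightarrow> 'v) set set" where
  "graph_ends \<Gamma> = rays \<Gamma> // ray_equiv \<Gamma>"

subsection \<open>The Freudenthal compactification of a locally finite graph\<close>

text \<open>
  A point of the 1-complex \<open>\<Gamma>\<close> is represented by its barycentric coordinates, which are indexed by
  the vertices; so each edge is a copy of the unit interval without a chosen orientation
  (\<open>edge_point u v t = edge_point v u (1 - t)\<close>), and distinct edges meet only in common end vertices.
\<close>

datatype 'v fpoint = Pt "'v \<Rightarrow> real" | End "(nat \<Rightarrow> 'v) set"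

definition vertex_point :: "'v \<Rightarrow> 'v \<Rightarrow> real" where
  "vertex_point v = indicator {v}"

definition edge_point :: "'v \<Rightarrow> 'v \<Rightarrow> real \<Rightarrow> 'v \<Rightarrow> real" where
  "edge_point u v t = (\<lambda>w. (1 - t) * indicator {u} w + t * indicator {v} w)"

definition complex_points :: "'v ugraph \<Rightarrow> ('v \<Rightarrow> real) set" where
  "complex_points \<Gamma> =
     vertex_point ` verts \<Gamma> \<union> {edge_point u v t |u v t. {u, v} \<in> edges \<Gamma> \<and> t \<in> {0..1}}"

definition complex_open :: "'v ugraph \<Rightarrow> ('v \<Rightarrow> real) set \<Rightarrow> bool" where
  "complex_open \<Gamma> A \<longleftrightarrow>
     A \<subseteq> complex_points \<Gamma> \<and>
     (\<forall>u v. {u, v} \<in> edges \<Gamma> \<longrightarrow>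
        openin (top_of_set {0..1}) {t \<in> {0..1}. edge_point u v t \<in> A})"

text \<open>
  For a component \<open>C\<close> of \<open>\<Gamma> - X\<close>, the basic open set given by \<open>C\<close> consists of the subgraph induced
  by \<open>C\<close>, the inner points of the edges between \<open>C\<close> and \<open>X\<close>, and the ends living in \<open>C\<close>. The
  first two are together the points of the 1-complex with a positive coordinate in \<open>C\<close>.
\<close>

definition end_nbhd :: "'v ugraph \<Rightarrow> 'v set \<Rightarrow> 'v fpoint set" where
  "end_nbhd \<Gamma> C =
     Pt ` {x \<in> complex_points \<Gamma>. \<exists>v\<in>C. x v > 0} \<union>
     End ` {\<omega> \<in> graph_ends \<Gamma>. \<forall>r\<in>\<omega>. has_tail_in r C}"

definition freudenthal :: "'v ugraph \<Rightarrow> 'v fpoint topology" where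
  "freudenthal \<Gamma> = topology_generated_by
     ({Pt ` A |A. complex_open \<Gamma> A} \<union>
      {end_nbhd \<Gamma> C |X C \<omega>. finite X \<and> X \<subseteq> verts \<Gamma> \<and> C \<in> components_minus \<Gamma> X \<and>
         \<omega> \<in> graph_ends \<Gamma> \<and> (\<forall>r\<in>\<omega>. has_tail_in r C)})"

lemma topspace_freudenthal:
  "topspace (freudenthal \<Gamma>) = Pt ` complex_points \<Gamma> \<union> End ` graph_ends \<Gamma>"
proof
  show "topspace (freudenthal \<Gamma>) \<subseteq> Pt ` complex_points \<Gamma> \<union> End ` graph_ends \<Gamma>"
    by (auto simp: freudenthal_def end_nbhd_def complex_open_def)
next
  have "complex_open \<Gamma> (complex_points \<Gamma>)"
  proof -
    have "{t \<in> {0..1}. edge_point u v t \<in> complex_points \<Gamma>} = {0..1}" if "{u, v} \<in> edges \<Gamma>" for u v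
      using that by (auto simp: complex_points_def)
    then show ?thesis by (simp add: complex_open_def)
  qed
  moreover have "End \<omega> \<in> topspace (freudenthal \<Gamma>)" if \<omega>: "\<omega> \<in> graph_ends \<Gamma>" for \<omega>
  proof -
    obtain r where r: "r \<in> rays \<Gamma>" "\<omega> = ray_equiv \<Gamma> `` {r}"
      using \<omega> by (auto simp: graph_ends_def elim: quotientE)
    define R where "R = {(x, y). {x, y} \<in> edges \<Gamma> \<and> x \<in> verts \<Gamma> - {} \<and> y \<in> verts \<Gamma> - {}}"
    define C where "C = component_of \<Gamma> {} (r 0)"
    have C: "C \<in> components_minus \<Gamma> {}"
      using r(1) by (auto simp: C_def components_minus_def rays_def)
    have CR: "C = {w. (r 0, w) \<in> R\<^sup>*}" by (simp add: C_def R_def component_of_def)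
    have rC: "r n \<in> C" for n
    proof (induction n)
      case (Suc n)
      have "(r n, r (Suc n)) \<in> R" using r(1) by (auto simp: R_def rays_def)
      with Suc show ?case by (auto simp: CR intro: rtrancl_into_rtrancl)
    qed (simp add: CR)
    have "has_tail_in r' C" if "r' \<in> \<omega>" for r'
    proof -
      have "r' \<in> rays \<Gamma>" "\<exists>D\<in>components_minus \<Gamma> {}. has_tail_in r D \<and> has_tail_in r' D"
        using that r by (auto simp: ray_equiv_def)
      then obtain d where D: "has_tail_in r (component_of \<Gamma> {} d)" "has_tail_in r' (component_of \<Gamma> {} d)"
        by (auto simp: components_minus_def)
      have symR: "sym (R\<^sup>*)" by (intro sym_rtrancl) (auto simp: sym_def R_def insert_commute)
      from D(1) obtain n where "(d, r n) \<in> R\<^sup>*"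
        by (auto simp: has_tail_in_def component_of_def R_def)
      then have "(r n, d) \<in> R\<^sup>*" using symR by (rule symD[rotated])
      then have d: "(r 0, d) \<in> R\<^sup>*" using rC[of n] rtrancl_trans[of "r 0" "r n" R d] by (simp add: CR)
      have "component_of \<Gamma> {} d \<subseteq> C"
        unfolding CR component_of_def R_def[symmetric] using rtrancl_trans[OF d] by blast
      then show ?thesis using D(2) unfolding has_tail_in_def by blast
    qed
    then have "End \<omega> \<in> end_nbhd \<Gamma> C" using \<omega> by (auto simp: end_nbhd_def)
    then show ?thesis unfolding freudenthal_def topology_generated_by_topspace
      using C \<omega> \<open>\<And>r'. r' \<in> \<omega> \<Longrightarrow> has_tail_in r' C\<close> by blast
  qed
  ultimately show "Pt ` complex_points \<Gamma> \<union> End ` graph_ends \<Gamma> \<subseteq> topspace (freudenthal \<Gamma>)"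
  proof (intro Un_least)
    assume "complex_open \<Gamma> (complex_points \<Gamma>)"
    then show "Pt ` complex_points \<Gamma> \<subseteq> topspace (freudenthal \<Gamma>)"
      unfolding freudenthal_def topology_generated_by_topspace by blast
  qed blast
qed

definition hamilton_circle :: "'v ugraph \<Rightarrow> 'v fpoint set \<Rightarrow> bool" where
  "hamilton_circle \<Gamma> C \<longleftrightarrow>
     C \<subseteq> topspace (freudenthal \<Gamma>) \<and>
     subtopology (freudenthal \<Gamma>) C homeomorphic_space top_of_set (sphere (0 :: complex) 1) \<and>
     Pt ` vertex_point ` verts \<Gamma> \<subseteq> C"

end

theory Submission
  imports Defs "HOL-Algebra.Bij"
begin

text \<open>
  In the amalgam \<open>A\<close> the subgroup \<open>H\<close> is normal and \<open>A / H\<close> is the infinite dihedral group, so the cosets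
  of \<open>H\<close> are arranged in a line. Its edges belong alternately to \<open>G\<close> and to \<open>G'\<close>, and the graph has
  exactly two ends. A Hamilton circle therefore arises from two disjoint double rays that cover all
  vertices and run from one end to the other.

  The line is cut into the left cosets of \<open>G\<close>, and neighbouring cosets are joined by the perfect
  matching given by right multiplication with some \<open>b \<in> S' - H'\<close>. So it suffices to show: for distinct
  \<open>x, y\<close> in the same coset of \<open>H\<close>, the coset \<open>x G\<close> is covered by two disjoint paths that start at \<open>x\<close>
  and \<open>y\<close> and end outside \<open>x H\<close>. Let \<open>K\<close> be the subgroup generated by \<open>S \<inter> H\<close>. All subgroups of \<open>G\<close>
  being normal, there is a Hamilton path of \<open>K\<close> and a Hamilton path of \<open>G / K\<close> with respect to \<open>S - H\<close>;
  the latter alternates between \<open>H\<close> and its complement, hence ends outside \<open>H\<close>. If \<open>y\<close> is not in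
  \<open>x K\<close>, the path of cosets is cut just before \<open>y K\<close>. If it is, then in the first two cosets of \<open>K\<close> the
  Hamilton path of \<open>K\<close> is cut in two pieces; one of the two paths ends there, and the other one
  visits the remaining cosets.
\<close>

section \<open>The Freudenthal compactification of a locally finite graph is Hausdorff\<close>

text \<open>Something must force a path of cosets to end outside \<open>H\<close>. Steps from
  \<open>S - H\<close> alternate between \<open>H\<close> and its complement, both contain equally
  many cosets of \<open>K\<close>, and the path starts in \<open>H\<close>. Generators inside
  \<open>H\<close> would spoil the alternation; this is why they are absorbed into \<open>K\<close>.

  The line of cosets is encoded by a homomorphism \<open>level\<close> into the infinite dihedral
  group, obtained from the universal property with the reflections 1 and -1 as images of
  \<open>G - H\<close> and \<open>G' - H'\<close>. Its fibres are the cosets of \<open>H\<close>, so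
  that membership in a piece of the line becomes a condition on integers.

  Sweeping through one coset of \<open>G\<close> after another covers only the levels from 0
  upwards. Left multiplication by \<open>b\<close> is an automorphism of the Cayley graph that
  exchanges level \<open>n\<close> and \<open>-1 - n\<close>, so a second sweep, moved by
  \<open>b\<close>, covers the rest. Starting the sweeps at 1, \<open>h\<close> and at 1,
  \<open>b^-1 h b\<close> makes them fit: the moved starting points are \<open>b\<close> and
  \<open>h b\<close>, neighbours of 1 and \<open>h\<close>.

  The two double rays converge to the same ends because every coset of \<open>G\<close> contains an
  edge between them.\<close>

locale locally_finite_graph =
  fixes \<Gamma> :: "'v ugraph"
  assumes edge_cases: "e \<in> edges \<Gamma> \<Longrightarrow> \<exists>u\<in>verts \<Gamma>. \<exists>v\<in>verts \<Gamma>. u \<noteq> v \<and> e = {u, v}"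
    and finite_neighbours: "v \<in> verts \<Gamma> \<Longrightarrow> finite {w. {v, w} \<in> edges \<Gamma>}"
begin

section \<open>Points and open sets of the 1-complex\<close>

lemma edge_verts:
  assumes "{u, v} \<in> edges \<Gamma>"
  shows "u \<in> verts \<Gamma>" "v \<in> verts \<Gamma>" "u \<noteq> v"
  using edge_cases[OF assms] by (auto simp: doubleton_eq_iff)

lemma complex_points_cases:
  assumes "x \<in> complex_points \<Gamma>"
  obtains (vertex) v where "v \<in> verts \<Gamma>" "x = vertex_point v"
  | (edge) u v t where "{u, v} \<in> edges \<Gamma>" "t \<in> {0..1}" "x = edge_point u v t"
  using assms by (auto simp: complex_points_def)

text \<open>Positive coordinates occur only at the end vertices of an edge through the point. This
  recovers adjacency from coordinates and serves to exclude common points of two basic open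
  sets.\<close>

lemma complex_points_support_edge:
  assumes "x \<in> complex_points \<Gamma>" "0 < x v" "0 < x w" "v \<noteq> w"
  shows "{v, w} \<in> edges \<Gamma>"
  using assms(1)
proof (cases rule: complex_points_cases)
  case (vertex u)
  with assms(2-4) show ?thesis by (simp add: vertex_point_def indicator_def split: if_splits)
next
  case (edge a b t)
  have "y = a \<or> y = b" if "0 < x y" for y
    using that edge(3) by (cases "y = a"; cases "y = b") (simp_all add: edge_point_def)
  with assms(2-4) have "v = a \<and> w = b \<or> v = b \<and> w = a" by blast
  with edge(1) show ?thesis by (auto simp: insert_commute)
qed

lemma complex_points_support:
  assumes "x \<in> complex_points \<Gamma>"
  obtains v where "v \<in> verts \<Gamma>" "0 < x v"
  using assms
proof (cases rule: complex_points_cases)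
  case (vertex v)
  then show ?thesis using that[of v] by (simp add: vertex_point_def)
next
  case (edge u v t)
  show ?thesis
  proof (cases "t < 1")
    case True
    with edge edge_verts[OF edge(1)] that[of u] show ?thesis
      by (auto simp: edge_point_def indicator_def)
  next
    case False
    with edge edge_verts[OF edge(1)] that[of v] show ?thesis
      by (auto simp: edge_point_def indicator_def)
  qed
qed

lemma complex_open_Union:
  assumes "\<And>A. A \<in> \<A> \<Longrightarrow> complex_open \<Gamma> A"
  shows "complex_open \<Gamma> (\<Union>\<A>)"
  unfolding complex_open_def
proof (intro conjI allI impI)
  show "\<Union>\<A> \<subseteq> complex_points \<Gamma>" using assms by (auto simp: complex_open_def)
next
  fix u v assume "{u, v} \<in> edges \<Gamma>"
  moreover have "{t \<in> {0..1}. edge_point u v t \<in> \<Union>\<A>} = (\<Union>A\<in>\<A>. {t \<in> {0..1}. edge_point u v t \<in> A})"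
    by auto
  ultimately show "openin (top_of_set {0..1}) {t \<in> {0..1}. edge_point u v t \<in> \<Union>\<A>}"
    using assms by (auto simp: complex_open_def intro!: openin_Union)
qed

text \<open>Along an edge every coordinate is an affine function of the edge parameter. The open
  sets that separate points are of this kind.\<close>

lemma complex_open_coordinate:
  assumes "open I"
  shows "complex_open \<Gamma> {x \<in> complex_points \<Gamma>. x w \<in> I}"
  unfolding complex_open_def
proof (intro conjI allI impI)
  fix u v assume uv: "{u, v} \<in> edges \<Gamma>"
  have "continuous_on {0..1} (\<lambda>t. edge_point u v t w)"
    unfolding edge_point_def by (intro continuous_intros)
  then have "openin (top_of_set {0..1}) ({0..1} \<inter> (\<lambda>t. edge_point u v t w) -` I)"
    using assms by (rule continuous_openin_preimage_gen)
  moreover have "{0..1} \<inter> (\<lambda>t. edge_point u v t w) -` I =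
      {t \<in> {0..1}. edge_point u v t \<in> {x \<in> complex_points \<Gamma>. x w \<in> I}}"
    using uv by (auto simp: complex_points_def)
  ultimately show "openin (top_of_set {0..1})
      {t \<in> {0..1}. edge_point u v t \<in> {x \<in> complex_points \<Gamma>. x w \<in> I}}"
    by simp
qed auto

lemma complex_open_positive: "complex_open \<Gamma> {x \<in> complex_points \<Gamma>. \<exists>v\<in>C. x v > 0}"
proof -
  have "{x \<in> complex_points \<Gamma>. \<exists>v\<in>C. x v > 0} = (\<Union>v\<in>C. {x \<in> complex_points \<Gamma>. x v \<in> {0<..}})"
    by auto
  also have "complex_open \<Gamma> \<dots>"
    by (intro complex_open_Union) (use complex_open_coordinate[OF open_greaterThan] in blast)
  finally show ?thesis .
qed

lemma openin_freudenthal_complex: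
  "complex_open \<Gamma> A \<Longrightarrow> openin (freudenthal \<Gamma>) (Pt ` A)"
  unfolding freudenthal_def by (rule topology_generated_by_Basis) blast

lemma openin_freudenthal_end_nbhd:
  assumes "finite X" "X \<subseteq> verts \<Gamma>" "C \<in> components_minus \<Gamma> X"
    "\<omega> \<in> graph_ends \<Gamma>" "\<forall>r\<in>\<omega>. has_tail_in r C"
  shows "openin (freudenthal \<Gamma>) (end_nbhd \<Gamma> C)"
  unfolding freudenthal_def by (rule topology_generated_by_Basis) (use assms in blast)

section \<open>Components of a vertex-deleted graph and the ends living in them\<close>

lemma components_minus_subset: "C \<in> components_minus \<Gamma> X \<Longrightarrow> C \<subseteq> verts \<Gamma> - X"
  by (auto simp: components_minus_def component_of_def elim: rtranclE)

lemma components_minus_cover: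
  "v \<in> verts \<Gamma> \<Longrightarrow> v \<notin> X \<Longrightarrow> \<exists>C\<in>components_minus \<Gamma> X. v \<in> C"
  by (auto simp: components_minus_def component_of_def)

lemma components_minus_eq:
  assumes "C \<in> components_minus \<Gamma> X" "D \<in> components_minus \<Gamma> X" "v \<in> C" "v \<in> D"
  shows "C = D"
proof -
  define R where "R = {(x, y). {x, y} \<in> edges \<Gamma> \<and> x \<in> verts \<Gamma> - X \<and> y \<in> verts \<Gamma> - X}"
  obtain c d where C: "C = {w. (c, w) \<in> R\<^sup>*}" and D: "D = {w. (d, w) \<in> R\<^sup>*}"
    using assms by (auto simp: components_minus_def component_of_def R_def)
  have "sym (R\<^sup>*)" by (intro sym_rtrancl) (auto simp: sym_def R_def insert_commute)
  moreover have "(c, v) \<in> R\<^sup>*" "(d, v) \<in> R\<^sup>*" using assms(3,4) unfolding C D by simp_all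
  ultimately have "(c, d) \<in> R\<^sup>*" "(d, c) \<in> R\<^sup>*"
    by (blast intro: rtrancl_trans dest: symD)+
  then show ?thesis unfolding C D by (auto intro: rtrancl_trans)
qed

lemma components_minus_closed:
  assumes "C \<in> components_minus \<Gamma> X" "v \<in> C" "{v, w} \<in> edges \<Gamma>" "w \<notin> X"
  shows "w \<in> C"
  using assms edge_verts[OF assms(3)] components_minus_subset[OF assms(1)]
  by (auto simp: components_minus_def component_of_def intro: rtrancl_into_rtrancl)

lemma has_tail_in_common: "has_tail_in r C \<Longrightarrow> has_tail_in r D \<Longrightarrow> \<exists>n. r n \<in> C \<inter> D"
  unfolding has_tail_in_def by (metis IntI linorder_linear)

text \<open>A ray is injective, so it meets the finite set \<open>X\<close> only finitely often;
  after the last visit consecutive vertices stay in one component.\<close>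

lemma ray_tail_component:
  assumes r: "r \<in> rays \<Gamma>" and X: "finite X"
  shows "\<exists>C\<in>components_minus \<Gamma> X. has_tail_in r C"
proof -
  have "finite (r -` X)" using r X by (intro finite_vimageI) (auto simp: rays_def)
  then obtain N where N: "\<forall>n\<in>r -` X. n < N" using finite_nat_set_iff_bounded by blast
  then have out: "r n \<notin> X" if "n \<ge> N" for n
    using N that linorder_not_less by blast
  have "r N \<in> verts \<Gamma>" using r by (auto simp: rays_def)
  then obtain C where C: "C \<in> components_minus \<Gamma> X" "r N \<in> C"
    using components_minus_cover out by blast
  have "r n \<in> C" if "n \<ge> N" for n
    using that
  proof (induction n rule: dec_induct)
    case (step n)
    then show ?case
      using components_minus_closed[OF C(1)] r out[of "Suc n"] by (auto simp: rays_def)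
  qed (use C in simp)
  with C(1) show ?thesis by (auto simp: has_tail_in_def)
qed

lemma end_rays: "\<omega> \<in> graph_ends \<Gamma> \<Longrightarrow> \<exists>r\<in>rays \<Gamma>. \<omega> = ray_equiv \<Gamma> `` {r}"
  by (auto simp: graph_ends_def elim: quotientE)

lemma ray_equiv_refl: "r \<in> rays \<Gamma> \<Longrightarrow> (r, r) \<in> ray_equiv \<Gamma>"
  using ray_tail_component by (auto simp: ray_equiv_def)

text \<open>Every ray of the end shares a component with the representative, whose tails cannot lie
  in two different components; so one component serves the whole class.\<close>

lemma end_component:
  assumes "\<omega> \<in> graph_ends \<Gamma>" "finite X" "X \<subseteq> verts \<Gamma>"
  shows "\<exists>C\<in>components_minus \<Gamma> X. \<forall>r\<in>\<omega>. has_tail_in r C"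
proof -
  obtain r where r: "r \<in> rays \<Gamma>" and \<omega>: "\<omega> = ray_equiv \<Gamma> `` {r}" using end_rays assms(1) by blast
  obtain C where C: "C \<in> components_minus \<Gamma> X" "has_tail_in r C"
    using ray_tail_component[OF r assms(2)] by blast
  have "has_tail_in r' C" if r': "r' \<in> \<omega>" for r'
  proof -
    obtain D where D: "D \<in> components_minus \<Gamma> X" "has_tail_in r D" "has_tail_in r' D"
      using r' assms(2,3) unfolding \<omega> ray_equiv_def by blast
    with C have "C = D" using components_minus_eq[OF C(1) D(1)] has_tail_in_common by blast
    with D show ?thesis by simp
  qed
  with C show ?thesis by blast
qed

lemma end_nonempty: "\<omega> \<in> graph_ends \<Gamma> \<Longrightarrow> \<exists>r. r \<in> \<omega>"
  using end_rays ray_equiv_refl by blast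

text \<open>A common point would lie on an edge between two components, and a common end would
  contain a ray with tails in both.\<close>

lemma end_nbhd_disjoint:
  assumes C: "C \<in> components_minus \<Gamma> X" and D: "D \<in> components_minus \<Gamma> X" and "C \<noteq> D"
  shows "end_nbhd \<Gamma> C \<inter> end_nbhd \<Gamma> D = {}"
proof -
  have disj: "C \<inter> D = {}" using components_minus_eq[OF C D] \<open>C \<noteq> D\<close> by blast
  have "False" if "x \<in> complex_points \<Gamma>" "v \<in> C" "x v > 0" "w \<in> D" "x w > 0" for x v w
  proof -
    have "v \<noteq> w" using that disj by auto
    then have "{v, w} \<in> edges \<Gamma>" using complex_points_support_edge that by blast
    moreover have "w \<notin> X" using components_minus_subset[OF D] that by blast
    ultimately show False using components_minus_closed[OF C] that disj by blast
  qed
  moreover have "False" if "\<omega> \<in> graph_ends \<Gamma>" "\<forall>r\<in>\<omega>. has_tail_in r C" "\<forall>r\<in>\<omega>. has_tail_in r D" for \<omega>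
    using end_nonempty[OF that(1)] that has_tail_in_common disj by blast
  ultimately show ?thesis unfolding end_nbhd_def by blast
qed

lemma separate_point_end:
  assumes x: "x \<in> complex_points \<Gamma>" and \<omega>: "\<omega> \<in> graph_ends \<Gamma>"
  shows "\<exists>U V. openin (freudenthal \<Gamma>) U \<and> openin (freudenthal \<Gamma>) V \<and>
    Pt x \<in> U \<and> End \<omega> \<in> V \<and> U \<inter> V = {}"
proof -
  obtain v where v: "v \<in> verts \<Gamma>" "0 < x v" using complex_points_support[OF x] .
  \<comment> \<open>The neighbours of \<open>v\<close> are removed as well: otherwise inner points
    of an edge from \<open>v\<close> into \<open>C\<close> would lie in both neighbourhoods. Local
    finiteness keeps \<open>X\<close> finite.\<close>
  define X where "X = insert v {w. {v, w} \<in> edges \<Gamma>}"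
  have X: "finite X" "X \<subseteq> verts \<Gamma>"
    using v finite_neighbours edge_verts by (auto simp: X_def)
  obtain C where C: "C \<in> components_minus \<Gamma> X" "\<forall>r\<in>\<omega>. has_tail_in r C"
    using end_component[OF \<omega> X] by blast
  let ?U = "Pt ` {y \<in> complex_points \<Gamma>. y v \<in> {0<..}}"
  show ?thesis
  proof (intro exI conjI)
    show "openin (freudenthal \<Gamma>) ?U"
      by (intro openin_freudenthal_complex complex_open_coordinate open_greaterThan)
    show "openin (freudenthal \<Gamma>) (end_nbhd \<Gamma> C)"
      by (rule openin_freudenthal_end_nbhd[OF X C(1) \<omega> C(2)])
    show "Pt x \<in> ?U" using x v by simp
    show "End \<omega> \<in> end_nbhd \<Gamma> C" using \<omega> C by (simp add: end_nbhd_def)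
    have False if "y \<in> complex_points \<Gamma>" "0 < y v" "w \<in> C" "0 < y w" for y w
      using complex_points_support_edge[OF that(1,2,4)] components_minus_subset[OF C(1)] that(3)
      unfolding X_def by blast
    then show "?U \<inter> end_nbhd \<Gamma> C = {}" unfolding end_nbhd_def by auto
  qed
qed

lemma separate_points:
  assumes x: "x \<in> complex_points \<Gamma>" and y: "y \<in> complex_points \<Gamma>" and "x \<noteq> y"
  shows "\<exists>U V. openin (freudenthal \<Gamma>) U \<and> openin (freudenthal \<Gamma>) V \<and>
    Pt x \<in> U \<and> Pt y \<in> V \<and> U \<inter> V = {}"
proof -
  obtain v where "x v \<noteq> y v" using \<open>x \<noteq> y\<close> by blast
  then obtain I J where IJ: "open I" "open J" "x v \<in> I" "y v \<in> J" "I \<inter> J = {}"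
    using separation_t2[of "x v" "y v"] by blast
  show ?thesis
  proof (intro exI conjI)
    show "openin (freudenthal \<Gamma>) (Pt ` {z \<in> complex_points \<Gamma>. z v \<in> I})"
      "openin (freudenthal \<Gamma>) (Pt ` {z \<in> complex_points \<Gamma>. z v \<in> J})"
      using IJ by (simp_all add: openin_freudenthal_complex complex_open_coordinate)
    show "Pt x \<in> Pt ` {z \<in> complex_points \<Gamma>. z v \<in> I}" "Pt y \<in> Pt ` {z \<in> complex_points \<Gamma>. z v \<in> J}"
      using x y IJ by simp_all
    show "Pt ` {z \<in> complex_points \<Gamma>. z v \<in> I} \<inter> Pt ` {z \<in> complex_points \<Gamma>. z v \<in> J} = {}"
      using IJ(5) by auto
  qed
qed

lemma equiv_ray_equiv: "equiv (rays \<Gamma>) (ray_equiv \<Gamma>)"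
proof (rule equivI)
  show sub: "ray_equiv \<Gamma> \<subseteq> rays \<Gamma> \<times> rays \<Gamma>" by (auto simp: ray_equiv_def)
  show "refl_on (rays \<Gamma>) (ray_equiv \<Gamma>)" by (auto simp: refl_on_def ray_equiv_refl)
  show "sym (ray_equiv \<Gamma>)" by (auto simp: sym_def ray_equiv_def)
  show "trans (ray_equiv \<Gamma>)"
  proof (rule transI)
    fix r s t assume rs: "(r, s) \<in> ray_equiv \<Gamma>" and st: "(s, t) \<in> ray_equiv \<Gamma>"
    have "\<exists>C\<in>components_minus \<Gamma> X. has_tail_in r C \<and> has_tail_in t C"
      if X: "finite X" "X \<subseteq> verts \<Gamma>" for X
    proof -
      obtain C where C: "C \<in> components_minus \<Gamma> X" "has_tail_in r C" "has_tail_in s C"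
        using rs X unfolding ray_equiv_def by blast
      obtain D where D: "D \<in> components_minus \<Gamma> X" "has_tail_in s D" "has_tail_in t D"
        using st X unfolding ray_equiv_def by blast
      have "C = D"
        using components_minus_eq[OF C(1) D(1)] has_tail_in_common[OF C(3) D(2)] by blast
      with C D show ?thesis by blast
    qed
    moreover have "r \<in> rays \<Gamma>" "t \<in> rays \<Gamma>" using sub rs st by auto
    ultimately show "(r, t) \<in> ray_equiv \<Gamma>" by (auto simp only: ray_equiv_def)
  qed
qed

lemma separate_ends:
  assumes \<omega>: "\<omega> \<in> graph_ends \<Gamma>" and \<omega>': "\<omega>' \<in> graph_ends \<Gamma>" and "\<omega> \<noteq> \<omega>'"
  shows "\<exists>U V. openin (freudenthal \<Gamma>) U \<and> openin (freudenthal \<Gamma>) V \<and>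
    End \<omega> \<in> U \<and> End \<omega>' \<in> V \<and> U \<inter> V = {}"
proof -
  obtain r where r: "r \<in> rays \<Gamma>" "\<omega> = ray_equiv \<Gamma> `` {r}" using end_rays[OF \<omega>] by blast
  obtain r' where r': "r' \<in> rays \<Gamma>" "\<omega>' = ray_equiv \<Gamma> `` {r'}" using end_rays[OF \<omega>'] by blast
  have mem: "r \<in> \<omega>" "r' \<in> \<omega>'" using r r' ray_equiv_refl by auto
  have "(r, r') \<notin> ray_equiv \<Gamma>"
    using \<open>\<omega> \<noteq> \<omega>'\<close> r r' equiv_class_eq[OF equiv_ray_equiv] by blast
  then obtain X where X: "finite X" "X \<subseteq> verts \<Gamma>"
      and sep: "\<forall>C\<in>components_minus \<Gamma> X. \<not> (has_tail_in r C \<and> has_tail_in r' C)"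
    using r(1) r'(1) by (auto simp: ray_equiv_def)
  obtain C where C: "C \<in> components_minus \<Gamma> X" "\<forall>s\<in>\<omega>. has_tail_in s C"
    using end_component[OF \<omega> X] by blast
  obtain D where D: "D \<in> components_minus \<Gamma> X" "\<forall>s\<in>\<omega>'. has_tail_in s D"
    using end_component[OF \<omega>' X] by blast
  have "C \<noteq> D" using sep C D mem by blast
  show ?thesis
  proof (intro exI conjI)
    show "openin (freudenthal \<Gamma>) (end_nbhd \<Gamma> C)"
      by (rule openin_freudenthal_end_nbhd[OF X C(1) \<omega> C(2)])
    show "openin (freudenthal \<Gamma>) (end_nbhd \<Gamma> D)"
      by (rule openin_freudenthal_end_nbhd[OF X D(1) \<omega>' D(2)])
    show "End \<omega> \<in> end_nbhd \<Gamma> C" "End \<omega>' \<in> end_nbhd \<Gamma> D"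
      using \<omega> \<omega>' C D by (simp_all add: end_nbhd_def)
    show "end_nbhd \<Gamma> C \<inter> end_nbhd \<Gamma> D = {}"
      by (rule end_nbhd_disjoint[OF C(1) D(1) \<open>C \<noteq> D\<close>])
  qed
qed

lemma Hausdorff_freudenthal: "Hausdorff_space (freudenthal \<Gamma>)"
  unfolding Hausdorff_space_def disjnt_def
proof (intro allI impI)
  fix p q assume *: "p \<in> topspace (freudenthal \<Gamma>) \<and> q \<in> topspace (freudenthal \<Gamma>) \<and> p \<noteq> q"
  show "\<exists>U V. openin (freudenthal \<Gamma>) U \<and> openin (freudenthal \<Gamma>) V \<and> p \<in> U \<and> q \<in> V \<and> U \<inter> V = {}"
  proof (cases p)
    case p: (Pt x)
    then have x: "x \<in> complex_points \<Gamma>" using * by (auto simp: topspace_freudenthal)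
    show ?thesis
    proof (cases q)
      case q: (Pt y)
      then have "y \<in> complex_points \<Gamma>" using * by (auto simp: topspace_freudenthal)
      then show ?thesis using separate_points[OF x] * p q by simp
    next
      case q: (End \<omega>)
      then have "\<omega> \<in> graph_ends \<Gamma>" using * by (auto simp: topspace_freudenthal)
      then show ?thesis using separate_point_end[OF x] p q by simp
    qed
  next
    case p: (End \<alpha>)
    then have \<alpha>: "\<alpha> \<in> graph_ends \<Gamma>" using * by (auto simp: topspace_freudenthal)
    show ?thesis
    proof (cases q)
      case q: (Pt y)
      then have "y \<in> complex_points \<Gamma>" using * by (auto simp: topspace_freudenthal)
      from separate_point_end[OF this \<alpha>] show ?thesis unfolding p q by (metis Int_commute)
    next
      case q: (End \<omega>)
      then have "\<omega> \<in> graph_ends \<Gamma>" using * by (auto simp: topspace_freudenthal)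
      then show ?thesis using separate_ends[OF \<alpha>] * p q by simp
    qed
  qed
qed

end

section \<open>Spanning pairs of double rays\<close>

definition double_ray_point :: "(int \<Rightarrow> 'v) \<Rightarrow> real \<Rightarrow> 'v \<Rightarrow> real" where
  "double_ray_point R t = edge_point (R \<lfloor>t\<rfloor>) (R (\<lfloor>t\<rfloor> + 1)) (frac t)"

text \<open>The floor jumps at \<open>n + 1\<close>, but the end of one edge is the start of the
  next, so the formula for edge \<open>n\<close> holds on the closed interval. The closed form is
  wanted because openness in the 1-complex is tested on closed unit intervals.\<close>

lemma double_ray_point_interval:
  assumes "real_of_int n \<le> t" "t \<le> real_of_int n + 1"
  shows "double_ray_point R t = edge_point (R n) (R (n + 1)) (t - n)"
proof (cases "t = n + 1")
  case True
  then have "\<lfloor>t\<rfloor> = n + 1" "frac t = 0" "t - n = 1" by (simp_all add: frac_def)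
  moreover have "edge_point a b 0 = edge_point c a 1" for a b c :: 'a
    by (simp add: edge_point_def fun_eq_iff)
  ultimately show ?thesis unfolding double_ray_point_def by (simp only:)
next
  case False
  with assms have "\<lfloor>t\<rfloor> = n" by (intro floor_unique) auto
  then show ?thesis by (simp add: double_ray_point_def frac_def)
qed

lemma double_ray_point_of_int: "double_ray_point R (of_int n) = vertex_point (R n)"
  by (simp add: double_ray_point_def edge_point_def vertex_point_def fun_eq_iff)

text \<open>As a function of \<open>t\<close>, the coordinate at \<open>R k\<close> is the hat
  function with peak at \<open>k\<close>.\<close>

lemma double_ray_point_coordinate:
  assumes "inj R"
  shows "double_ray_point R t (R k) = max 0 (1 - \<bar>t - of_int k\<bar>)"
proof -
  have fl: "of_int \<lfloor>t\<rfloor> \<le> t" "t < of_int \<lfloor>t\<rfloor> + 1" by linarith+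
  have eq: "double_ray_point R t (R k) =
      (1 - frac t) * of_bool (k = \<lfloor>t\<rfloor>) + frac t * of_bool (k = \<lfloor>t\<rfloor> + 1)"
    using assms by (auto simp: double_ray_point_def edge_point_def indicator_def inj_eq)
  consider "k = \<lfloor>t\<rfloor>" | "k = \<lfloor>t\<rfloor> + 1" | "k < \<lfloor>t\<rfloor>" | "\<lfloor>t\<rfloor> + 1 < k" by linarith
  then show ?thesis
  proof cases
    case 3
    then have "of_int k + 1 \<le> real_of_int \<lfloor>t\<rfloor>" by linarith
    with fl have "1 - \<bar>t - of_int k\<bar> \<le> 0" by linarith
    with 3 show ?thesis unfolding eq by (simp add: max_absorb1)
  next
    case 4
    then have "real_of_int \<lfloor>t\<rfloor> + 2 \<le> of_int k" by linarith
    with fl have "1 - \<bar>t - of_int k\<bar> \<le> 0" by linarith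
    with 4 show ?thesis unfolding eq by (simp add: max_absorb1)
  next
    case 1
    from fl have "0 \<le> 1 - \<bar>t - of_int \<lfloor>t\<rfloor>\<bar>" "\<bar>t - of_int \<lfloor>t\<rfloor>\<bar> = t - of_int \<lfloor>t\<rfloor>" by linarith+
    with 1 show ?thesis unfolding eq frac_def by (simp only: max_absorb2) simp
  next
    case 2
    with fl show ?thesis unfolding eq frac_def by (simp add: max_absorb2)
  qed
qed

lemma double_ray_point_outside: "v \<notin> range R \<Longrightarrow> double_ray_point R t v = 0"
  by (auto simp: double_ray_point_def edge_point_def indicator_def)

text \<open>The weight \<open>1 - frac t\<close> never vanishes. This vertex reveals which double
  ray a point lies on, and it witnesses that a point belongs to the neighbourhood of an end.\<close>

lemma double_ray_point_floor_pos:
  assumes "inj R"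
  shows "0 < double_ray_point R t (R \<lfloor>t\<rfloor>)"
proof -
  have "0 < 1 - \<bar>t - of_int \<lfloor>t\<rfloor>\<bar>" by linarith
  then show ?thesis unfolding double_ray_point_coordinate[OF assms] by (simp only: less_max_iff_disj simp_thms)
qed

lemma inj_double_ray_point:
  assumes "inj R"
  shows "inj (double_ray_point R)"
proof (rule injI)
  fix s t assume *: "double_ray_point R s = double_ray_point R t"
  have eq: "max 0 (1 - \<bar>s - of_int k\<bar>) = max 0 (1 - \<bar>t - of_int k\<bar>)" for k
    using fun_cong[OF *, of "R k"] by (simp add: double_ray_point_coordinate[OF assms])
  have "of_int \<lfloor>s\<rfloor> \<le> s" "s < of_int \<lfloor>s\<rfloor> + 1" by linarith+
  \<comment> \<open>The hat at the floor of \<open>s\<close> determines only the distance of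
    \<open>t\<close> from that integer; the next hat decides the side.\<close>
  then show "s = t"
    using eq[of "\<lfloor>s\<rfloor>"] eq[of "\<lfloor>s\<rfloor> + 1"]
    by (simp add: max_def abs_if split: if_splits)
qed

context locally_finite_graph
begin

lemma double_ray_point_in_complex:
  assumes "\<And>n. {R n, R (n + 1)} \<in> edges \<Gamma>"
  shows "double_ray_point R t \<in> complex_points \<Gamma>"
proof -
  have "frac t \<in> {0..1}" using frac_lt_1[of t] by auto
  with assms[of "\<lfloor>t\<rfloor>"] show ?thesis unfolding double_ray_point_def complex_points_def by blast
qed

text \<open>On an edge, openness is only relative to a closed interval, so closed complements are
  glued instead: an open interval of length two around an integer \<open>n\<close> is covered by the
  two unit intervals at \<open>n\<close>, and such intervals cover the line.\<close>

lemma open_double_ray_point_preimage: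
  assumes R: "\<And>n. {R n, R (n + 1)} \<in> edges \<Gamma>" and A: "complex_open \<Gamma> A"
  shows "open {t. double_ray_point R t \<in> A}"
proof -
  define B where "B = {t. double_ray_point R t \<notin> A}"
  have closed: "closed (B \<inter> {real_of_int n..real_of_int n + 1})" for n
  proof -
    have "openin (top_of_set {0..1}) {s \<in> {0..1}. edge_point (R n) (R (n + 1)) s \<in> A}"
      using A R by (auto simp: complex_open_def)
    then have "closedin (top_of_set {0..1}) ({0..1} - {s \<in> {0..1}. edge_point (R n) (R (n + 1)) s \<in> A})"
      by (intro closedin_diff) auto
    then have "closed ({0..1} - {s \<in> {0..1}. edge_point (R n) (R (n + 1)) s \<in> A})"
      by (rule closedin_closed_trans) auto
    then have "closed ((+) (real_of_int n) ` ({0..1} - {s \<in> {0..1}. edge_point (R n) (R (n + 1)) s \<in> A}))"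
      by (rule closed_translation)
    also have "(+) (real_of_int n) ` ({0..1} - {s \<in> {0..1}. edge_point (R n) (R (n + 1)) s \<in> A}) =
        B \<inter> {real_of_int n..real_of_int n + 1}" (is "?L = ?M")
    proof (intro equalityI subsetI)
      fix t assume "t \<in> ?L"
      then obtain s where s: "s \<in> {0..1} - {s \<in> {0..1}. edge_point (R n) (R (n + 1)) s \<in> A}"
          "t = real_of_int n + s"
        by (rule imageE)
      from s(1) have "0 \<le> s" "s \<le> 1" "edge_point (R n) (R (n + 1)) s \<notin> A" by auto
      with s(2) show "t \<in> ?M" using double_ray_point_interval[of n t R] by (simp add: B_def)
    next
      fix t assume t: "t \<in> ?M"
      then have "t - n \<in> {0..1} - {s \<in> {0..1}. edge_point (R n) (R (n + 1)) s \<in> A}"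
        using double_ray_point_interval[of n t R] by (simp add: B_def)
      moreover have "t = n + (t - n)" by simp
      ultimately show "t \<in> ?L" by (rule rev_image_eqI)
    qed
    finally show ?thesis .
  qed
  have "open ({real_of_int n - 1<..<real_of_int n + 1} - B)" for n
  proof -
    have "closed (B \<inter> {real_of_int (n - 1)..real_of_int (n - 1) + 1} \<union>
        B \<inter> {real_of_int n..real_of_int n + 1})"
      by (intro closed_Un closed)
    then have "open ({real_of_int n - 1<..<real_of_int n + 1} -
        (B \<inter> {real_of_int (n - 1)..real_of_int (n - 1) + 1} \<union> B \<inter> {real_of_int n..real_of_int n + 1}))"
      by (intro open_Diff open_greaterThanLessThan)
    also have "\<dots> = {real_of_int n - 1<..<real_of_int n + 1} - B" by auto
    finally show ?thesis .
  qed
  then have "open (\<Union>n. {real_of_int n - 1<..<real_of_int n + 1} - B)" by blast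
  also have "(\<Union>n. {real_of_int n - 1<..<real_of_int n + 1} - B) = {t. double_ray_point R t \<in> A}"
  proof -
    have "\<exists>n. t \<in> {real_of_int n - 1<..<real_of_int n + 1}" for t
    proof
      show "t \<in> {real_of_int \<lfloor>t\<rfloor> - 1<..<real_of_int \<lfloor>t\<rfloor> + 1}"
        unfolding greaterThanLessThan_iff by linarith
    qed
    then show ?thesis unfolding B_def by blast
  qed
  finally show ?thesis .
qed

text \<open>For finite \<open>X\<close> both rays have tails in components; an edge between two
  sufficiently late vertices joins these components, which therefore coincide.\<close>

lemma ray_equivI:
  assumes r: "r \<in> rays \<Gamma>" and s: "s \<in> rays \<Gamma>"
    and linked: "\<And>N. \<exists>i\<ge>N. \<exists>j\<ge>N. {r i, s j} \<in> edges \<Gamma>"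
  shows "(r, s) \<in> ray_equiv \<Gamma>"
proof -
  have "\<exists>C\<in>components_minus \<Gamma> X. has_tail_in r C \<and> has_tail_in s C" if X: "finite X" for X
  proof -
    obtain C where C: "C \<in> components_minus \<Gamma> X" "has_tail_in r C"
      using ray_tail_component[OF r X] by blast
    obtain D where D: "D \<in> components_minus \<Gamma> X" "has_tail_in s D"
      using ray_tail_component[OF s X] by blast
    obtain M N where M: "\<forall>n\<ge>M. r n \<in> C" and N: "\<forall>n\<ge>N. s n \<in> D"
      using C D by (auto simp: has_tail_in_def)
    obtain i j where ij: "i \<ge> max M N" "j \<ge> max M N" "{r i, s j} \<in> edges \<Gamma>" using linked by blast
    with M N have "r i \<in> C" "s j \<in> D" by auto
    moreover from this have "s j \<in> C"
      using components_minus_closed[OF C(1) _ ij(3)] components_minus_subset[OF D(1)] by blast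
    ultimately have "C = D" using components_minus_eq[OF C(1) D(1)] by blast
    with C D show ?thesis by blast
  qed
  with r s show ?thesis by (auto simp only: ray_equiv_def)
qed

end

text \<open>The two double rays are \<open>R True\<close> and \<open>R False\<close>; the boolean is the sign of the imaginary
  part on the corresponding arc of the circle.\<close>

locale spanning_double_rays = locally_finite_graph \<Gamma> for \<Gamma> :: "'v ugraph" +
  fixes R :: "bool \<Rightarrow> int \<Rightarrow> 'v" and level :: "'v \<Rightarrow> int"
  assumes R_edge: "{R b n, R b (n + 1)} \<in> edges \<Gamma>"
    and R_inject: "R b m = R c n \<Longrightarrow> b = c \<and> m = n"
    and R_cover: "v \<in> verts \<Gamma> \<Longrightarrow> \<exists>b n. v = R b n"
    and linked_top: "\<exists>i\<ge>N. \<exists>j\<ge>N. {R True i, R False j} \<in> edges \<Gamma>"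
    and linked_bot: "\<exists>i\<le>N. \<exists>j\<le>N. {R True i, R False j} \<in> edges \<Gamma>"
    and level_edge: "{u, v} \<in> edges \<Gamma> \<Longrightarrow> \<bar>level u - level v\<bar> \<le> 1"
    and finite_level: "finite {v \<in> verts \<Gamma>. level v = 0}"
    and level_top: "\<exists>N. \<forall>n\<ge>N. 0 < level (R True n)"
    and level_bot: "\<exists>N. \<forall>n\<le>N. level (R True n) < 0"
begin

section \<open>The two ends\<close>

definition half_ray :: "bool \<Rightarrow> bool \<Rightarrow> nat \<Rightarrow> 'v" where
  "half_ray b e n = R b (if e then int n else - int n)"

definition ray_end :: "bool \<Rightarrow> (nat \<Rightarrow> 'v) set" where
  "ray_end e = ray_equiv \<Gamma> `` {half_ray True e}"

lemma inj_R: "inj (R b)"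
  using R_inject by (auto intro: injI)

lemma half_ray_rays: "half_ray b e \<in> rays \<Gamma>"
proof -
  have "inj (half_ray b e)"
    by (rule injI) (auto simp: half_ray_def dest!: R_inject split: if_splits)
  moreover have "{half_ray b e n, half_ray b e (Suc n)} \<in> edges \<Gamma>" for n
    using R_edge[of b "int n"] R_edge[of b "- 1 - int n"]
    by (auto simp: half_ray_def insert_commute add.commute)
  moreover have "half_ray b e n \<in> verts \<Gamma>" for n
    using edge_verts(1)[OF R_edge[of b "if e then int n else - int n"]] by (simp only: half_ray_def)
  ultimately show ?thesis by (auto simp: rays_def)
qed

lemma R_point_in_complex: "double_ray_point (R b) t \<in> complex_points \<Gamma>"
  by (rule double_ray_point_in_complex) (rule R_edge)

lemma ray_end_in_ends: "ray_end e \<in> graph_ends \<Gamma>"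
  unfolding ray_end_def graph_ends_def by (rule quotientI) (rule half_ray_rays)

text \<open>\<open>ray_end\<close> is defined by \<open>R True\<close> alone. The edges between the
  double rays, found arbitrarily far out in either direction, put the half rays of
  \<open>R False\<close> into the same classes.\<close>

lemma half_ray_in_end: "half_ray b e \<in> ray_end e"
proof -
  have "(half_ray True e, half_ray False e) \<in> ray_equiv \<Gamma>"
  proof (rule ray_equivI[OF half_ray_rays half_ray_rays])
    fix N
    show "\<exists>i\<ge>N. \<exists>j\<ge>N. {half_ray True e i, half_ray False e j} \<in> edges \<Gamma>"
    proof (cases e)
      case True
      obtain i j where "i \<ge> int N" "j \<ge> int N" "{R True i, R False j} \<in> edges \<Gamma>"
        using linked_top by blast
      with True show ?thesis
        by (intro exI[of _ "nat i"] conjI exI[of _ "nat j"]) (auto simp: half_ray_def)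
    next
      case False
      obtain i j where "i \<le> - int N" "j \<le> - int N" "{R True i, R False j} \<in> edges \<Gamma>"
        using linked_bot by blast
      with False show ?thesis
        by (intro exI[of _ "nat (- i)"] conjI exI[of _ "nat (- j)"]) (auto simp: half_ray_def)
    qed
  qed
  then show ?thesis using ray_equiv_refl[OF half_ray_rays] by (cases b) (auto simp: ray_end_def)
qed

text \<open>The level changes by at most 1 along an edge, so it cannot change sign without passing
  through 0.\<close>

lemma component_level_sign:
  assumes "C \<in> components_minus \<Gamma> {v \<in> verts \<Gamma>. level v = 0}" "v \<in> C" "w \<in> C"
  shows "0 < level v \<longleftrightarrow> 0 < level w"
proof -
  let ?X = "{v \<in> verts \<Gamma>. level v = 0}"
  obtain c where C: "C = component_of \<Gamma> ?X c" using assms(1) by (auto simp: components_minus_def)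
  have "0 < level c \<longleftrightarrow> 0 < level u" if "u \<in> C" for u
    using that unfolding C component_of_def mem_Collect_eq
  proof (induction rule: rtrancl_induct)
    case (step y z)
    then show ?case using level_edge[of y z] by force
  qed simp
  with assms(2,3) show ?thesis by blast
qed

text \<open>The finitely many vertices of level 0 separate the two directions: \<open>R True\<close>
  is eventually positive on one side and eventually negative on the other.\<close>

lemma ray_end_distinct: "ray_end True \<noteq> ray_end False"
proof
  assume eq: "ray_end True = ray_end False"
  obtain C where C: "C \<in> components_minus \<Gamma> {v \<in> verts \<Gamma>. level v = 0}"
      "\<forall>r\<in>ray_end True. has_tail_in r C"
    using end_component[OF ray_end_in_ends finite_level] by blast
  have "has_tail_in (half_ray True True) C" "has_tail_in (half_ray True False) C"
    using C(2) half_ray_in_end eq by blast+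
  then obtain M N where M: "\<forall>n\<ge>M. R True (int n) \<in> C" and N: "\<forall>n\<ge>N. R True (- int n) \<in> C"
    by (auto simp: has_tail_in_def half_ray_def)
  obtain k where k: "\<forall>n\<ge>k. 0 < level (R True n)" using level_top by blast
  obtain l where l: "\<forall>n\<le>l. level (R True n) < 0" using level_bot by blast
  have "0 < level (R True (int (max M (nat k))))" using k by simp
  moreover have "level (R True (- int (max N (nat (- l))))) < 0" using l by simp
  moreover have "R True (int (max M (nat k))) \<in> C" "R True (- int (max N (nat (- l)))) \<in> C"
    using M N by simp_all
  ultimately show False using component_level_sign[OF C(1)] by (metis less_asym)
qed

section \<open>The circle formed by the double rays and their ends\<close>

definition stretch :: "real \<Rightarrow> real" where
  "stretch x = x / (1 - \<bar>x\<bar>)"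

text \<open>The points 1 and -1 become the ends, and each open half circle is parametrised by its
  real part. So both double rays run from \<open>ray_end False\<close> at -1 to
  \<open>ray_end True\<close> at 1.\<close>

definition circle_map :: "complex \<Rightarrow> 'v fpoint" where
  "circle_map z =
     (if Im z = 0 then End (ray_end (Re z > 0))
      else Pt (double_ray_point (R (Im z > 0)) (stretch (Re z))))"

lemma sphere_Re_less: "z \<in> sphere 0 1 \<Longrightarrow> Im z \<noteq> 0 \<Longrightarrow> \<bar>Re z\<bar> < 1"
proof -
  assume "z \<in> sphere 0 1" "Im z \<noteq> 0"
  then have "(Re z)\<^sup>2 + (Im z)\<^sup>2 = 1" "0 < (Im z)\<^sup>2"
    by (simp_all add: cmod_def)
  then have "(Re z)\<^sup>2 < 1" by linarith
  then show "\<bar>Re z\<bar> < 1" by (simp only: abs_square_less_1)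
qed

lemma sphere_Re_eq: "z \<in> sphere 0 1 \<Longrightarrow> Im z = 0 \<Longrightarrow> z = (if Re z > 0 then 1 else - 1)"
  by (auto simp: complex_eq_iff cmod_def)

text \<open>\<open>stretch\<close> maps the open interval from -1 to 1 bijectively onto the real
  line, with inverse \<open>t / (1 + \<bar>t\<bar>)\<close>.\<close>

lemma stretch_inverse: "\<bar>x\<bar> < 1 \<Longrightarrow> stretch x / (1 + \<bar>stretch x\<bar>) = x"
proof -
  assume "\<bar>x\<bar> < 1"
  then have pos: "1 - \<bar>x\<bar> > 0" by simp
  then have "1 + \<bar>stretch x\<bar> = 1 / (1 - \<bar>x\<bar>)" by (simp add: stretch_def abs_divide field_simps)
  with pos show ?thesis by (simp add: stretch_def)
qed

lemma stretch_inject: "\<bar>x\<bar> < 1 \<Longrightarrow> \<bar>y\<bar> < 1 \<Longrightarrow> stretch x = stretch y \<Longrightarrow> x = y"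
  by (metis stretch_inverse)

lemma stretch_surj: "\<exists>x. \<bar>x\<bar> < 1 \<and> stretch x = t"
proof (intro exI conjI)
  have pos: "1 + \<bar>t\<bar> > 0" by linarith
  show "\<bar>t / (1 + \<bar>t\<bar>)\<bar> < 1" using pos by (simp add: abs_divide)
  have "1 - \<bar>t / (1 + \<bar>t\<bar>)\<bar> = 1 / (1 + \<bar>t\<bar>)" using pos by (simp add: abs_divide field_simps)
  then show "stretch (t / (1 + \<bar>t\<bar>)) = t" using pos by (simp add: stretch_def)
qed

lemma stretch_ge: "0 \<le> N \<Longrightarrow> N / (1 + N) < x \<Longrightarrow> x < 1 \<Longrightarrow> N \<le> stretch x"
proof -
  assume "0 \<le> N" "N / (1 + N) < x" "x < 1"
  moreover from this have "0 \<le> x" by (metis add_nonneg_nonneg divide_nonneg_nonneg le_less_trans less_imp_le zero_le_one)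
  ultimately show ?thesis by (simp add: stretch_def field_simps)
qed

lemma stretch_uminus: "stretch (- x) = - stretch x"
  by (simp add: stretch_def)

text \<open>The set is taken in the plane, on the open strip that avoids the poles of
  \<open>stretch\<close>. A point of the circle lies in the strip as soon as its imaginary part is
  nonzero.\<close>

lemma open_circle_part:
  assumes "complex_open \<Gamma> A"
  shows "open {z. \<bar>Re z\<bar> < 1 \<and> Im z \<noteq> 0 \<and> double_ray_point (R (Im z > 0)) (stretch (Re z)) \<in> A}"
proof -
  define T where "T b = {t. double_ray_point (R b) t \<in> A}" for b
  have T: "open (T b)" for b
    unfolding T_def by (rule open_double_ray_point_preimage) (rule R_edge assms)+
  define Y where "Y = {z. \<bar>Re z\<bar> < 1}"
  have "open Y"
    unfolding Y_def by (intro open_Collect_less continuous_intros)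
  moreover have "continuous_on Y (\<lambda>z. stretch (Re z))"
    unfolding stretch_def Y_def by (intro continuous_intros) auto
  ultimately have pre: "open (Y \<inter> (\<lambda>z. stretch (Re z)) -` T b)" for b
    using T by (intro continuous_open_preimage)
  have "open ({z. 0 < Im z} \<inter> (Y \<inter> (\<lambda>z. stretch (Re z)) -` T True) \<union>
      {z. Im z < 0} \<inter> (Y \<inter> (\<lambda>z. stretch (Re z)) -` T False))"
    by (intro open_Un open_Int pre open_halfspace_Im_gt open_halfspace_Im_lt)
  also have "\<dots> = {z. \<bar>Re z\<bar> < 1 \<and> Im z \<noteq> 0 \<and> double_ray_point (R (Im z > 0)) (stretch (Re z)) \<in> A}"
    by (auto simp: T_def Y_def neq_iff)
  finally show ?thesis .
qed

lemma circle_map_near_end: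
  assumes C: "\<forall>r\<in>ray_end e. has_tail_in r C"
  shows "\<exists>W. open W \<and> (if e then 1 else - 1) \<in> W \<and> (\<forall>z\<in>sphere 0 1 \<inter> W. circle_map z \<in> end_nbhd \<Gamma> C)"
proof -
  have "has_tail_in (half_ray b e) C" for b using C half_ray_in_end by blast
  then have "\<exists>N. \<forall>n\<ge>N. half_ray b e n \<in> C" for b by (simp add: has_tail_in_def)
  then obtain f where f: "\<forall>n\<ge>f b. half_ray b e n \<in> C" for b by metis
  define N where "N = max (f True) (f False)"
  have "f b \<le> N" for b by (cases b) (simp_all add: N_def)
  then have N: "half_ray b e n \<in> C" if "n \<ge> N" for n b using f that order_trans by blast
  define \<sigma> where "\<sigma> = (if e then 1 else - 1 :: real)"
  \<comment> \<open>The bound is the preimage of \<open>N\<close> under \<open>stretch\<close>: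
    points of the circle off the real axis in this half plane have a parameter at least
    \<open>N\<close> far out in the direction \<open>\<sigma>\<close>.\<close>
  define W where "W = {z. real N / (1 + real N) < \<sigma> * Re z}"
  have frac: "0 \<le> real N / (1 + real N)" "real N / (1 + real N) < 1" by (simp_all add: field_simps)
  have "open W" unfolding W_def by (intro open_Collect_less continuous_intros)
  moreover have "(if e then 1 else - 1) \<in> W" using frac by (simp add: W_def \<sigma>_def)
  moreover have "circle_map z \<in> end_nbhd \<Gamma> C" if z: "z \<in> sphere 0 1" "z \<in> W" for z
  proof (cases "Im z = 0")
    case True
    have "(Re z > 0) = e"
    proof -
      have "0 < \<sigma> * Re z" using le_less_trans[OF frac(1)] z(2) unfolding W_def by blast
      then show ?thesis by (auto simp: \<sigma>_def split: if_splits)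
    qed
    with True C show ?thesis
      by (simp add: circle_map_def end_nbhd_def ray_end_in_ends)
  next
    case False
    let ?b = "Im z > 0" and ?t = "stretch (Re z)"
    have "\<bar>Re z\<bar> < 1" using sphere_Re_less z False by blast
    then have ge: "real N \<le> stretch (\<sigma> * Re z)"
      using z(2) by (intro stretch_ge) (auto simp: W_def \<sigma>_def split: if_splits)
    \<comment> \<open>One vertex of \<open>C\<close> with positive weight is enough to place the
      point in the neighbourhood, and the vertex at the floor has positive weight.\<close>
    have "R ?b \<lfloor>?t\<rfloor> \<in> C"
    proof (cases e)
      case True
      then have le: "int N \<le> \<lfloor>?t\<rfloor>" using ge by (simp add: \<sigma>_def le_floor_iff)
      then obtain k where k: "\<lfloor>?t\<rfloor> = int k"
        by (metis of_nat_0_le_iff order_trans zero_le_imp_eq_int)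
      with le N[of k ?b] True show ?thesis by (simp add: half_ray_def)
    next
      case False
      then have "?t \<le> - real N" using ge by (simp add: \<sigma>_def stretch_uminus)
      then have le: "int N \<le> - \<lfloor>?t\<rfloor>" by linarith
      then obtain k where k: "- \<lfloor>?t\<rfloor> = int k"
        by (metis of_nat_0_le_iff order_trans zero_le_imp_eq_int)
      then have "\<lfloor>?t\<rfloor> = - int k" by linarith
      with k le N[of k ?b] False show ?thesis by (simp add: half_ray_def)
    qed
    then have "double_ray_point (R ?b) ?t \<in> {x \<in> complex_points \<Gamma>. \<exists>v\<in>C. x v > 0}"
      using R_point_in_complex double_ray_point_floor_pos[OF inj_R] by blast
    with False show ?thesis by (simp add: circle_map_def end_nbhd_def)
  qed
  ultimately show ?thesis by blast
qed

lemma circle_map_topspace: "circle_map z \<in> topspace (freudenthal \<Gamma>)"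
  using R_point_in_complex ray_end_in_ends
  by (auto simp: circle_map_def topspace_freudenthal)

lemma openin_preimage_complex:
  assumes "complex_open \<Gamma> A"
  shows "openin (top_of_set (sphere 0 1)) (circle_map -` (Pt ` A) \<inter> sphere 0 1)"
proof -
  have "circle_map -` (Pt ` A) \<inter> sphere 0 1 = sphere 0 1 \<inter>
      {z. \<bar>Re z\<bar> < 1 \<and> Im z \<noteq> 0 \<and> double_ray_point (R (Im z > 0)) (stretch (Re z)) \<in> A}"
    using sphere_Re_less by (auto simp: circle_map_def split: if_splits)
  then show ?thesis using open_circle_part[OF assms] by (simp only: openin_open_Int)
qed

lemma openin_preimage_end_nbhd:
  "openin (top_of_set (sphere 0 1)) (circle_map -` end_nbhd \<Gamma> C \<inter> sphere 0 1)"
proof -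
  let ?A = "{x \<in> complex_points \<Gamma>. \<exists>v\<in>C. x v > 0}" and ?U = "end_nbhd \<Gamma> C"
  \<comment> \<open>If the end is not in the neighbourhood, the empty set serves as
    \<open>W\<close>; this treats both real points of the circle uniformly.\<close>
  have "\<exists>W. open W \<and> (End (ray_end e) \<in> ?U \<longrightarrow> (if e then 1 else - 1) \<in> W) \<and>
      (\<forall>z\<in>sphere 0 1 \<inter> W. circle_map z \<in> ?U)" for e
  proof (cases "End (ray_end e) \<in> ?U")
    case True
    then have "\<forall>r\<in>ray_end e. has_tail_in r C" by (auto simp: end_nbhd_def)
    from circle_map_near_end[OF this] show ?thesis by blast
  qed (intro exI[of _ "{}"], simp)
  then obtain W where W: "\<And>e. open (W e)" "\<And>e. End (ray_end e) \<in> ?U \<Longrightarrow> (if e then 1 else - 1) \<in> W e"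
      "\<And>e z. z \<in> sphere 0 1 \<Longrightarrow> z \<in> W e \<Longrightarrow> circle_map z \<in> ?U"
    by (metis IntI)
  have "circle_map -` ?U \<inter> sphere 0 1 =
      (circle_map -` (Pt ` ?A) \<inter> sphere 0 1) \<union> (sphere 0 1 \<inter> (W True \<union> W False))"
  proof (intro equalityI subsetI)
    fix z assume z: "z \<in> circle_map -` ?U \<inter> sphere 0 1"
    show "z \<in> (circle_map -` (Pt ` ?A) \<inter> sphere 0 1) \<union> (sphere 0 1 \<inter> (W True \<union> W False))"
    proof (cases "Im z = 0")
      case True
      then have "(if Re z > 0 then 1 else - 1) \<in> W (Re z > 0)"
        using z by (intro W(2)) (simp add: circle_map_def)
      then have "z \<in> W (Re z > 0)" using sphere_Re_eq[of z] z True by simp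
      with z show ?thesis by (cases "Re z > 0") auto
    next
      case False
      with z show ?thesis by (auto simp: circle_map_def end_nbhd_def)
    qed
  next
    fix z assume "z \<in> (circle_map -` (Pt ` ?A) \<inter> sphere 0 1) \<union> (sphere 0 1 \<inter> (W True \<union> W False))"
    moreover have "Pt ` ?A \<subseteq> ?U" by (simp add: end_nbhd_def)
    ultimately show "z \<in> circle_map -` ?U \<inter> sphere 0 1" using W(3)[of z] by blast
  qed
  then show ?thesis
    by (simp only:) (intro openin_Un openin_preimage_complex complex_open_positive openin_open_Int open_Un W)
qed

lemma continuous_circle_map: "continuous_map (top_of_set (sphere 0 1)) (freudenthal \<Gamma>) circle_map"
  unfolding freudenthal_def
proof (rule continuous_on_generated_topo)
  fix U assume "U \<in> {Pt ` A |A. complex_open \<Gamma> A} \<union>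
      {end_nbhd \<Gamma> C |X C \<omega>. finite X \<and> X \<subseteq> verts \<Gamma> \<and> C \<in> components_minus \<Gamma> X \<and>
         \<omega> \<in> graph_ends \<Gamma> \<and> (\<forall>r\<in>\<omega>. has_tail_in r C)}"
  then show "openin (top_of_set (sphere 0 1)) (circle_map -` U \<inter> topspace (top_of_set (sphere 0 1)))"
    by (elim UnE CollectE exE conjE)
      (simp_all only: topspace_euclidean_subtopology openin_preimage_complex openin_preimage_end_nbhd)
next
  show "circle_map ` topspace (top_of_set (sphere 0 1)) \<subseteq> \<Union> ({Pt ` A |A. complex_open \<Gamma> A} \<union>
      {end_nbhd \<Gamma> C |X C \<omega>. finite X \<and> X \<subseteq> verts \<Gamma> \<and> C \<in> components_minus \<Gamma> X \<and>
         \<omega> \<in> graph_ends \<Gamma> \<and> (\<forall>r\<in>\<omega>. has_tail_in r C)})"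
    unfolding topology_generated_by_topspace[symmetric] freudenthal_def[symmetric]
    by (rule image_subsetI) (rule circle_map_topspace)
qed

lemma inj_circle_map: "inj_on circle_map (sphere 0 1)"
proof (rule inj_onI)
  fix z w assume zw: "z \<in> sphere 0 1" "w \<in> sphere 0 1" "circle_map z = circle_map w"
  consider "Im z = 0" "Im w = 0" | "Im z \<noteq> 0" "Im w \<noteq> 0"
    using zw(3) by (auto simp: circle_map_def split: if_splits)
  then show "z = w"
  proof cases
    case 1
    then have "ray_end (Re z > 0) = ray_end (Re w > 0)" using zw(3) by (simp add: circle_map_def)
    then have "(Re z > 0) = (Re w > 0)"
      using ray_end_distinct by (cases "Re z > 0"; cases "Re w > 0") auto
    then show ?thesis using sphere_Re_eq[OF zw(1) 1(1)] sphere_Re_eq[OF zw(2) 1(2)] by simp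
  next
    case 2
    let ?b = "Im z > 0" and ?c = "Im w > 0" and ?s = "stretch (Re z)" and ?t = "stretch (Re w)"
    have eq: "double_ray_point (R ?b) ?s = double_ray_point (R ?c) ?t"
      using zw(3) 2 by (simp add: circle_map_def)
    \<comment> \<open>The vertex at the floor has positive weight in the common point and thus lies
      on both double rays; since these are disjoint, the half circles agree.\<close>
    have "0 < double_ray_point (R ?c) ?t (R ?b \<lfloor>?s\<rfloor>)"
      using double_ray_point_floor_pos[OF inj_R[of ?b], of ?s] unfolding eq .
    then have "R ?b \<lfloor>?s\<rfloor> \<in> range (R ?c)"
      using double_ray_point_outside[of "R ?b \<lfloor>?s\<rfloor>" "R ?c" ?t] by force
    then have bc: "?b = ?c" using R_inject by blast
    then have "?s = ?t" using eq injD[OF inj_double_ray_point[OF inj_R]] by simp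
    then have re: "Re z = Re w" using stretch_inject sphere_Re_less zw 2 by blast
    have "(Re z)\<^sup>2 + (Im z)\<^sup>2 = 1" "(Re w)\<^sup>2 + (Im w)\<^sup>2 = 1"
      using zw by (simp_all add: cmod_def)
    then have "(Im z)\<^sup>2 = (Im w)\<^sup>2" using re by simp
    then have "Im z = Im w" using bc 2 by (auto simp: power2_eq_iff)
    with re show ?thesis by (simp add: complex_eq_iff)
  qed
qed

lemma vertex_in_circle:
  assumes "v \<in> verts \<Gamma>"
  shows "Pt (vertex_point v) \<in> circle_map ` sphere 0 1"
proof -
  obtain b n where v: "v = R b n" using R_cover[OF assms] by blast
  obtain x where x: "\<bar>x\<bar> < 1" "stretch x = of_int n" using stretch_surj by blast
  have "x\<^sup>2 < 1" using x by (simp add: abs_square_less_1)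
  define z where "z = Complex x ((if b then 1 else - 1) * sqrt (1 - x\<^sup>2))"
  have "z \<in> sphere 0 1" using \<open>x\<^sup>2 < 1\<close> by (simp add: z_def cmod_def power_mult_distrib)
  moreover have "circle_map z = Pt (double_ray_point (R b) (of_int n))"
    using \<open>x\<^sup>2 < 1\<close> x by (simp add: z_def circle_map_def)
  ultimately show ?thesis unfolding v double_ray_point_of_int[symmetric] by (metis imageI)
qed

text \<open>The circle is compact and the compactification is Hausdorff, so a continuous injection
  is already an embedding; continuity of the inverse comes for free.\<close>

theorem hamilton_circle_of_double_rays: "hamilton_circle \<Gamma> (circle_map ` sphere 0 1)"
proof -
  have "embedding_map (top_of_set (sphere 0 1)) (freudenthal \<Gamma>) circle_map"
    by (rule continuous_imp_embedding_map)
      (simp_all add: continuous_circle_map Hausdorff_freudenthal inj_circle_map compact_space_subtopology)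
  then have "top_of_set (sphere (0::complex) 1) homeomorphic_space
      subtopology (freudenthal \<Gamma>) (circle_map ` sphere 0 1)"
    using embedding_map_imp_homeomorphic_space by fastforce
  then have "subtopology (freudenthal \<Gamma>) (circle_map ` sphere 0 1) homeomorphic_space
      top_of_set (sphere (0::complex) 1)"
    by (rule homeomorphic_space_sym[THEN iffD1])
  moreover have "circle_map ` sphere 0 1 \<subseteq> topspace (freudenthal \<Gamma>)"
    by (rule image_subsetI) (rule circle_map_topspace)
  moreover have "Pt ` vertex_point ` verts \<Gamma> \<subseteq> circle_map ` sphere 0 1"
    using vertex_in_circle by blast
  ultimately show ?thesis unfolding hamilton_circle_def by blast
qed

end

section \<open>Paths through the cosets of a subgroup\<close>

context group
begin

section \<open>Translates of paths and lists of coset representatives\<close>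

lemma inv_mult_cancel_left [simp]: "x \<in> carrier G \<Longrightarrow> y \<in> carrier G \<Longrightarrow> inv x \<otimes> (x \<otimes> y) = y"
  by (simp add: m_assoc[symmetric])

lemma mult_inv_cancel_left [simp]: "x \<in> carrier G \<Longrightarrow> y \<in> carrier G \<Longrightarrow> x \<otimes> (inv x \<otimes> y) = y"
  by (simp add: m_assoc[symmetric])

lemma inj_on_translate: "g \<in> carrier G \<Longrightarrow> W \<subseteq> carrier G \<Longrightarrow> inj_on ((\<otimes>) g) W"
  by (auto intro!: inj_onI simp: subset_iff)

definition step :: "'a set \<Rightarrow> 'a \<Rightarrow> 'a \<Rightarrow> bool" where
  "step S x y \<longleftrightarrow> (\<exists>s\<in>S. y = x \<otimes> s)"

text \<open>The entries represent pairwise different left cosets of \<open>K\<close>. The clause on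
  pairs sees only the set of entries, hence the separate demand of distinctness.\<close>

definition separated :: "'a set \<Rightarrow> 'a list \<Rightarrow> bool" where
  "separated K W \<longleftrightarrow> distinct W \<and> (\<forall>x\<in>set W. \<forall>y\<in>set W. inv x \<otimes> y \<in> K \<longrightarrow> x = y)"

text \<open>For a normal subgroup \<open>K\<close> of \<open>L\<close> this is a Hamilton path of
  \<open>L / K\<close>, given by representatives that are themselves joined by generators. With
  \<open>K = {\<one>}\<close> it is a Hamilton path of \<open>L\<close>.\<close>

definition coset_path :: "'a set \<Rightarrow> 'a set \<Rightarrow> 'a set \<Rightarrow> 'a list \<Rightarrow> bool" where
  "coset_path K S L W \<longleftrightarrow> W \<noteq> [] \<and> hd W = \<one> \<and> set W \<subseteq> L \<and> successively (step S) W \<and>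
     separated K W \<and> (\<forall>g\<in>L. \<exists>w\<in>set W. inv w \<otimes> g \<in> K)"

lemma step_translate:
  assumes "g \<in> carrier G" "x \<in> carrier G" "S \<subseteq> carrier G" "step S x y"
  shows "step S (g \<otimes> x) (g \<otimes> y)"
  using assms by (auto simp: step_def m_assoc intro!: bexI)

lemma successively_step_translate:
  assumes "g \<in> carrier G" "S \<subseteq> carrier G" "set W \<subseteq> carrier G" "successively (step S) W"
  shows "successively (step S) (map ((\<otimes>) g) W)"
  using assms(3,4)
  by (induction W rule: induct_list012) (auto simp: step_translate[OF assms(1) _ assms(2)])

lemma successively_step_mono:
  "successively (step S) W \<Longrightarrow> S \<subseteq> T \<Longrightarrow> successively (step T) W"
  by (erule successively_mono) (auto simp: step_def)

lemma inv_mult_translate [simp]: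
  "g \<in> carrier G \<Longrightarrow> x \<in> carrier G \<Longrightarrow> y \<in> carrier G \<Longrightarrow> inv (g \<otimes> x) \<otimes> (g \<otimes> y) = inv x \<otimes> y"
  by (simp add: inv_mult_group m_assoc)

lemma separated_translate:
  assumes "g \<in> carrier G" "set W \<subseteq> carrier G" "separated K W"
  shows "separated K (map ((\<otimes>) g) W)"
proof -
  have "inj_on ((\<otimes>) g) (set W)" using assms by (intro inj_on_translate)
  with assms show ?thesis by (auto simp: separated_def distinct_map subset_iff)
qed

lemma separated_append:
  "separated K (U @ V) \<Longrightarrow> separated K U \<and> separated K V"
  by (auto simp: separated_def)

lemma separated_Cons: "separated K (u # V) \<Longrightarrow> separated K V"
  by (auto simp: separated_def)

text \<open>Left multiplication by an element of \<open>U\<close> is an injective, hence surjective,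
  self-map of a finite set; the neutral element and inverses are found as preimages.\<close>

lemma finite_closed_subgroup:
  assumes U: "U \<subseteq> carrier G" "finite U" "U \<noteq> {}" and mult: "\<And>x y. x \<in> U \<Longrightarrow> y \<in> U \<Longrightarrow> x \<otimes> y \<in> U"
  shows "subgroup U G"
proof -
  have img: "(\<otimes>) x ` U = U" if "x \<in> U" for x
    using that U mult by (intro endo_inj_surj inj_on_translate) auto
  obtain x where x: "x \<in> U" using U by blast
  have one: "\<one> \<in> U"
  proof -
    obtain y where y: "y \<in> U" "x \<otimes> y = x" using img[OF x] x by (metis imageE)
    then have "inv x \<otimes> (x \<otimes> y) = inv x \<otimes> x" by simp
    moreover have "x \<in> carrier G" "y \<in> carrier G" using x y U by auto
    ultimately have "y = \<one>" by simp
    with y show ?thesis by simp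
  qed
  have "inv x \<in> U" if xU: "x \<in> U" for x
  proof -
    obtain y where y: "y \<in> U" "x \<otimes> y = \<one>" using img[OF xU] one by (metis imageE)
    then have "inv x \<otimes> (x \<otimes> y) = inv x" using xU U by auto
    moreover have "x \<in> carrier G" "y \<in> carrier G" using xU y U by auto
    ultimately have "y = inv x" by simp
    with y show ?thesis by simp
  qed
  with one U mult show ?thesis by (intro subgroup.intro) auto
qed

text \<open>Right multiplication by a generator permutes the finite set \<open>F\<close>, so
  \<open>F\<close> is also closed under inverses of generators.\<close>

lemma finite_right_closed:
  assumes F: "F \<subseteq> carrier G" "finite F" and S: "S \<subseteq> carrier G"
    and closed: "\<And>f s. f \<in> F \<Longrightarrow> s \<in> S \<Longrightarrow> f \<otimes> s \<in> F"
    and g: "g \<in> generate G S"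
  shows "f \<in> F \<Longrightarrow> f \<otimes> g \<in> F"
  using g
proof (induction arbitrary: f rule: generate.induct)
  case one
  then show ?case using F by auto
next
  case (incl s)
  then show ?case using closed by blast
next
  case (inv s)
  have "(\<lambda>f. f \<otimes> s) ` F = F"
    using F S inv.hyps closed by (intro endo_inj_surj) (auto intro!: inj_onI simp: subset_iff)
  then obtain f' where f': "f' \<in> F" "f = f' \<otimes> s" using inv.prems by (metis imageE)
  moreover have "f' \<in> carrier G" "s \<in> carrier G" using f' F S inv.hyps by auto
  ultimately show ?case by (simp add: m_assoc)
next
  case (eng g h)
  have "g \<in> carrier G" "h \<in> carrier G" using eng.hyps generate_in_carrier[OF S] by auto
  then show ?case using eng.IH eng.prems F by (metis m_assoc subsetD)
qed

lemma exists_power_in_subgroup: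
  assumes M: "subgroup M G" "finite M" and L: "subgroup L G" and t: "t \<in> M"
  shows "\<exists>m>0. t [^] (m::nat) \<in> L"
proof -
  have tc: "t \<in> carrier G" using t M(1) by (rule subgroup.mem_carrier[rotated])
  have "t [^] n \<in> M" for n :: nat
    using t M(1) by (induction n) (auto simp: subgroup.one_closed subgroup.m_closed)
  then have "\<not> inj (\<lambda>n::nat. t [^] n)"
    using M(2) by (meson finite_subset image_subsetI infinite_UNIV_nat inj_on_finite)
  then obtain i j :: nat where "t [^] i = t [^] j" "i < j"
    unfolding inj_def by (metis linorder_neqE_nat)
  then have "t [^] (j - i) = \<one>"
    using tc by (simp add: pow_eq_div2)
  then show ?thesis using \<open>i < j\<close> subgroup.one_closed[OF L] by (intro exI[of _ "j - i"]) simp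
qed

text \<open>The path \<open>W\<close> is followed by its translates under powers of
  \<open>t = last W \<otimes> s\<close>: leaving \<open>t^i W\<close> by \<open>s\<close> leads to
  \<open>t^(i+1)\<close>, the first vertex of the next translate. As \<open>M\<close> normalises
  \<open>L\<close>, the cosets \<open>t^i L\<close> together form a subgroup, and it contains
  \<open>s\<close>, the product of \<open>inv (last W)\<close> and \<open>t\<close>.\<close>

lemma coset_path_extend:
  assumes M: "subgroup M G" "finite M" and K: "subgroup K G" and L: "subgroup L G"
    and KL: "K \<subseteq> L" and LM: "L \<subseteq> M" and S: "S \<subseteq> M" and s: "s \<in> M"
    and norm: "\<And>x l. x \<in> M \<Longrightarrow> l \<in> L \<Longrightarrow> x \<otimes> l \<otimes> inv x \<in> L"
    and W: "coset_path K S L W"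
  shows "\<exists>L' W'. subgroup L' G \<and> L \<subseteq> L' \<and> s \<in> L' \<and> L' \<subseteq> M \<and> coset_path K (insert s S) L' W'"
proof -
  have Mc: "M \<subseteq> carrier G" using M(1) by (rule subgroup.subset)
  have Lc: "L \<subseteq> carrier G" using LM Mc by blast
  have Wne: "W \<noteq> []" and Whd: "hd W = \<one>" and WL: "set W \<subseteq> L" and Wstep: "successively (step S) W"
    and Wsep: "separated K W" and Wcov: "\<And>g. g \<in> L \<Longrightarrow> \<exists>w\<in>set W. inv w \<otimes> g \<in> K"
    using W by (auto simp: coset_path_def)
  have lastL: "last W \<in> L" using WL Wne by auto
  define t where "t = last W \<otimes> s"
  have tM: "t \<in> M" unfolding t_def using lastL LM s M(1) by (auto intro: subgroup.m_closed)
  have tc: "t \<in> carrier G" using tM Mc by blast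
  have powM: "t [^] n \<in> M" for n :: nat
    using tM M(1) by (induction n) (auto simp: subgroup.one_closed subgroup.m_closed)
  \<comment> \<open>The order of \<open>t\<close> modulo \<open>L\<close>. If \<open>s\<close> lies
    in \<open>L\<close>, it is 1 and the path stays as it is.\<close>
  define m where "m = (LEAST m. 0 < m \<and> t [^] (m::nat) \<in> L)"
  have "0 < m \<and> t [^] m \<in> L"
    unfolding m_def by (rule LeastI_ex) (use exists_power_in_subgroup[OF M L tM] in blast)
  then have m: "0 < m" "t [^] m \<in> L" by auto
  have m_min: "k = 0" if "k < m" "t [^] k \<in> L" for k
    using that not_less_Least[of k "\<lambda>m. 0 < m \<and> t [^] (m::nat) \<in> L"] unfolding m_def[symmetric] by auto
  have norm': "inv x \<otimes> l \<otimes> x \<in> L" if "x \<in> M" "l \<in> L" for x l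
    using norm[of "inv x" l] that subgroup.m_inv_closed[OF M(1)] Mc by (auto simp: subset_iff)
  define L' where "L' = (\<Union>i<m. (\<otimes>) (t [^] i) ` L)"
  have powL: "t [^] (m * q) \<in> L" for q :: nat
    using m(2) L tc by (induction q) (auto simp: subgroup.one_closed subgroup.m_closed nat_pow_mult[symmetric] mult_Suc_right)
  have L'I: "t [^] n \<otimes> l \<in> L'" if "l \<in> L" for n :: nat and l
  proof -
    have "t [^] n = t [^] (n mod m) \<otimes> t [^] (m * (n div m))"
      using tc by (simp add: nat_pow_mult)
    then have "t [^] n \<otimes> l = t [^] (n mod m) \<otimes> (t [^] (m * (n div m)) \<otimes> l)"
      using tc that Lc powL by (simp add: m_assoc subset_iff)
    moreover have "t [^] (m * (n div m)) \<otimes> l \<in> L" using powL that L by (simp add: subgroup.m_closed)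
    ultimately show ?thesis using m(1) unfolding L'_def by (auto intro!: bexI[of _ "n mod m"])
  qed
  have L'E: "\<exists>i<m. \<exists>l\<in>L. g = t [^] i \<otimes> l" if "g \<in> L'" for g using that by (auto simp: L'_def)
  have L'M: "L' \<subseteq> M" using L'E powM LM M(1) by (fastforce intro: subgroup.m_closed)
  have "subgroup L' G"
  proof (rule finite_closed_subgroup)
    show "L' \<subseteq> carrier G" using L'M Mc by blast
    show "finite L'" using L'M M(2) finite_subset by blast
    show "L' \<noteq> {}" using L'I subgroup.one_closed[OF L] by blast
    fix x y assume "x \<in> L'" "y \<in> L'"
    then obtain i k i' k' where x: "x = t [^] (i::nat) \<otimes> k" "k \<in> L" and y: "y = t [^] (i'::nat) \<otimes> k'" "k' \<in> L"
      using L'E by metis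
    let ?p = "t [^] i" and ?q = "t [^] i'"
    have c: "k \<in> carrier G" "k' \<in> carrier G" "?p \<in> carrier G" "?q \<in> carrier G" using x y Lc tc by auto
    \<comment> \<open>Moving \<open>k\<close> past \<open>?q\<close> costs a conjugation, under
      which \<open>L\<close> is invariant.\<close>
    have "x \<otimes> y = (?p \<otimes> ?q) \<otimes> ((inv ?q \<otimes> k \<otimes> ?q) \<otimes> k')"
      unfolding x y using c by (simp add: m_assoc)
    also have "?p \<otimes> ?q = t [^] (i + i')" using tc by (simp add: nat_pow_mult)
    finally show "x \<otimes> y \<in> L'"
      using L'I norm'[OF powM x(2)] y(2) subgroup.m_closed[OF L] by metis
  qed
  moreover have "L \<subseteq> L'" using L'I[of _ 0] Lc by (auto simp: subset_iff)
  moreover have "s \<in> L'"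
  proof -
    have "t \<in> L'" using L'I[OF subgroup.one_closed[OF L], of 1] tc by simp
    moreover have "inv (last W) \<in> L'" using \<open>L \<subseteq> L'\<close> lastL subgroup.m_inv_closed[OF L] by blast
    ultimately have "inv (last W) \<otimes> t \<in> L'" using \<open>subgroup L' G\<close> by (simp add: subgroup.m_closed)
    moreover have "inv (last W) \<otimes> t = s" unfolding t_def using lastL s Lc Mc
      by (simp add: subset_iff m_assoc[symmetric])
    ultimately show ?thesis by simp
  qed
  moreover note L'M
  moreover have "\<exists>W'. coset_path K (insert s S) L' W'"
  proof -
    define V where "V n = concat (map (\<lambda>i. map ((\<otimes>) (t [^] i)) W) [0..<n])" for n :: nat
    have V_Suc: "V (Suc n) = V n @ map ((\<otimes>) (t [^] n)) W" for n by (simp add: V_def)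
    have setV: "set (V n) = (\<Union>i<n. (\<otimes>) (t [^] i) ` set W)" for n by (auto simp: V_def)
    have Vprops: "V n \<noteq> [] \<and> hd (V n) = \<one> \<and> successively (step (insert s S)) (V n) \<and>
        last (V n) = t [^] (n - 1) \<otimes> last W" if "0 < n" for n
      using that
    proof (induction n)
      case (Suc n)
      let ?B = "map ((\<otimes>) (t [^] n)) W"
      have B: "?B \<noteq> []" "hd ?B = t [^] n" "last ?B = t [^] n \<otimes> last W"
        using Wne Whd tc by (simp_all add: hd_map last_map)
      have Bstep: "successively (step (insert s S)) ?B"
        by (rule successively_step_mono[OF successively_step_translate[OF _ _ _ Wstep]])
          (use tc S Mc WL Lc in auto)
      show ?case
      proof (cases "n = 0")
        case True
        then show ?thesis using B Bstep by (simp add: V_Suc) (simp add: V_def)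
      next
        case False
        then have IH: "V n \<noteq> []" "hd (V n) = \<one>" "successively (step (insert s S)) (V n)"
          "last (V n) = t [^] (n - 1) \<otimes> last W" using Suc.IH by auto
        have "t [^] n = t [^] (n - 1) \<otimes> t" using False by (cases n) auto
        also have "\<dots> = last (V n) \<otimes> s"
          unfolding IH(4) t_def using lastL s Lc Mc tc by (simp add: m_assoc subset_iff)
        finally have "step (insert s S) (last (V n)) (hd ?B)" unfolding B(2) step_def by blast
        with IH B Bstep show ?thesis by (simp add: V_Suc successively_append_iff)
      qed
    qed simp
    \<comment> \<open>Two vertices of blocks \<open>i \<le> j\<close> in one coset of
      \<open>K\<close> put \<open>t^(j - i)\<close> into \<open>L\<close>. Minimality of
      \<open>m\<close> gives \<open>i = j\<close>, and then separatedness of \<open>W\<close>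
      applies.\<close>
    have sep: "i = j \<and> v = w" if ij: "i \<le> j" "j < m" and vw: "v \<in> set W" "w \<in> set W"
      and K': "inv (t [^] i \<otimes> v) \<otimes> (t [^] j \<otimes> w) \<in> K" for i j v w
    proof -
      have c: "v \<in> carrier G" "w \<in> carrier G" using vw WL Lc by auto
      have vwL: "v \<in> L" "w \<in> L" using vw WL by auto
      have "t [^] j = t [^] i \<otimes> t [^] (j - i)" using ij(1) tc by (simp add: nat_pow_mult)
      then have eq: "inv (t [^] i \<otimes> v) \<otimes> (t [^] j \<otimes> w) = inv v \<otimes> (t [^] (j - i) \<otimes> w)"
        using c tc by (simp add: m_assoc)
      then have "inv v \<otimes> (t [^] (j - i) \<otimes> w) \<in> L" using K' KL by auto
      then have "v \<otimes> (inv v \<otimes> (t [^] (j - i) \<otimes> w)) \<otimes> inv w \<in> L"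
        using vwL L by (simp add: subgroup.m_closed subgroup.m_inv_closed)
      moreover have "v \<otimes> (inv v \<otimes> (t [^] (j - i) \<otimes> w)) \<otimes> inv w = t [^] (j - i)"
        using c tc by (simp add: m_assoc[symmetric]) (simp add: m_assoc)
      ultimately have "j - i = 0" using m_min[of "j - i"] ij less_imp_diff_less[of j m i] by simp
      then have "i = j" using ij by simp
      moreover have "inv v \<otimes> w \<in> K" using K' eq \<open>j - i = 0\<close> c by simp
      ultimately show ?thesis using Wsep vw by (auto simp: separated_def)
    qed
    have sep': "x = y" if xy: "x \<in> set (V m)" "y \<in> set (V m)" "inv x \<otimes> y \<in> K" for x y
    proof -
      obtain i j v w where x: "i < m" "v \<in> set W" "x = t [^] i \<otimes> v"
        and y: "j < m" "w \<in> set W" "y = t [^] j \<otimes> w"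
        using xy by (auto simp: setV)
      have c: "x \<in> carrier G" "y \<in> carrier G" using x y tc WL Lc by auto
      have "inv (inv x \<otimes> y) \<in> K" using xy(3) subgroup.m_inv_closed[OF K] by blast
      then have "inv y \<otimes> x \<in> K" using c by (simp add: inv_mult_group)
      then show ?thesis using sep[of i j v w] sep[of j i w v] x y xy(3) by (cases "i \<le> j") auto
    qed
    have "distinct (V n)" if "n \<le> m" for n
      using that
    proof (induction n)
      case (Suc n)
      have "inj_on ((\<otimes>) (t [^] n)) (set W)" using WL Lc tc by (intro inj_on_translate) auto
      moreover have "distinct W" using Wsep by (simp add: separated_def)
      moreover have False if "i < n" "v \<in> set W" "w \<in> set W" "t [^] n \<otimes> w = t [^] i \<otimes> v" for i v w
      proof -
        from that(4)[symmetric] have "inv (t [^] i \<otimes> v) \<otimes> (t [^] n \<otimes> w) = \<one>" using that(2,3) WL Lc tc by (auto simp: subset_iff)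
        then show False using sep[of i n v w] that Suc.prems subgroup.one_closed[OF K] by simp
      qed
      ultimately show ?case using Suc by (auto simp: V_Suc distinct_map setV)
    qed (simp add: V_def)
    then have "separated K (V m)" using sep' by (auto simp: separated_def)
    moreover have "set (V m) \<subseteq> L'" unfolding setV using L'I WL by auto
    moreover have "\<exists>w\<in>set (V m). inv w \<otimes> g \<in> K" if gL': "g \<in> L'" for g
    proof -
      obtain i l where l: "i < m" "l \<in> L" "g = t [^] i \<otimes> l" using L'E[OF gL'] by blast
      obtain w where w: "w \<in> set W" "inv w \<otimes> l \<in> K" using Wcov[OF l(2)] by blast
      have "inv (t [^] i \<otimes> w) \<otimes> g = inv w \<otimes> l" unfolding l(3) using l(2) w(1) tc WL Lc by (simp add: subset_iff)
      with w l(1) show ?thesis unfolding setV by (intro bexI[of _ "t [^] i \<otimes> w"]) auto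
    qed
    ultimately have "coset_path K (insert s S) L' (V m)"
      using Vprops[OF m(1)] unfolding coset_path_def by blast
    then show ?thesis by blast
  qed
  ultimately show ?thesis by blast
qed

text \<open>The generators are added one at a time, each enlarging \<open>L\<close>. The
  intermediate subgroups are not known in advance, so normality in \<open>M\<close> is required of
  every subgroup of \<open>M\<close>.\<close>

lemma coset_path_exists:
  assumes M: "subgroup M G" "finite M" and K: "subgroup K G" "K \<subseteq> M" and S: "S \<subseteq> M"
    and norm: "\<And>L x l. subgroup L G \<Longrightarrow> L \<subseteq> M \<Longrightarrow> x \<in> M \<Longrightarrow> l \<in> L \<Longrightarrow> x \<otimes> l \<otimes> inv x \<in> L"
  shows "\<exists>L W. subgroup L G \<and> K \<subseteq> L \<and> S \<subseteq> L \<and> L \<subseteq> M \<and> coset_path K S L W"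
proof -
  have "finite S" using S M(2) finite_subset by blast
  then show ?thesis using S
  proof (induction S)
    case empty
    have "coset_path K {} K [\<one>]"
      using subgroup.one_closed[OF K(1)] subgroup.subset[OF K(1)]
      by (auto simp: coset_path_def separated_def subset_iff)
    with K show ?case by blast
  next
    case (insert s S)
    then obtain L W where L: "subgroup L G" "K \<subseteq> L" "S \<subseteq> L" "L \<subseteq> M" "coset_path K S L W" by auto
    have "\<exists>L' W'. subgroup L' G \<and> L \<subseteq> L' \<and> s \<in> L' \<and> L' \<subseteq> M \<and> coset_path K (insert s S) L' W'"
      by (rule coset_path_extend[OF M K(1) L(1,2,4) _ _ _ L(5)])
        (use insert.prems norm[OF L(1) L(4)] in auto)
    then show ?case using L by (meson insert_subset order_trans)
  qed
qed

end

section \<open>Covering a coset by two paths\<close>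

text \<open>In an alternating list the two classes balance up to the end points. If both end points
  satisfy \<open>P\<close>, that class has one element more.\<close>

lemma alternating_filter_length:
  assumes "U \<noteq> []" "successively (\<lambda>x y. P x \<longleftrightarrow> \<not> P y) U"
  shows "length (filter P U) + of_bool (\<not> P (hd U)) = length (filter (\<lambda>x. \<not> P x) U) + of_bool (P (last U))"
  using assms
  by (induction U rule: induct_list012) auto

text \<open>The infinite dihedral group, acting simply transitively on the integers: an element is identified
  with the image of \<open>0\<close>; even elements are translations and odd ones are reflections.\<close>

definition int_dihedral :: "int monoid" where
  "int_dihedral = \<lparr>carrier = UNIV, mult = (\<lambda>m n. if even m then m + n else m - n), one = 0\<rparr>"

text \<open>The amalgam as seen from its factor \<open>G\<close>: of the other factor only one element \<open>b\<close> outside \<open>H\<close>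
  matters.\<close>

locale dihedral_extension = group A for A (structure) +
  fixes G H S :: "'a set" and b :: 'a and level :: "'a \<Rightarrow> int"
  assumes G_subgroup: "subgroup G A" and H_subgroup: "subgroup H A" and H_sub: "H \<subseteq> G"
    and finite_G: "finite G"
    and S_sub: "S \<subseteq> G" and S_generates: "generate A S = G"
    and H_proper: "H \<noteq> G" and H_nontrivial: "H \<noteq> {\<one>}"
    and dedekind: "subgroup K A \<Longrightarrow> K \<subseteq> G \<Longrightarrow> x \<in> G \<Longrightarrow> k \<in> K \<Longrightarrow> x \<otimes> k \<otimes> inv x \<in> K"
    and b_carrier: "b \<in> carrier A" and b_square: "b \<otimes> b \<in> H"
    and b_conj: "h \<in> H \<Longrightarrow> inv b \<otimes> h \<otimes> b \<in> H"
    and generates: "generate A (insert b G) = carrier A"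
    and level_hom: "level \<in> hom A int_dihedral"
    and level_H: "h \<in> H \<Longrightarrow> level h = 0"
    and level_G: "g \<in> G \<Longrightarrow> g \<notin> H \<Longrightarrow> level g = 1"
    and level_b: "level b = - 1"
begin

section \<open>Levels and the cosets of \<open>H\<close> and of \<open>G\<close>\<close>

lemma G_carrier: "g \<in> G \<Longrightarrow> g \<in> carrier A"
  using G_subgroup by (rule subgroup.mem_carrier)

lemma H_carrier: "h \<in> H \<Longrightarrow> h \<in> carrier A"
  using H_subgroup by (rule subgroup.mem_carrier)

lemma S_carrier: "S \<subseteq> carrier A"
  using S_sub G_carrier by blast

lemma level_mult:
  "x \<in> carrier A \<Longrightarrow> y \<in> carrier A \<Longrightarrow>
    level (x \<otimes> y) = (if even (level x) then level x + level y else level x - level y)"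
  using hom_mult[OF level_hom, of x y] by (simp add: int_dihedral_def)

lemma level_one: "level \<one> = 0"
  using level_H subgroup.one_closed[OF H_subgroup] by blast

lemma G_mult: "g \<in> G \<Longrightarrow> h \<in> G \<Longrightarrow> g \<otimes> h \<in> G"
  using G_subgroup by (simp add: subgroup.m_closed)

lemma G_inv: "g \<in> G \<Longrightarrow> inv g \<in> G"
  using G_subgroup by (simp add: subgroup.m_inv_closed)

lemma H_iff_level: "g \<in> G \<Longrightarrow> g \<in> H \<longleftrightarrow> level g = 0"
  using level_H level_G by fastforce

lemma level_G_cases: "g \<in> G \<Longrightarrow> level g = 0 \<or> level g = 1"
  using level_H level_G by blast

lemma mult_H_iff: "g \<in> G \<Longrightarrow> h \<in> G \<Longrightarrow> g \<otimes> h \<in> H \<longleftrightarrow> (g \<in> H \<longleftrightarrow> h \<in> H)"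
  using level_G_cases[of g] level_G_cases[of h]
  by (auto simp: H_iff_level G_mult level_mult G_carrier)

lemma inv_H_iff: "g \<in> G \<Longrightarrow> inv g \<in> H \<longleftrightarrow> g \<in> H"
  using mult_H_iff[of "inv g" g] subgroup.one_closed[OF H_subgroup] by (simp add: G_inv G_carrier)

text \<open>The levels 1 of \<open>a\<close> and -1 of \<open>b\<close> are reflections, and their
  product is the translation by \<open>1 - (-1) = 2\<close>.\<close>

lemma level_even_power: "a \<in> G \<Longrightarrow> a \<notin> H \<Longrightarrow> level ((a \<otimes> b) [^] (k::int)) = 2 * k"
proof (induction k rule: int_induct[of _ 0])
  case base
  then show ?case by (simp add: level_one)
next
  case (step1 i)
  have c: "a \<otimes> b \<in> carrier A" using step1 G_carrier b_carrier by simp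
  have "(a \<otimes> b) [^] (i + 1) = (a \<otimes> b) [^] i \<otimes> (a \<otimes> b)"
    using int_pow_mult[OF c, of i 1] c by simp
  then show ?case
    using step1 c by (simp add: level_mult G_carrier b_carrier level_G level_b)
next
  case (step2 i)
  have c: "a \<otimes> b \<in> carrier A" using step2 G_carrier b_carrier by simp
  have "(a \<otimes> b) [^] i = (a \<otimes> b) [^] (i - 1) \<otimes> (a \<otimes> b)"
    using int_pow_mult[OF c, of "i - 1" 1] c by simp
  then have "level ((a \<otimes> b) [^] i) = level ((a \<otimes> b) [^] (i - 1) \<otimes> (a \<otimes> b))" by simp
  then have "2 * i = level ((a \<otimes> b) [^] (i - 1) \<otimes> (a \<otimes> b))" using step2 by simp
  also have "\<dots> = (if even (level ((a \<otimes> b) [^] (i - 1))) then level ((a \<otimes> b) [^] (i - 1)) + 2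
      else level ((a \<otimes> b) [^] (i - 1)) - 2)"
    using step2 c by (simp add: level_mult G_carrier b_carrier level_G level_b)
  finally show ?case by presburger
qed

text \<open>The elements of this form include 1 and are closed under right multiplication by
  \<open>G\<close>, by \<open>b\<close> and by the inverse of \<open>b\<close>, so they exhaust the
  group. In other words, powers of \<open>a \<otimes> b\<close> represent all left cosets of
  \<open>G\<close>.\<close>

lemma normal_form:
  assumes a: "a \<in> G" "a \<notin> H" and x: "x \<in> carrier A"
  shows "\<exists>k::int. \<exists>g\<in>G. x = (a \<otimes> b) [^] k \<otimes> g"
proof -
  define M where "M = {(a \<otimes> b) [^] k \<otimes> g |(k::int) g. g \<in> G}"
  have ac: "a \<in> carrier A" using a G_carrier by blast
  have cc: "a \<otimes> b \<in> carrier A" using ac b_carrier by simp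
  have M_G: "y \<otimes> g \<in> M" if y: "y \<in> M" and g: "g \<in> G" for y g
  proof -
    obtain k :: int and f where f: "f \<in> G" "y = (a \<otimes> b) [^] k \<otimes> f" using y by (auto simp: M_def)
    have "y \<otimes> g = (a \<otimes> b) [^] k \<otimes> (f \<otimes> g)" unfolding f(2) using cc f(1) g G_carrier by (simp add: m_assoc)
    then show ?thesis using f(1) g G_mult unfolding M_def by blast
  qed
  have M_b: "y \<otimes> b \<in> M" if y: "y \<in> M" for y
  proof -
    obtain k :: int and g where g: "g \<in> G" "y = (a \<otimes> b) [^] k \<otimes> g" using y by (auto simp: M_def)
    let ?c = "(a \<otimes> b) [^] k"
    have kc: "?c \<in> carrier A" using cc by simp
    show ?thesis
    proof (cases "g \<in> H")
      case True
      \<comment> \<open>One factor \<open>a b\<close> is split off: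
        \<open>(a b)^k g b = (a b)^(k-1) a (b b) (b^-1 g b)\<close>.\<close>
      let ?h = "inv b \<otimes> g \<otimes> b"
      have h: "?h \<in> H" using b_conj True .
      have gc: "g \<in> carrier A" using g(1) G_carrier by blast
      have "(a \<otimes> b) [^] k = (a \<otimes> b) [^] (k - 1) \<otimes> (a \<otimes> b)"
        using int_pow_mult[OF cc, of "k - 1" 1] cc by simp
      then have "y \<otimes> b = (a \<otimes> b) [^] (k - 1) \<otimes> (a \<otimes> (b \<otimes> b) \<otimes> ?h)"
        unfolding g(2) using cc ac b_carrier gc by (simp add: m_assoc)
      moreover have "a \<otimes> (b \<otimes> b) \<otimes> ?h \<in> G" using a(1) b_square h H_sub G_mult by blast
      ultimately show ?thesis unfolding M_def by blast
    next
      case False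
      \<comment> \<open>Here \<open>a^-1 g\<close> lies in \<open>H\<close> and
        \<open>g b = (a b) (b^-1 (a^-1 g) b)\<close>, so the exponent grows by one.\<close>
      let ?h = "inv b \<otimes> (inv a \<otimes> g) \<otimes> b"
      have gc: "g \<in> carrier A" using g(1) G_carrier by blast
      have "inv a \<otimes> g \<in> H" using False a g(1) by (simp add: mult_H_iff G_inv inv_H_iff)
      then have h: "?h \<in> G" using b_conj H_sub by blast
      have "(a \<otimes> b) [^] (k + 1) = (a \<otimes> b) [^] k \<otimes> (a \<otimes> b)"
        using int_pow_mult[OF cc, of k 1] cc by simp
      then have "y \<otimes> b = (a \<otimes> b) [^] (k + 1) \<otimes> ?h"
        unfolding g(2) using cc ac b_carrier gc by (simp add: m_assoc)
      with h show ?thesis unfolding M_def by blast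
    qed
  qed
  have M_carrier: "M \<subseteq> carrier A" using cc G_carrier by (auto simp: M_def)
  have "y \<otimes> g \<in> M" if "g \<in> generate A (insert b G)" "y \<in> M" for g y
    using that
  proof (induction arbitrary: y rule: generate.induct)
    case one
    then show ?case using M_carrier by auto
  next
    case (incl g)
    then show ?case using M_G M_b by blast
  next
    case (inv g)
    show ?case
    proof (cases "g = b")
      case True
      have bb: "inv (b \<otimes> b) \<in> G" using b_square H_sub G_inv by blast
      have yc: "y \<in> carrier A" using inv M_carrier by blast
      \<comment> \<open>Since \<open>b b\<close> lies in \<open>H\<close>, the inverse of
        \<open>b\<close> is \<open>b\<close> times an element of \<open>G\<close>.\<close>
      have "y \<otimes> inv b = y \<otimes> b \<otimes> inv (b \<otimes> b)"
        using yc b_carrier by (simp add: m_assoc inv_mult_group)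
      then show ?thesis using M_G[OF M_b[OF inv.prems] bb] True by simp
    next
      case False
      then show ?thesis using inv M_G G_inv by blast
    qed
  next
    case (eng g h)
    have "g \<in> carrier A" "h \<in> carrier A"
      using eng.hyps generate_in_carrier[of "insert b G"] b_carrier G_carrier by blast+
    then have "y \<otimes> (g \<otimes> h) = y \<otimes> g \<otimes> h" using eng.prems M_carrier by (simp add: m_assoc subset_iff)
    then show ?case using eng by simp
  qed
  moreover have "\<one> \<in> M"
    using subgroup.one_closed[OF G_subgroup] unfolding M_def by (force intro!: exI[of _ "0::int"])
  ultimately have "\<one> \<otimes> x \<in> M" using x generates by blast
  then show ?thesis using x by (auto simp: M_def)
qed

text \<open>The level of \<open>(a b)^k g\<close> is \<open>2 k\<close> for \<open>g\<close> in
  \<open>H\<close> and \<open>2 k + 1\<close> otherwise. It thus determines \<open>k\<close> and the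
  coset of \<open>g\<close>, so the fibres of \<open>level\<close> are no larger than cosets of
  \<open>H\<close>.\<close>

lemma level_eq_imp_H:
  assumes x: "x \<in> carrier A" and y: "y \<in> carrier A" and eq: "level x = level y"
  shows "inv x \<otimes> y \<in> H"
proof -
  obtain a where a: "a \<in> G" "a \<notin> H" using H_proper H_sub by blast
  obtain k :: int and g where g: "g \<in> G" "x = (a \<otimes> b) [^] k \<otimes> g" using normal_form[OF a x] by blast
  obtain l :: int and h where h: "h \<in> G" "y = (a \<otimes> b) [^] l \<otimes> h" using normal_form[OF a y] by blast
  have cc: "a \<otimes> b \<in> carrier A" using a G_carrier b_carrier by simp
  have "level x = 2 * k + level g" "level y = 2 * l + level h"
    unfolding g(2) h(2) using cc g(1) h(1) by (simp_all add: level_mult level_even_power[OF a] G_carrier)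
  then have *: "k = l" "level g = level h"
    using eq level_G_cases[OF g(1)] level_G_cases[OF h(1)] by presburger+
  then have "inv x \<otimes> y = inv g \<otimes> h" unfolding g(2) h(2) using cc g(1) h(1) G_carrier by simp
  moreover have "g \<in> H \<longleftrightarrow> h \<in> H" using * g(1) h(1) by (simp add: H_iff_level)
  ultimately show ?thesis using g(1) h(1) by (simp add: mult_H_iff G_inv inv_H_iff)
qed

lemma level_eq_iff:
  assumes "x \<in> carrier A" "y \<in> carrier A"
  shows "inv x \<otimes> y \<in> H \<longleftrightarrow> level x = level y"
proof
  assume "inv x \<otimes> y \<in> H"
  then have "level (x \<otimes> (inv x \<otimes> y)) = level x" using assms level_mult[of x "inv x \<otimes> y"] by (simp add: level_H)
  then show "level x = level y" using assms by simp
qed (use level_eq_imp_H assms in blast)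

text \<open>An element of even level acts as a translation, so multiplying it by \<open>G\<close>
  adds 0 or 1. Conversely, some \<open>a\<close> in \<open>G - H\<close> reduces the second case to
  equal levels.\<close>

lemma slab_iff:
  assumes x: "x \<in> carrier A" "even (level x)" and y: "y \<in> carrier A"
  shows "inv x \<otimes> y \<in> G \<longleftrightarrow> level y = level x \<or> level y = level x + 1"
proof
  assume *: "inv x \<otimes> y \<in> G"
  have "level (x \<otimes> (inv x \<otimes> y)) = level x + level (inv x \<otimes> y)"
    using x y level_mult[of x "inv x \<otimes> y"] by simp
  then show "level y = level x \<or> level y = level x + 1"
    using x y level_G_cases[OF *] by auto
next
  obtain a where a: "a \<in> G" "a \<notin> H" using H_proper H_sub by blast
  have ac: "a \<in> carrier A" using a G_carrier by blast
  assume "level y = level x \<or> level y = level x + 1"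
  then show "inv x \<otimes> y \<in> G"
  proof
    assume "level y = level x + 1"
    then have "level (x \<otimes> a) = level y" using x a ac by (simp add: level_mult level_G)
    then have "inv (x \<otimes> a) \<otimes> y \<in> G" using level_eq_imp_H x y ac H_sub by blast
    then have "a \<otimes> (inv (x \<otimes> a) \<otimes> y) \<in> G" using a G_mult by blast
    moreover have "a \<otimes> (inv (x \<otimes> a) \<otimes> y) = inv x \<otimes> y"
      using x y ac by (simp add: inv_mult_group m_assoc)
    ultimately show ?thesis by simp
  qed (use level_eq_imp_H[OF x(1) y] H_sub in auto)
qed

section \<open>Lifting paths of cosets to paths of vertices\<close>

lemma hamilton_path:
  assumes K: "K \<subseteq> G" and W: "coset_path {\<one>} S K W"
  shows "W \<noteq> []" "hd W = \<one>" "set W = K" "successively (step S) W" "distinct W"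
proof -
  show "W \<noteq> []" "hd W = \<one>" "successively (step S) W" "distinct W"
    using W by (auto simp: coset_path_def separated_def)
  have "g \<in> set W" if g: "g \<in> K" for g
  proof -
    obtain w where w: "w \<in> set W" "inv w \<otimes> g = \<one>" using W g by (auto simp: coset_path_def)
    have c: "w \<in> carrier A" "g \<in> carrier A" using w W g K G_carrier by (auto simp: coset_path_def)
    then have "g = w \<otimes> (inv w \<otimes> g)" by simp
    also have "\<dots> = w" using c w(2) by simp
    finally show ?thesis using w(1) by simp
  qed
  then show "set W = K" using W by (auto simp: coset_path_def)
qed

lemma coset_image:
  assumes K: "subgroup K A" and u: "u \<in> carrier A" and e: "e \<in> carrier A" "inv u \<otimes> e \<in> K"
  shows "(\<otimes>) e ` K = {g \<in> carrier A. inv u \<otimes> g \<in> K}"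
proof (intro equalityI subsetI)
  have Kc: "k \<in> carrier A" if "k \<in> K" for k using subgroup.mem_carrier[OF K that] .
  fix g assume "g \<in> (\<otimes>) e ` K"
  then obtain k where k: "k \<in> K" "g = e \<otimes> k" by blast
  then have "inv u \<otimes> g = (inv u \<otimes> e) \<otimes> k" using u e Kc by (simp add: m_assoc)
  with k e K Kc show "g \<in> {g \<in> carrier A. inv u \<otimes> g \<in> K}" by (simp add: subgroup.m_closed)
next
  fix g assume g: "g \<in> {g \<in> carrier A. inv u \<otimes> g \<in> K}"
  have "inv e \<otimes> g = inv (inv u \<otimes> e) \<otimes> (inv u \<otimes> g)" using g u e by (simp add: inv_mult_group m_assoc)
  then have "inv e \<otimes> g \<in> K" using g e K by (simp add: subgroup.m_closed subgroup.m_inv_closed)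
  moreover have "g = e \<otimes> (inv e \<otimes> g)" using g e by simp
  ultimately show "g \<in> (\<otimes>) e ` K" by (rule rev_image_eqI)
qed

text \<open>Normality of \<open>K\<close> ensures that leaving a coset by a generator \<open>s\<close> leads to the same
  next coset from every vertex.\<close>

lemma step_coset:
  assumes K: "subgroup K A" "K \<subseteq> G" and c: "u \<in> carrier A" "z \<in> carrier A" "inv u \<otimes> z \<in> K" and s: "s \<in> S"
  shows "inv (u \<otimes> s) \<otimes> (z \<otimes> s) \<in> K"
proof -
  have sG: "s \<in> G" using s S_sub by blast
  have "inv (u \<otimes> s) \<otimes> (z \<otimes> s) = inv s \<otimes> (inv u \<otimes> z) \<otimes> inv (inv s)"
    using c G_carrier[OF sG] by (simp add: inv_mult_group m_assoc)
  then show ?thesis using dedekind[OF K G_inv[OF sG] c(3)] by simp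
qed

text \<open>Each representative is replaced by a translate of \<open>W\<close> that runs through its
  whole coset. Leaving the last vertex by the generator that joins the representatives enters the
  next coset, but not necessarily at its representative; hence the arbitrary entry point
  \<open>e\<close>.\<close>

lemma lift_coset_path:
  assumes K: "subgroup K A" "K \<subseteq> G" and W: "coset_path {\<one>} S K W"
    and "set (u # V) \<subseteq> carrier A" "successively (step S) (u # V)" "separated K (u # V)"
    and "e \<in> carrier A" "inv u \<otimes> e \<in> K"
  shows "\<exists>P. P \<noteq> [] \<and> hd P = e \<and> successively (step S) P \<and> distinct P \<and>
    set P = {g \<in> carrier A. \<exists>v\<in>set (u # V). inv v \<otimes> g \<in> K} \<and> inv (last (u # V)) \<otimes> last P \<in> K"
  using assms(4-)
proof (induction V arbitrary: u e)
  case (Nil u e)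
  note Wp = hamilton_path[OF K(2) W]
  have Kc: "K \<subseteq> carrier A" using K(1) subgroup.subset by blast
  define B where "B = map ((\<otimes>) e) W"
  have "B \<noteq> []" "hd B = e" "distinct B" "successively (step S) B"
    using Wp Nil Kc S_carrier
    by (auto simp: B_def hd_map distinct_map intro!: inj_on_translate successively_step_translate)
  moreover have "set B = {g \<in> carrier A. inv u \<otimes> g \<in> K}"
    unfolding B_def using Wp coset_image[OF K(1), of u e] Nil by simp
  moreover from calculation have "inv u \<otimes> last B \<in> K" using last_in_set by blast
  ultimately show ?case by (intro exI[of _ B]) simp
next
  case (Cons v V u e)
  note Wp = hamilton_path[OF K(2) W]
  have Kc: "K \<subseteq> carrier A" using K(1) subgroup.subset by blast
  define B where "B = map ((\<otimes>) e) W"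
  have B: "B \<noteq> []" "hd B = e" "distinct B" "successively (step S) B"
    using Wp Cons.prems Kc S_carrier
    by (auto simp: B_def hd_map distinct_map intro!: inj_on_translate successively_step_translate)
  have setB: "set B = {g \<in> carrier A. inv u \<otimes> g \<in> K}"
    unfolding B_def using Wp coset_image[OF K(1), of u e] Cons.prems by simp
  have lastB: "last B \<in> carrier A" "inv u \<otimes> last B \<in> K" using B(1) setB last_in_set by blast+
  obtain s where s: "s \<in> S" "v = u \<otimes> s" using Cons.prems by (auto simp: step_def)
  have sc: "s \<in> carrier A" using s S_carrier by blast
  have uc: "u \<in> carrier A" using Cons.prems by simp
  have "inv v \<otimes> (last B \<otimes> s) \<in> K" unfolding s(2) by (rule step_coset[OF K uc lastB s(1)])
  moreover have "last B \<otimes> s \<in> carrier A" using lastB sc by simp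
  moreover have "separated K (v # V)" using Cons.prems separated_Cons by blast
  ultimately obtain P where P: "P \<noteq> []" "hd P = last B \<otimes> s" "successively (step S) P" "distinct P"
      "set P = {g \<in> carrier A. \<exists>w\<in>set (v # V). inv w \<otimes> g \<in> K}" "inv (last (v # V)) \<otimes> last P \<in> K"
    using Cons.IH[of v "last B \<otimes> s"] Cons.prems by auto
  have "set B \<inter> set P = {}"
  proof -
    have False if g: "g \<in> carrier A" "inv u \<otimes> g \<in> K" "w \<in> set (v # V)" "inv w \<otimes> g \<in> K" for g w
    proof -
      have wc: "w \<in> carrier A" using g Cons.prems by auto
      have "inv u \<otimes> w = (inv u \<otimes> g) \<otimes> inv (inv w \<otimes> g)"
        using g wc uc by (simp add: inv_mult_group m_assoc)
      then have "inv u \<otimes> w \<in> K" using g K by (simp add: subgroup.m_closed subgroup.m_inv_closed)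
      moreover have "u \<in> set (u # v # V)" "w \<in> set (u # v # V)" using g(3) by auto
      ultimately have "u = w" using Cons.prems(3) unfolding separated_def by blast
      then show False using Cons.prems(3) g(3) unfolding separated_def distinct.simps by blast
    qed
    then show ?thesis unfolding setB P(5) by blast
  qed
  moreover have "successively (step S) (B @ P)"
    using B P s by (auto simp: successively_append_iff step_def)
  moreover have "set (B @ P) = {g \<in> carrier A. \<exists>w\<in>set (u # v # V). inv w \<otimes> g \<in> K}"
    using setB P(5) by auto
  ultimately show ?case using B P by (intro exI[of _ "B @ P"]) simp
qed

text \<open>A variant for a path that has already arrived at \<open>z\<close> in the coset of
  \<open>u\<close>: only the cosets after \<open>u\<close> are visited, possibly none.\<close>

lemma lift_coset_path_continue:
  assumes K: "subgroup K A" "K \<subseteq> G" and W: "coset_path {\<one>} S K W"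
    and V: "set (u # V) \<subseteq> carrier A" "successively (step S) (u # V)" "separated K (u # V)"
    and z: "z \<in> carrier A" "inv u \<otimes> z \<in> K"
  shows "\<exists>R. successively (step S) (z # R) \<and> distinct R \<and>
    set R = {g \<in> carrier A. \<exists>v\<in>set V. inv v \<otimes> g \<in> K} \<and> inv (last (u # V)) \<otimes> last (z # R) \<in> K"
proof (cases V)
  case Nil
  with z show ?thesis by (intro exI[of _ "[]"]) simp
next
  case (Cons v V')
  obtain s where s: "s \<in> S" "v = u \<otimes> s" using V Cons by (auto simp: step_def)
  have "s \<in> carrier A" using s S_carrier by blast
  moreover have uc: "u \<in> carrier A" using V by simp
  have "inv v \<otimes> (z \<otimes> s) \<in> K" unfolding s(2) by (rule step_coset[OF K uc z s(1)])
  ultimately obtain P where P: "P \<noteq> []" "hd P = z \<otimes> s" "successively (step S) P" "distinct P"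
      "set P = {g \<in> carrier A. \<exists>w\<in>set (v # V'). inv w \<otimes> g \<in> K}" "inv (last (v # V')) \<otimes> last P \<in> K"
    using lift_coset_path[OF K W, of v V' "z \<otimes> s"] V z separated_Cons Cons by auto
  then show ?thesis using s Cons
    by (intro exI[of _ P]) (auto simp: successively_Cons step_def)
qed

text \<open>A Hamilton path of the coset starting at \<open>p\<close> is cut just before
  \<open>q\<close>; as \<open>p \<noteq> q\<close>, both pieces are non-empty.\<close>

lemma split_block:
  assumes K: "subgroup K A" "K \<subseteq> G" and W: "coset_path {\<one>} S K W"
    and pq: "p \<in> carrier A" "q \<in> carrier A" "inv p \<otimes> q \<in> K" "p \<noteq> q"
  shows "\<exists>P Q. P \<noteq> [] \<and> Q \<noteq> [] \<and> hd P = p \<and> hd Q = q \<and> successively (step S) P \<and>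
    successively (step S) Q \<and> distinct (P @ Q) \<and> set (P @ Q) = {g \<in> carrier A. inv p \<otimes> g \<in> K}"
proof -
  have "inv p \<otimes> p \<in> K" using pq subgroup.one_closed[OF K(1)] by simp
  moreover have "separated K [p]" "successively (step S) [p]" by (simp_all add: separated_def)
  ultimately obtain B where B: "B \<noteq> []" "hd B = p" "successively (step S) B" "distinct B"
      "set B = {g \<in> carrier A. inv p \<otimes> g \<in> K}"
    using lift_coset_path[OF K W, of p "[]" p] pq(1) by auto
  then have "q \<in> set B" using pq by simp
  then obtain P Q where PQ: "B = P @ q # Q" using split_list by metis
  then have "P \<noteq> []" using B(2) pq(4) by auto
  with B PQ show ?thesis
    by (intro exI[of _ P] exI[of _ "q # Q"]) (auto simp: successively_append_iff)
qed

section \<open>Hamilton paths of \<open>K\<close> and of \<open>G / K\<close>\<close>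

lemma S_inter_H_path:
  "\<exists>K W. subgroup K A \<and> S \<inter> H \<subseteq> K \<and> K \<subseteq> H \<and> coset_path {\<one>} S K W"
proof -
  have "\<exists>L W. subgroup L A \<and> {\<one>} \<subseteq> L \<and> S \<inter> H \<subseteq> L \<and> L \<subseteq> H \<and> coset_path {\<one>} (S \<inter> H) L W"
  proof (rule coset_path_exists)
    show "finite H" using H_sub finite_G finite_subset by blast
    show "{\<one>} \<subseteq> H" using subgroup.one_closed[OF H_subgroup] by blast
    show "x \<otimes> l \<otimes> inv x \<in> L" if "subgroup L A" "L \<subseteq> H" "x \<in> H" "l \<in> L" for L x l
      using dedekind[of L x l] that H_sub by blast
  qed (use H_subgroup triv_subgroup in auto)
  moreover have "coset_path {\<one>} (S \<inter> H) L W \<Longrightarrow> coset_path {\<one>} S L W" for L W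
    unfolding coset_path_def using successively_step_mono by blast
  ultimately show ?thesis by blast
qed

lemma card_complement_H: "card (G - H) = card H"
proof -
  obtain a where a: "a \<in> G" "a \<notin> H" using H_proper H_sub by blast
  have ac: "a \<in> carrier A" using a G_carrier by blast
  have "bij_betw ((\<otimes>) a) H (G - H)"
    unfolding bij_betw_def
  proof
    show "inj_on ((\<otimes>) a) H" using ac H_carrier by (intro inj_on_translate) auto
    have "g \<in> (\<otimes>) a ` H" if "g \<in> G" "g \<notin> H" for g
    proof -
      have "inv a \<otimes> g \<in> H" using that a by (simp add: mult_H_iff G_inv inv_H_iff)
      moreover have "g = a \<otimes> (inv a \<otimes> g)" using ac that G_carrier by simp
      ultimately show ?thesis by (rule rev_image_eqI)
    qed
    moreover have "a \<otimes> h \<in> G - H" if "h \<in> H" for h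
      using that a H_sub by (auto simp: mult_H_iff G_mult)
    ultimately show "(\<otimes>) a ` H = G - H" by auto
  qed
  then show ?thesis by (simp add: bij_betw_same_card)
qed

text \<open>Multiplication is a bijection from \<open>U \<times> K\<close> onto this set, because
  the elements of \<open>U\<close> represent different cosets.\<close>

lemma card_coset_union:
  assumes K: "subgroup K A" "K \<subseteq> H" and U: "U \<subseteq> G" "\<forall>x\<in>U. \<forall>y\<in>U. inv x \<otimes> y \<in> K \<longrightarrow> x = y"
  shows "card {g \<in> G. \<exists>u\<in>U. inv u \<otimes> g \<in> K} = card U * card K"
proof -
  have Kc: "k \<in> carrier A" if "k \<in> K" for k using that K H_carrier by blast
  have Uc: "u \<in> carrier A" if "u \<in> U" for u using that U G_carrier by blast
  have "bij_betw (\<lambda>(u, k). u \<otimes> k) (U \<times> K) {g \<in> G. \<exists>u\<in>U. inv u \<otimes> g \<in> K}"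
    unfolding bij_betw_def
  proof
    show "inj_on (\<lambda>(u, k). u \<otimes> k) (U \<times> K)"
    proof (rule inj_onI, clarify)
      fix u k v l assume *: "u \<in> U" "k \<in> K" "v \<in> U" "l \<in> K" "u \<otimes> k = v \<otimes> l"
      have c: "u \<in> carrier A" "k \<in> carrier A" "v \<in> carrier A" "l \<in> carrier A" using * Uc Kc by auto
      have "inv u \<otimes> v = inv u \<otimes> (v \<otimes> l) \<otimes> inv l" using c by (simp add: m_assoc)
      also have "\<dots> = k \<otimes> inv l" unfolding *(5)[symmetric] using c by simp
      finally have "inv u \<otimes> v \<in> K" using * K by (simp add: subgroup.m_closed subgroup.m_inv_closed)
      then have "u = v" using U * by blast
      then show "u = v \<and> k = l" using * c by simp
    qed
    show "(\<lambda>(u, k). u \<otimes> k) ` (U \<times> K) = {g \<in> G. \<exists>u\<in>U. inv u \<otimes> g \<in> K}"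
    proof (intro equalityI subsetI)
      fix g assume "g \<in> (\<lambda>(u, k). u \<otimes> k) ` (U \<times> K)"
      then obtain u k where u: "u \<in> U" "k \<in> K" "g = u \<otimes> k" by auto
      then have "g \<in> G" using U K H_sub G_mult by blast
      moreover have "inv u \<otimes> g \<in> K" using u Uc Kc by simp
      ultimately show "g \<in> {g \<in> G. \<exists>u\<in>U. inv u \<otimes> g \<in> K}" using u(1) by blast
    next
      fix g assume "g \<in> {g \<in> G. \<exists>u\<in>U. inv u \<otimes> g \<in> K}"
      then obtain u where u: "u \<in> U" "g \<in> G" "inv u \<otimes> g \<in> K" by blast
      then have "g = (\<lambda>(u, k). u \<otimes> k) (u, inv u \<otimes> g)" using Uc G_carrier by simp
      moreover have "(u, inv u \<otimes> g) \<in> U \<times> K" using u by blast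
      ultimately show "g \<in> (\<lambda>(u, k). u \<otimes> k) ` (U \<times> K)" by (rule rev_image_eqI[rotated])
    qed
  qed
  from bij_betw_same_card[OF this] show ?thesis by (simp add: card_cartesian_product)
qed

text \<open>Each step by \<open>S - H\<close> changes sides between \<open>H\<close> and its
  complement. Starting and ending in \<open>H\<close> would give one coset of \<open>K\<close> more
  inside \<open>H\<close> than outside, contrary to both sides having the same size.\<close>

lemma coset_path_last_not_H:
  assumes K: "subgroup K A" "K \<subseteq> H" and U: "coset_path K (S - H) G U"
  shows "last U \<notin> H"
proof
  assume lastH: "last U \<in> H"
  have U': "U \<noteq> []" "hd U = \<one>" "set U \<subseteq> G" "successively (step (S - H)) U" "separated K U"
      "\<forall>g\<in>G. \<exists>w\<in>set U. inv w \<otimes> g \<in> K"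
    using U by (auto simp: coset_path_def)
  have "successively (\<lambda>x y. x \<in> H \<longleftrightarrow> y \<notin> H) U"
  proof (rule successively_mono[OF U'(4)])
    fix x y assume "x \<in> set U" "y \<in> set U" "step (S - H) x y"
    then show "x \<in> H \<longleftrightarrow> y \<notin> H" using U'(3) S_sub by (auto simp: step_def mult_H_iff subset_iff)
  qed
  then have len: "length (filter (\<lambda>u. u \<in> H) U) = length (filter (\<lambda>u. u \<notin> H) U) + 1"
    using alternating_filter_length[of U "\<lambda>u. u \<in> H"] U'(1,2) lastH subgroup.one_closed[OF H_subgroup]
    by simp
  have dist: "distinct U" using U'(5) by (simp add: separated_def)
  then have "length (filter P U) = card (set U \<inter> Collect P)" for P
    using distinct_card[of "filter P U"] by (simp add: Int_def)
  then have card: "card (set U \<inter> H) = card (set U - H) + 1"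
    using len by (simp add: Diff_eq Compl_eq)
  have same: "u \<in> H \<longleftrightarrow> g \<in> H" if "u \<in> G" "g \<in> G" "inv u \<otimes> g \<in> K" for u g
    using that K(2) mult_H_iff[of "inv u" g] by (auto simp: G_inv inv_H_iff)
  have "{g \<in> G. \<exists>u\<in>set U \<inter> H. inv u \<otimes> g \<in> K} = H"
    using U'(3,6) same H_sub by blast
  then have 1: "card H = card (set U \<inter> H) * card K"
    using card_coset_union[OF K, of "set U \<inter> H"] U'(3,5) by (auto simp: separated_def)
  have "{g \<in> G. \<exists>u\<in>set U - H. inv u \<otimes> g \<in> K} = G - H"
    using U'(3,6) same H_sub by blast
  then have 2: "card (G - H) = card (set U - H) * card K"
    using card_coset_union[OF K, of "set U - H"] U'(3,5) by (auto simp: separated_def)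
  have "finite K" using K(2) H_sub finite_G by (meson finite_subset)
  then have "card K > 0" using subgroup.one_closed[OF K(1)] card_gt_0_iff by blast
  then show False using 1 2 card card_complement_H by simp
qed

text \<open>The subgroup that is reached contains \<open>K\<close>, hence
  \<open>S \<inter> H\<close>, and also \<open>S - H\<close>; it is all of \<open>G\<close> because
  \<open>S\<close> generates \<open>G\<close>.\<close>

lemma S_minus_H_path:
  assumes K: "subgroup K A" "S \<inter> H \<subseteq> K" "K \<subseteq> H"
  shows "\<exists>U. coset_path K (S - H) G U"
proof -
  have "\<exists>L W. subgroup L A \<and> K \<subseteq> L \<and> S - H \<subseteq> L \<and> L \<subseteq> G \<and> coset_path K (S - H) L W"
    by (rule coset_path_exists)
      (use G_subgroup K H_sub finite_G S_sub dedekind in auto)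
  then obtain L W where L: "subgroup L A" "K \<subseteq> L" "S - H \<subseteq> L" "L \<subseteq> G" "coset_path K (S - H) L W"
    by blast
  have "S \<subseteq> L" using L K by blast
  then have "G \<subseteq> L" using generate_subgroup_incl[OF _ L(1)] S_generates by blast
  with L show ?thesis by auto
qed

text \<open>The cosets of \<open>K\<close> in \<open>x G\<close> are arranged along the translate
  \<open>?U\<close> of a Hamilton path of \<open>G / K\<close>. One path runs to the coset of
  \<open>last ?U\<close>, which is outside \<open>x H\<close>; the cut is placed so that the other
  one ends outside \<open>x H\<close> too.\<close>

lemma two_path_cover:
  assumes x: "x \<in> carrier A" and y: "y \<in> carrier A" and xy: "inv x \<otimes> y \<in> H" "x \<noteq> y"
  shows "\<exists>P Q. P \<noteq> [] \<and> Q \<noteq> [] \<and> hd P = x \<and> hd Q = y \<and> successively (step S) P \<and>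
    successively (step S) Q \<and> distinct (P @ Q) \<and> set (P @ Q) = {g \<in> carrier A. inv x \<otimes> g \<in> G} \<and>
    inv x \<otimes> last P \<in> G - H \<and> inv x \<otimes> last Q \<in> G - H"
proof -
  obtain K W where K: "subgroup K A" "S \<inter> H \<subseteq> K" "K \<subseteq> H" and W: "coset_path {\<one>} S K W"
    using S_inter_H_path by blast
  have KG: "K \<subseteq> G" using K(3) H_sub by blast
  obtain U where U: "coset_path K (S - H) G U" using S_minus_H_path[OF K] by blast
  have U': "U \<noteq> []" "hd U = \<one>" "set U \<subseteq> G" "successively (step (S - H)) U" "separated K U"
      "\<And>g. g \<in> G \<Longrightarrow> \<exists>w\<in>set U. inv w \<otimes> g \<in> K"
    using U by (auto simp: coset_path_def)
  have lastU: "last U \<in> G" "last U \<notin> H"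
    using U' coset_path_last_not_H[OF K(1,3) U] by auto
  have Uc: "set U \<subseteq> carrier A" using U'(3) G_carrier by blast
  have UstepS: "successively (step S) U" using successively_step_mono[OF U'(4)] by blast
  let ?U = "map ((\<otimes>) x) U"
  have xU: "set ?U \<subseteq> carrier A" "successively (step S) ?U" "separated K ?U"
    using x Uc successively_step_translate[OF x S_carrier Uc UstepS] separated_translate[OF x Uc U'(5)]
    by auto
  have cover: "g \<in> carrier A \<and> inv x \<otimes> g \<in> G \<longleftrightarrow> g \<in> carrier A \<and> (\<exists>v\<in>set ?U. inv v \<otimes> g \<in> K)" for g
  proof -
    have shift: "inv (x \<otimes> u) \<otimes> g = inv u \<otimes> (inv x \<otimes> g)" if "u \<in> set U" "g \<in> carrier A" for u
      using that x Uc by (simp add: inv_mult_group m_assoc subset_iff)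
    have "inv x \<otimes> g \<in> G" if g: "g \<in> carrier A" and u: "u \<in> set U" "inv (x \<otimes> u) \<otimes> g \<in> K" for u
    proof -
      have "u \<in> G" "inv u \<otimes> (inv x \<otimes> g) \<in> G" using u shift[OF u(1) g] KG U'(3) by auto
      then have "u \<otimes> (inv u \<otimes> (inv x \<otimes> g)) \<in> G" by (rule G_mult)
      then show ?thesis using u g x Uc by (simp add: subset_iff)
    qed
    then show ?thesis using U'(6)[of "inv x \<otimes> g"] shift by auto
  qed
  have ends: "inv x \<otimes> z \<in> G - H" if "u \<in> G" "u \<notin> H" "z \<in> carrier A" "inv (x \<otimes> u) \<otimes> z \<in> K" for u z
  proof -
    have uc: "u \<in> carrier A" using that G_carrier by blast
    have "inv u \<otimes> (inv x \<otimes> z) \<in> H"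
      using that K(3) x uc by (auto simp: inv_mult_group m_assoc)
    then have *: "inv u \<otimes> (inv x \<otimes> z) \<in> G" "inv u \<otimes> (inv x \<otimes> z) \<in> H" using H_sub by auto
    have "u \<otimes> (inv u \<otimes> (inv x \<otimes> z)) \<in> G - H"
      using * that by (auto simp: mult_H_iff G_mult)
    then show ?thesis using uc x that by simp
  qed
  show ?thesis
  proof (cases "inv x \<otimes> y \<in> K")
    \<comment> \<open>The coset of \<open>y\<close> lies in \<open>x H\<close> and is entered by a
      step from \<open>S - H\<close>, so the coset before it lies outside \<open>x H\<close>; there
      the first path ends.\<close>
    case False
    obtain w where w: "w \<in> set U" "inv w \<otimes> (inv x \<otimes> y) \<in> K" using U'(6) xy H_sub by blast
    obtain U1 U2 where U12: "U = U1 @ w # U2" using split_list[OF w(1)] by blast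
    have wc: "w \<in> carrier A" using w Uc by blast
    have wH: "w \<in> H"
    proof -
      have wG: "w \<in> G" using w U'(3) by blast
      have "inv x \<otimes> y \<in> G" using xy H_sub by blast
      then have "inv w \<otimes> (inv x \<otimes> y) \<in> H \<longleftrightarrow> w \<in> H" using wG xy by (simp add: mult_H_iff G_inv inv_H_iff)
      then show ?thesis using w K(3) by blast
    qed
    have "U1 \<noteq> []"
    proof
      assume "U1 = []"
      then have "w = \<one>" using U'(2) U12 by simp
      then show False using w(2) False x y by simp
    qed
    then obtain u V where U1: "U1 = u # V" by (cases U1) auto
    have u: "u = \<one>" using U'(2) U12 U1 by simp
    have lastU1: "last U1 \<in> G" "last U1 \<notin> H"
    proof -
      show lG: "last U1 \<in> G" using U'(3) U12 \<open>U1 \<noteq> []\<close> by auto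
      have "step (S - H) (last U1) w" using U'(4) U12 \<open>U1 \<noteq> []\<close> by (auto simp: successively_append_iff)
      then obtain s where "s \<in> S - H" "w = last U1 \<otimes> s" by (auto simp: step_def)
      then show "last U1 \<notin> H" using wH lG S_sub by (auto simp: mult_H_iff)
    qed
    have map1: "map ((\<otimes>) x) U1 = x # map ((\<otimes>) x) V" using U1 u x by simp
    have split: "?U = (x # map ((\<otimes>) x) V) @ ((x \<otimes> w) # map ((\<otimes>) x) U2)"
      using U12 map1 by simp
    have sub: "set (x # map ((\<otimes>) x) V) \<subseteq> carrier A" "successively (step S) (x # map ((\<otimes>) x) V)"
        "separated K (x # map ((\<otimes>) x) V)"
        "set ((x \<otimes> w) # map ((\<otimes>) x) U2) \<subseteq> carrier A" "successively (step S) ((x \<otimes> w) # map ((\<otimes>) x) U2)"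
        "separated K ((x \<otimes> w) # map ((\<otimes>) x) U2)"
      using xU separated_append unfolding split successively_append_iff set_append by blast+
    have "inv x \<otimes> x \<in> K" using x subgroup.one_closed[OF K(1)] by simp
    from lift_coset_path[OF K(1) KG W sub(1-3) x this]
    obtain P where P: "P \<noteq> []" "hd P = x" "successively (step S) P" "distinct P"
      "set P = {g \<in> carrier A. \<exists>v\<in>set (x # map ((\<otimes>) x) V). inv v \<otimes> g \<in> K}"
      "inv (last (x # map ((\<otimes>) x) V)) \<otimes> last P \<in> K" by blast
    have "inv (x \<otimes> w) \<otimes> y \<in> K" using w(2) x y wc by (simp add: inv_mult_group m_assoc)
    from lift_coset_path[OF K(1) KG W sub(4-6) y this]
    obtain Q where Q: "Q \<noteq> []" "hd Q = y" "successively (step S) Q" "distinct Q"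
      "set Q = {g \<in> carrier A. \<exists>v\<in>set ((x \<otimes> w) # map ((\<otimes>) x) U2). inv v \<otimes> g \<in> K}"
      "inv (last ((x \<otimes> w) # map ((\<otimes>) x) U2)) \<otimes> last Q \<in> K" by blast
    have "last (x # map ((\<otimes>) x) V) = x \<otimes> last U1"
      unfolding map1[symmetric] using \<open>U1 \<noteq> []\<close> by (simp add: last_map)
    then have "inv x \<otimes> last P \<in> G - H" using ends[OF lastU1, of "last P"] P last_in_set[OF P(1)] by auto
    moreover have "last ((x \<otimes> w) # map ((\<otimes>) x) U2) = x \<otimes> last U"
      using U12 by (cases "U2 = []") (auto simp: last_map)
    then have "inv x \<otimes> last Q \<in> G - H" using ends[OF lastU, of "last Q"] Q last_in_set[OF Q(1)] by auto
    moreover have "set (P @ Q) = {g \<in> carrier A. inv x \<otimes> g \<in> G}"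
      unfolding set_append P(5) Q(5) using cover unfolding split set_append by blast
    moreover have "set P \<inter> set Q = {}"
    proof -
      have False if g: "g \<in> carrier A" and v: "v \<in> set (x # map ((\<otimes>) x) V)" "inv v \<otimes> g \<in> K"
        and v': "v' \<in> set ((x \<otimes> w) # map ((\<otimes>) x) U2)" "inv v' \<otimes> g \<in> K" for g v v'
      proof -
        have c: "v \<in> carrier A" "v' \<in> carrier A" using v v' sub by blast+
        have "inv v \<otimes> v' = (inv v \<otimes> g) \<otimes> inv (inv v' \<otimes> g)"
          using g c by (simp add: inv_mult_group m_assoc)
        then have "inv v \<otimes> v' \<in> K" using v v' K by (simp add: subgroup.m_closed subgroup.m_inv_closed)
        then have "v = v'" using xU(3) v(1) v'(1) unfolding split separated_def set_append by blast
        then show False using xU(3) v(1) v'(1) unfolding split separated_def distinct_append by blast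
      qed
      then show ?thesis unfolding P(5) Q(5) by blast
    qed
    ultimately show ?thesis using P Q by (intro exI[of _ P] exI[of _ Q]) simp
  next
    \<comment> \<open>Both pieces of the first coset end inside \<open>x H\<close>. So both cross by
      the same \<open>s\<close> into the second coset, which lies outside \<open>x H\<close>, and
      divide it again; \<open>P\<close> stops there and \<open>Q\<close> goes on.\<close>
    case True
    obtain U0 where U0: "U = \<one> # U0" using U'(1,2) by (cases U) auto
    \<comment> \<open>A path consisting of 1 alone would end in \<open>H\<close>.\<close>
    have "U0 \<noteq> []" using lastU U0 subgroup.one_closed[OF H_subgroup] by auto
    then obtain v V where UV: "U = \<one> # v # V" using U0 by (cases U0) auto
    obtain s where s: "s \<in> S - H" "v = s" using U'(4) UV S_carrier by (auto simp: step_def)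
    have sc: "s \<in> carrier A" and sG: "s \<in> G" using s S_carrier S_sub by auto
    let ?v = "x \<otimes> s" and ?V = "map ((\<otimes>) x) V"
    have Ueq: "?U = x # ?v # ?V" using UV s(2) x by simp
    have vc: "?v \<in> carrier A" using x sc by simp
    obtain P0 Q0 where PQ0: "P0 \<noteq> []" "Q0 \<noteq> []" "hd P0 = x" "hd Q0 = y" "successively (step S) P0"
        "successively (step S) Q0" "distinct (P0 @ Q0)" "set (P0 @ Q0) = {g \<in> carrier A. inv x \<otimes> g \<in> K}"
      using split_block[OF K(1) KG W x y True xy(2)] by blast
    have l0: "last P0 \<in> carrier A" "inv x \<otimes> last P0 \<in> K" "last Q0 \<in> carrier A" "inv x \<otimes> last Q0 \<in> K"
      using PQ0(8) last_in_set[OF PQ0(1)] last_in_set[OF PQ0(2)] by auto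
    have ne0: "last P0 \<noteq> last Q0" using PQ0(7) last_in_set[OF PQ0(1)] last_in_set[OF PQ0(2)] by auto
    let ?p = "last P0 \<otimes> s" and ?q = "last Q0 \<otimes> s"
    have pqc: "?p \<in> carrier A" "?q \<in> carrier A" "?p \<noteq> ?q" using l0 sc ne0 by auto
    have pK: "inv ?v \<otimes> ?p \<in> K" "inv ?v \<otimes> ?q \<in> K"
      using step_coset[OF K(1) KG x l0(1,2)] step_coset[OF K(1) KG x l0(3,4)] s by auto
    have "inv ?p \<otimes> ?q = inv (inv ?v \<otimes> ?p) \<otimes> (inv ?v \<otimes> ?q)"
      using pqc vc by (simp add: inv_mult_group[of "inv ?v" ?p] m_assoc)
    then have "inv ?p \<otimes> ?q \<in> K" using pK K by (simp add: subgroup.m_closed subgroup.m_inv_closed)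
    then obtain P1 Q1 where PQ1: "P1 \<noteq> []" "Q1 \<noteq> []" "hd P1 = ?p" "hd Q1 = ?q" "successively (step S) P1"
        "successively (step S) Q1" "distinct (P1 @ Q1)" "set (P1 @ Q1) = {g \<in> carrier A. inv ?p \<otimes> g \<in> K}"
      using split_block[OF K(1) KG W pqc(1,2) _ pqc(3)] by blast
    have set1: "set (P1 @ Q1) = {g \<in> carrier A. inv ?v \<otimes> g \<in> K}"
      using coset_image[OF K(1) vc pqc(1) pK(1)] coset_image[OF K(1) pqc(1,1)] pqc
        subgroup.one_closed[OF K(1)] PQ1(8) by simp
    have l1: "last P1 \<in> carrier A" "inv ?v \<otimes> last P1 \<in> K" "last Q1 \<in> carrier A" "inv ?v \<otimes> last Q1 \<in> K"
      using set1 last_in_set[OF PQ1(1)] last_in_set[OF PQ1(2)] by auto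
    have sub: "set (?v # ?V) \<subseteq> carrier A" "successively (step S) (?v # ?V)" "separated K (?v # ?V)"
      using xU separated_Cons unfolding Ueq by auto
    obtain R where R: "successively (step S) (last Q1 # R)" "distinct R"
        "set R = {g \<in> carrier A. \<exists>v\<in>set ?V. inv v \<otimes> g \<in> K}" "inv (last (?v # ?V)) \<otimes> last (last Q1 # R) \<in> K"
      using lift_coset_path_continue[OF K(1) KG W sub l1(3,4)] by blast
    let ?P = "P0 @ P1" and ?Q = "Q0 @ Q1 @ R"
    have "successively (step S) ?P"
      using PQ0 PQ1 s by (auto simp: successively_append_iff step_def)
    moreover have "successively (step S) ?Q"
      using PQ0 PQ1 s R(1) by (auto simp: successively_append_iff successively_Cons step_def)
    moreover have "set (?P @ ?Q) = {g \<in> carrier A. inv x \<otimes> g \<in> G}"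
      using cover PQ0(8) set1 R(3) unfolding Ueq by auto
    moreover have "distinct (?P @ ?Q)"
    proof -
      have disj: False if g: "g \<in> carrier A" and u: "u \<in> set ?U" "inv u \<otimes> g \<in> K"
        and u': "u' \<in> set ?U" "inv u' \<otimes> g \<in> K" and ne: "u \<noteq> u'" for g u u'
      proof -
        have c: "u \<in> carrier A" "u' \<in> carrier A" using u u' xU by blast+
        have "inv u \<otimes> u' = (inv u \<otimes> g) \<otimes> inv (inv u' \<otimes> g)"
          using g c by (simp add: inv_mult_group m_assoc)
        then have "inv u \<otimes> u' \<in> K" using u u' K by (simp add: subgroup.m_closed subgroup.m_inv_closed)
        then show False using xU(3) u(1) u'(1) ne unfolding separated_def by blast
      qed
      have dU: "x \<noteq> ?v" "x \<notin> set ?V" "?v \<notin> set ?V"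
        using xU(3) unfolding Ueq separated_def by auto
      have "set (P0 @ Q0) \<inter> set (P1 @ Q1) = {}"
        unfolding PQ0(8) set1 using disj[of _ x ?v] dU unfolding Ueq by auto
      moreover have "set (P0 @ Q0) \<inter> set R = {}"
        unfolding PQ0(8) R(3) using disj[of _ x] dU unfolding Ueq by auto
      moreover have "set (P1 @ Q1) \<inter> set R = {}"
        unfolding set1 R(3) using disj[of _ ?v] dU unfolding Ueq by auto
      ultimately show ?thesis using PQ0(7) PQ1(7) R(2) by auto
    qed
    moreover have "inv x \<otimes> last ?P \<in> G - H"
      using ends[of s "last P1"] s sG l1 PQ1(1) by simp
    moreover have "inv x \<otimes> last ?Q \<in> G - H"
    proof -
      have "last (?v # ?V) = x \<otimes> last U"
        using UV s(2) by (cases "V = []") (auto simp: last_map)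
      moreover have "last ?Q = last (last Q1 # R)" using PQ1(2) by simp
      moreover have "set R \<subseteq> carrier A" using R(3) by auto
      then have "last (last Q1 # R) \<in> carrier A" using l1(3) by (cases "R = []") auto
      ultimately show ?thesis using ends[OF lastU, of "last ?Q"] R(4) by simp
    qed
    ultimately show ?thesis using PQ0 by (intro exI[of _ ?P] exI[of _ ?Q]) simp
  qed
qed

text \<open>Without such an edge, the vertices of \<open>P\<close> would be closed under right
  multiplication by \<open>S\<close>, hence by all of \<open>G\<close>, and would include
  \<open>hd Q\<close>.\<close>

lemma cross_edge:
  assumes x: "x \<in> carrier A" and P: "P \<noteq> []" "hd P = x" and Q: "Q \<noteq> []" and disj: "distinct (P @ Q)"
    and cover: "set (P @ Q) = {g \<in> carrier A. inv x \<otimes> g \<in> G}"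
  shows "\<exists>p\<in>set P. \<exists>q\<in>set Q. step S p q"
proof (rule ccontr)
  assume no: "\<not> ?thesis"
  have Pc: "set P \<subseteq> carrier A" using cover by auto
  have "p \<otimes> s \<in> set P" if p: "p \<in> set P" and s: "s \<in> S" for p s
  proof -
    have sc: "s \<in> carrier A" and sG: "s \<in> G" using s S_carrier S_sub by auto
    have pc: "p \<in> carrier A" "inv x \<otimes> p \<in> G" using p cover by auto
    have "inv x \<otimes> (p \<otimes> s) = (inv x \<otimes> p) \<otimes> s" using x pc sc by (simp add: m_assoc)
    then have "p \<otimes> s \<in> set (P @ Q)" unfolding cover using pc sc sG G_mult by simp
    moreover have "p \<otimes> s \<notin> set Q" using no p s unfolding step_def by blast
    ultimately show ?thesis by simp
  qed
  from finite_right_closed[OF Pc _ S_carrier this]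
  have closed: "p \<otimes> g \<in> set P" if "g \<in> G" "p \<in> set P" for p g
    using that S_generates by auto
  have q: "hd Q \<in> set Q" using Q by simp
  then have q': "hd Q \<in> carrier A" "inv x \<otimes> hd Q \<in> G" using cover by auto
  have "x \<in> set P" using P by auto
  then have "x \<otimes> (inv x \<otimes> hd Q) \<in> set P" using closed q' by blast
  then show False using q q' x disj by auto
qed

end

section \<open>Double rays in the Cayley graph\<close>

context dihedral_extension
begin

text \<open>The length clauses ensure that entry \<open>n\<close> exists at stage \<open>n\<close>,
  so that the limiting rays can be read off along the diagonal.\<close>

definition sweep :: "'a \<Rightarrow> nat \<Rightarrow> 'a list \<Rightarrow> 'a list \<Rightarrow> bool" where
  "sweep h n P Q \<longleftrightarrow> n < length P \<and> n < length Q \<and> hd P = \<one> \<and> hd Q = h \<and>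
     successively (step (insert b S)) P \<and> successively (step (insert b S)) Q \<and> distinct (P @ Q) \<and>
     set (P @ Q) = {g \<in> carrier A. 0 \<le> level g \<and> level g \<le> 2 * int n + 1} \<and>
     level (last P) = 2 * int n + 1 \<and> level (last Q) = 2 * int n + 1"

text \<open>The linking edge is required between the newly added parts, so that repeated extension
  yields such edges arbitrarily far out.\<close>

definition linked_extension :: "'a list \<times> 'a list \<Rightarrow> 'a list \<times> 'a list \<Rightarrow> bool" where
  "linked_extension PQ PQ' \<longleftrightarrow> (\<exists>P Q. fst PQ' = fst PQ @ P \<and> snd PQ' = snd PQ @ Q \<and>
     (\<exists>p\<in>set P. \<exists>q\<in>set Q. step S p q))"

lemma slab_cover:
  assumes x: "x \<in> carrier A" and y: "y \<in> carrier A" and xy: "x \<noteq> y" "level y = level x" "even (level x)"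
  shows "\<exists>P Q. P \<noteq> [] \<and> Q \<noteq> [] \<and> hd P = x \<and> hd Q = y \<and> successively (step (insert b S)) P \<and>
    successively (step (insert b S)) Q \<and> distinct (P @ Q) \<and>
    set (P @ Q) = {g \<in> carrier A. level g = level x \<or> level g = level x + 1} \<and>
    level (last P) = level x + 1 \<and> level (last Q) = level x + 1 \<and>
    (\<exists>p\<in>set P. \<exists>q\<in>set Q. step S p q)"
proof -
  have "inv x \<otimes> y \<in> H" using level_eq_imp_H x y xy by simp
  from two_path_cover[OF x y this xy(1)]
  obtain P Q where PQ: "P \<noteq> []" "Q \<noteq> []" "hd P = x" "hd Q = y" "successively (step S) P"
    "successively (step S) Q" "distinct (P @ Q)" "set (P @ Q) = {g \<in> carrier A. inv x \<otimes> g \<in> G}"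
    "inv x \<otimes> last P \<in> G - H" "inv x \<otimes> last Q \<in> G - H" by blast
  have "\<exists>p\<in>set P. \<exists>q\<in>set Q. step S p q" using cross_edge[OF x PQ(1,3,2,7,8)] .
  moreover have "set (P @ Q) = {g \<in> carrier A. level g = level x \<or> level g = level x + 1}"
    unfolding PQ(8) using slab_iff[OF x xy(3)] by blast
  moreover have "level z = level x + 1" if "z \<in> carrier A" "inv x \<otimes> z \<in> G - H" for z
    using that slab_iff[OF x xy(3)] level_eq_iff[OF x] by auto
  moreover have "last P \<in> carrier A" "last Q \<in> carrier A"
    using PQ(8) last_in_set[OF PQ(1)] last_in_set[OF PQ(2)] by auto
  moreover have "successively (step (insert b S)) P" "successively (step (insert b S)) Q"
    using PQ successively_step_mono by blast+
  ultimately show ?thesis using PQ by (intro exI[of _ P] exI[of _ Q]) simp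
qed

lemma sweep_start:
  assumes "h \<in> H" "h \<noteq> \<one>"
  shows "\<exists>P Q. sweep h 0 P Q"
proof -
  have "h \<in> carrier A" "level h = level \<one>" "even (level \<one>)" using assms H_carrier level_H level_one by auto
  from slab_cover[OF one_closed this(1) assms(2)[symmetric] this(2,3)]
  obtain P Q where "P \<noteq> []" "Q \<noteq> []" "hd P = \<one>" "hd Q = h" "successively (step (insert b S)) P"
    "successively (step (insert b S)) Q" "distinct (P @ Q)"
    "set (P @ Q) = {g \<in> carrier A. level g = level \<one> \<or> level g = level \<one> + 1}"
    "level (last P) = level \<one> + 1" "level (last Q) = level \<one> + 1" by blast
  moreover have "{g \<in> carrier A. level g = level \<one> \<or> level g = level \<one> + 1} =
      {g \<in> carrier A. 0 \<le> level g \<and> level g \<le> 2 * int 0 + 1}"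
    by (auto simp: level_one)
  ultimately show ?thesis unfolding sweep_def by (intro exI[of _ P] exI[of _ Q]) (simp add: level_one)
qed

lemma sweep_extend:
  assumes PQ: "sweep h n P Q"
  shows "\<exists>P' Q'. sweep h (Suc n) P' Q' \<and> linked_extension (P, Q) (P', Q')"
proof -
  have ne: "P \<noteq> []" "Q \<noteq> []" using PQ by (auto simp: sweep_def)
  have setPQ: "set (P @ Q) = {g \<in> carrier A. 0 \<le> level g \<and> level g \<le> 2 * int n + 1}"
    using PQ by (simp add: sweep_def)
  have l: "last P \<in> carrier A" "last Q \<in> carrier A" "level (last P) = 2 * int n + 1" "level (last Q) = 2 * int n + 1"
    using setPQ last_in_set[OF ne(1)] last_in_set[OF ne(2)] PQ by (auto simp: sweep_def)
  \<comment> \<open>At an odd level multiplication by \<open>b\<close> subtracts -1, so both paths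
    move up to the even level \<open>2 n + 2\<close>, the bottom of the next coset of
    \<open>G\<close>.\<close>
  let ?p = "last P \<otimes> b" and ?q = "last Q \<otimes> b"
  have pq: "?p \<in> carrier A" "?q \<in> carrier A" "level ?p = 2 * int n + 2" "level ?q = 2 * int n + 2"
    using l b_carrier by (simp_all add: level_mult level_b)
  have "distinct (P @ Q)" using PQ by (simp add: sweep_def)
  then have "last P \<noteq> last Q" using last_in_set[OF ne(1)] last_in_set[OF ne(2)] by auto
  then have "?p \<noteq> ?q" using l b_carrier by simp
  with slab_cover[OF pq(1,2)] pq(3,4) obtain P' Q' where PQ': "P' \<noteq> []" "Q' \<noteq> []" "hd P' = ?p" "hd Q' = ?q"
    "successively (step (insert b S)) P'" "successively (step (insert b S)) Q'" "distinct (P' @ Q')"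
    "set (P' @ Q') = {g \<in> carrier A. level g = level ?p \<or> level g = level ?p + 1}"
    "level (last P') = level ?p + 1" "level (last Q') = level ?p + 1"
    "\<exists>p\<in>set P'. \<exists>q\<in>set Q'. step S p q" by auto
  have "{g \<in> carrier A. level g = level ?p \<or> level g = level ?p + 1} \<union>
      {g \<in> carrier A. 0 \<le> level g \<and> level g \<le> 2 * int n + 1} =
      {g \<in> carrier A. 0 \<le> level g \<and> level g \<le> 2 * int (Suc n) + 1}"
    unfolding pq(3) by auto
  moreover have "set ((P @ P') @ (Q @ Q')) = set (P' @ Q') \<union> set (P @ Q)" by auto
  ultimately have "set ((P @ P') @ (Q @ Q')) = {g \<in> carrier A. 0 \<le> level g \<and> level g \<le> 2 * int (Suc n) + 1}"
    unfolding PQ'(8) setPQ by (simp only:)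
  moreover have "set (P @ Q) \<inter> set (P' @ Q') = {}"
    unfolding setPQ PQ'(8) pq(3) by auto
  then have "distinct ((P @ P') @ (Q @ Q'))" using PQ PQ'(7) by (auto simp: sweep_def)
  moreover have "Suc n < length (P @ P')" "Suc n < length (Q @ Q')"
  proof -
    have "n < length P" "n < length Q" using PQ by (simp_all add: sweep_def)
    moreover have "0 < length P'" "0 < length Q'" using PQ'(1,2) by simp_all
    ultimately show "Suc n < length (P @ P')" "Suc n < length (Q @ Q')" unfolding length_append by linarith+
  qed
  moreover have "successively (step (insert b S)) (P @ P')" "successively (step (insert b S)) (Q @ Q')"
    using PQ PQ'(3-6) by (auto simp: sweep_def successively_append_iff step_def)
  ultimately have "sweep h (Suc n) (P @ P') (Q @ Q')"
    using PQ PQ'(1,2,9,10) ne pq(3) by (simp add: sweep_def)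
  moreover have "linked_extension (P, Q) (P @ P', Q @ Q')"
    using PQ'(11) by (auto simp: linked_extension_def)
  ultimately show ?thesis by blast
qed

text \<open>Each stage extends the previous one, so entry \<open>n\<close> is final from stage
  \<open>n\<close> on, and the stages have two rays as their limit.\<close>

lemma sweeping_rays:
  assumes h: "h \<in> H" "h \<noteq> \<one>"
  shows "\<exists>\<rho>. \<rho> True 0 = \<one> \<and> \<rho> False 0 = h \<and>
    (\<forall>c n. step (insert b S) (\<rho> c n) (\<rho> c (Suc n))) \<and>
    (\<forall>c m d n. \<rho> c m = \<rho> d n \<longrightarrow> c = d \<and> m = n) \<and>
    (\<forall>c n. \<rho> c n \<in> carrier A \<and> 0 \<le> level (\<rho> c n)) \<and>
    (\<forall>g\<in>carrier A. 0 \<le> level g \<longrightarrow> (\<exists>c n. g = \<rho> c n)) \<and>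
    (\<forall>N. \<exists>i\<ge>N. \<exists>j\<ge>N. step S (\<rho> True i) (\<rho> False j))"
proof -
  have "\<exists>f. \<forall>n. sweep h n (fst (f n)) (snd (f n)) \<and> linked_extension (f n) (f (Suc n))"
  proof (rule dependent_nat_choice)
    show "\<exists>PQ. sweep h 0 (fst PQ) (snd PQ)" using sweep_start[OF h] by simp
    show "\<exists>PQ'. sweep h (Suc n) (fst PQ') (snd PQ') \<and> linked_extension PQ PQ'"
      if "sweep h n (fst PQ) (snd PQ)" for PQ n
      using sweep_extend[OF that] by simp
  qed
  then obtain f where sw: "\<And>n. sweep h n (fst (f n)) (snd (f n))" and ext: "\<And>n. linked_extension (f n) (f (Suc n))"
    by blast
  define L where "L c n = (if c then fst (f n) else snd (f n))" for c n
  define \<rho> where "\<rho> c n = L c n ! n" for c n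
  have len: "n < length (L c n)" for c n using sw[of n] by (simp add: L_def sweep_def)
  have mono: "\<exists>B. L c n = L c m @ B" if "m \<le> n" for c m n
    using that
  proof (induction n rule: dec_induct)
    case (step n)
    then show ?case using ext[of n] by (auto simp: linked_extension_def L_def split: if_splits)
  qed simp
  have nth: "L c n ! k = \<rho> c k" if k: "k < length (L c n)" for c n k
  proof (cases "k \<le> n")
    case True
    then obtain B where "L c n = L c k @ B" using mono by blast
    then show ?thesis using len by (simp add: \<rho>_def nth_append)
  next
    case False
    then obtain B where "L c k = L c n @ B" using mono[of n k c] by auto
    then show ?thesis using k by (simp add: \<rho>_def nth_append)
  qed
  have setL: "set (L True n) \<union> set (L False n) = {g \<in> carrier A. 0 \<le> level g \<and> level g \<le> 2 * int n + 1}" for n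
    using sw[of n] by (simp add: L_def sweep_def)
  have dist: "distinct (L True n @ L False n)" for n using sw[of n] by (simp add: L_def sweep_def)
  have stepL: "successively (step (insert b S)) (L c n)" for c n using sw[of n] by (simp add: L_def sweep_def)
  have mem: "\<rho> c m \<in> set (L c n)" if "m \<le> n" for c m n
  proof -
    have "m < length (L c n)" using that len[of n c] by simp
    then show ?thesis using nth by (metis nth_mem)
  qed
  have start: "\<rho> True 0 = \<one>" "\<rho> False 0 = h"
    using sw[of 0] by (auto simp: \<rho>_def L_def sweep_def hd_conv_nth)
  moreover have "step (insert b S) (\<rho> c n) (\<rho> c (Suc n))" for c n
  proof -
    have "successively (step (insert b S)) (take n (L c (Suc n)) @ L c (Suc n) ! n # L c (Suc n) ! Suc n #
        drop (Suc (Suc n)) (L c (Suc n)))"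
      using stepL[of c "Suc n"] len[of "Suc n" c] by (simp add: Cons_nth_drop_Suc)
    then have "step (insert b S) (L c (Suc n) ! n) (L c (Suc n) ! Suc n)"
      by (simp add: successively_append_iff)
    then show ?thesis using nth[of n c "Suc n"] nth[of "Suc n" c "Suc n"] len[of "Suc n" c] by simp
  qed
  moreover have "c = d \<and> m = n" if eq: "\<rho> c m = \<rho> d n" for c m d n
  proof -
    let ?k = "max m n"
    have m: "\<rho> c m \<in> set (L c ?k)" "\<rho> d n \<in> set (L d ?k)" by (rule mem, simp)+
    have "c = d"
      using m eq dist[of ?k] by (cases c; cases d) auto
    moreover have "distinct (L c ?k)" using dist[of ?k] by (cases c) auto
    moreover have "m < length (L c ?k)" "n < length (L c ?k)" using len[of ?k c] by auto
    moreover from calculation have "L c ?k ! m = L c ?k ! n" using nth[of m c ?k] nth[of n c ?k] eq by simp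
    ultimately show ?thesis using nth_eq_iff_index_eq[of "L c ?k" m n] by blast
  qed
  moreover have "\<rho> c n \<in> carrier A \<and> 0 \<le> level (\<rho> c n)" for c n
    using mem[of n n c] setL[of n] by (cases c) auto
  moreover have "\<exists>c n. g = \<rho> c n" if g: "g \<in> carrier A" "0 \<le> level g" for g
  proof -
    \<comment> \<open>Stage \<open>n\<close> covers all levels up to \<open>2 n + 1\<close>, in
      particular level \<open>n\<close>.\<close>
    have "g \<in> set (L True (nat (level g))) \<union> set (L False (nat (level g)))" unfolding setL using g by simp
    then obtain c where "g \<in> set (L c (nat (level g)))" by auto
    then obtain k where "k < length (L c (nat (level g)))" "g = L c (nat (level g)) ! k"
      by (metis in_set_conv_nth)
    then have "g = \<rho> c k" using nth by simp
    then show ?thesis by blast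
  qed
  moreover have "\<exists>i\<ge>N. \<exists>j\<ge>N. step S (\<rho> True i) (\<rho> False j)" for N
  proof -
    obtain P Q p q where PQ: "L True (Suc N) = L True N @ P" "L False (Suc N) = L False N @ Q"
        "p \<in> set P" "q \<in> set Q" "step S p q"
      using ext[of N] by (auto simp: linked_extension_def L_def)
    obtain i where i: "i < length P" "p = P ! i" using PQ(3) by (metis in_set_conv_nth)
    obtain j where j: "j < length Q" "q = Q ! j" using PQ(4) by (metis in_set_conv_nth)
    have "p = \<rho> True (length (L True N) + i)"
      using nth[of "length (L True N) + i" True "Suc N"] i PQ(1) by simp
    moreover have "q = \<rho> False (length (L False N) + j)"
      using nth[of "length (L False N) + j" False "Suc N"] j PQ(2) by simp
    ultimately show ?thesis using PQ(5) len[of N True] len[of N False]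
      by (intro exI[of _ "length (L True N) + i"] conjI exI[of _ "length (L False N) + j"]) auto
  qed
  ultimately show ?thesis by blast
qed

theorem hamilton_circle_cayley:
  assumes T: "T \<subseteq> carrier A" "finite T" "insert b S \<subseteq> T"
    and level_T: "\<And>t. t \<in> T \<Longrightarrow> \<bar>level t\<bar> \<le> 1"
  shows "\<exists>C. hamilton_circle (cayley_graph A T) C"
proof -
  let ?\<Gamma> = "cayley_graph A T"
  obtain h where h: "h \<in> H" "h \<noteq> \<one>"
    using H_nontrivial subgroup.one_closed[OF H_subgroup] by blast
  have hc: "h \<in> carrier A" using h H_carrier by blast
  \<comment> \<open>The second sweep starts at 1 and \<open>k\<close>. After the move by
    \<open>b\<close> these become \<open>b\<close> and \<open>b k = h b\<close>, which are reached
    from 1 and \<open>h\<close> by the generator \<open>b\<close>.\<close>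
  define k where "k = inv b \<otimes> h \<otimes> b"
  have kH: "k \<in> H" unfolding k_def using b_conj h by blast
  have bk: "b \<otimes> k = h \<otimes> b" unfolding k_def using hc b_carrier by (simp add: m_assoc)
  have "k \<noteq> \<one>"
  proof
    assume "k = \<one>"
    then have "h \<otimes> b = b" using bk b_carrier by simp
    then show False using h hc b_carrier by simp
  qed
  from sweeping_rays[OF h] obtain \<rho> where \<rho>: "\<rho> True 0 = \<one>" "\<rho> False 0 = h"
    "\<And>c n. step (insert b S) (\<rho> c n) (\<rho> c (Suc n))" "\<And>c m d n. \<rho> c m = \<rho> d n \<Longrightarrow> c = d \<and> m = n"
    "\<And>c n. \<rho> c n \<in> carrier A" "\<And>c n. 0 \<le> level (\<rho> c n)"
    "\<And>g. g \<in> carrier A \<Longrightarrow> 0 \<le> level g \<Longrightarrow> \<exists>c n. g = \<rho> c n"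
    "\<And>N. \<exists>i\<ge>N. \<exists>j\<ge>N. step S (\<rho> True i) (\<rho> False j)"
    by auto
  from sweeping_rays[OF kH \<open>k \<noteq> \<one>\<close>] obtain \<pi> where \<pi>: "\<pi> True 0 = \<one>" "\<pi> False 0 = k"
    "\<And>c n. step (insert b S) (\<pi> c n) (\<pi> c (Suc n))" "\<And>c m d n. \<pi> c m = \<pi> d n \<Longrightarrow> c = d \<and> m = n"
    "\<And>c n. \<pi> c n \<in> carrier A" "\<And>c n. 0 \<le> level (\<pi> c n)"
    "\<And>g. g \<in> carrier A \<Longrightarrow> 0 \<le> level g \<Longrightarrow> \<exists>c n. g = \<pi> c n"
    "\<And>N. \<exists>i\<ge>N. \<exists>j\<ge>N. step S (\<pi> True i) (\<pi> False j)"
    by auto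
  \<comment> \<open>Index -1 carries the moved start of the second sweep: the lower half is
    traversed backwards, and the seam lies between -1 and 0.\<close>
  define R where "R c n = (if 0 \<le> n then \<rho> c (nat n) else b \<otimes> \<pi> c (nat (- n - 1)))" for c and n :: int
  have flip: "level (b \<otimes> g) = - 1 - level g" if "g \<in> carrier A" for g
    using that b_carrier by (simp add: level_mult level_b)
  have R_nonneg: "R c (int n) = \<rho> c n" for c n by (simp add: R_def)
  have R_neg: "R c (- 1 - int n) = b \<otimes> \<pi> c n" for c n by (simp add: R_def)
  have R_carrier: "R c n \<in> carrier A" for c n using \<rho>(5) \<pi>(5) b_carrier by (simp add: R_def)
  have R_level: "0 \<le> level (R c n) \<longleftrightarrow> 0 \<le> n" for c n
  proof (cases "0 \<le> n")
    case False
    then have "level (R c n) = - 1 - level (\<pi> c (nat (- n - 1)))" using flip[OF \<pi>(5)] by (simp add: R_def)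
    then show ?thesis using False \<pi>(6)[of c "nat (- n - 1)"] by simp
  qed (use \<rho>(6) in \<open>simp add: R_def\<close>)
  have int_cases: "(\<exists>m. n = int m) \<or> (\<exists>m. n = - 1 - int m)" for n :: int
    by presburger
  have edgeI: "{x, y} \<in> edges ?\<Gamma>" if xy: "step T x y" "x \<in> carrier A" "x \<noteq> y" for x y
  proof -
    obtain s where s: "s \<in> T" "y = x \<otimes> s" using xy(1) by (auto simp: step_def)
    moreover have "s \<noteq> \<one>" using s xy(2,3) by auto
    ultimately show ?thesis using xy(2) by (auto simp: cayley_graph_def)
  qed
  have TI: "step (insert b S) x y \<Longrightarrow> step T x y" "step S x y \<Longrightarrow> step T x y" for x y
    using T(3) by (auto simp: step_def)
  have R_inject: "c = d \<and> m = n" if eq: "R c m = R d n" for c m d n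
  proof -
    have "0 \<le> m \<longleftrightarrow> 0 \<le> n" using R_level eq by metis
    then consider i j where "m = int i" "n = int j" | i j where "m = - 1 - int i" "n = - 1 - int j"
      using int_cases[of m] int_cases[of n] by fastforce
    then show ?thesis
    proof cases
      case 1
      then show ?thesis using eq \<rho>(4)[of c i d j] by (simp add: R_nonneg)
    next
      case 2
      then have "\<pi> c i = \<pi> d j" using eq \<pi>(5) b_carrier by (simp add: R_neg)
      then show ?thesis using \<pi>(4)[of c i d j] 2 by simp
    qed
  qed
  have R_ne: "R c n \<noteq> R c (n + 1)" for c n using R_inject[of c n c "n + 1"] by auto
  \<comment> \<open>Steps are directed: in the lower half and across the seam the generator leads
    from index \<open>n + 1\<close> to \<open>n\<close>.\<close>
  have R_step: "step T (R c n) (R c (n + 1)) \<or> step T (R c (n + 1)) (R c n)" for c n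
  proof -
    consider (pos) i where "n = int i" | (zero) "n = - 1" | (neg) i where "n = - 1 - int (Suc i)"
    proof -
      consider i where "n = int i" | i where "n = - 1 - int i" using int_cases[of n] by blast
      then show thesis
      proof cases
        case (2 i)
        then show thesis using that(2,3) by (cases i) auto
      qed (use that in blast)
    qed
    then show ?thesis
    proof cases
      case (pos i)
      have "R c (n + 1) = \<rho> c (Suc i)" using R_nonneg[of c "Suc i"] pos by (simp add: add.commute)
      then show ?thesis using TI(1)[OF \<rho>(3)[of c i]] pos by (simp add: R_nonneg)
    next
      case zero
      have "R c n = b \<otimes> \<pi> c 0" "R c (n + 1) = \<rho> c 0" using zero by (simp_all add: R_def)
      then have "R c n = R c (n + 1) \<otimes> b" using \<rho>(1,2) \<pi>(1,2) bk b_carrier by (cases c) auto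
      then show ?thesis using T(3) by (auto simp: step_def)
    next
      case (neg i)
      have "R c (n + 1) = b \<otimes> \<pi> c i" "R c n = b \<otimes> \<pi> c (Suc i)"
        using R_neg[of c i] R_neg[of c "Suc i"] neg by simp_all
      moreover have "step (insert b S) (b \<otimes> \<pi> c i) (b \<otimes> \<pi> c (Suc i))"
        using S_carrier b_carrier \<pi>(3,5) by (intro step_translate) auto
      ultimately show ?thesis using TI by simp
    qed
  qed
  interpret spanning_double_rays ?\<Gamma> R level
  proof unfold_locales
    fix e assume "e \<in> edges ?\<Gamma>"
    then obtain g s where gs: "e = {g, g \<otimes> s}" "g \<in> carrier A" "s \<in> T" "s \<noteq> \<one>"
      by (auto simp: cayley_graph_def)
    moreover have "s \<in> carrier A" using gs T by blast
    moreover from calculation have "g \<noteq> g \<otimes> s" by simp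
    ultimately show "\<exists>u\<in>verts ?\<Gamma>. \<exists>v\<in>verts ?\<Gamma>. u \<noteq> v \<and> e = {u, v}"
      by (intro bexI[of _ g] bexI[of _ "g \<otimes> s"]) (auto simp: cayley_graph_def)
  next
    fix v
    \<comment> \<open>The generator of an edge may be read from either end, so a neighbour of
      \<open>v\<close> is \<open>v s\<close> or \<open>v s^-1\<close>.\<close>
    have "{w. {v, w} \<in> edges ?\<Gamma>} \<subseteq> (\<lambda>s. v \<otimes> s) ` T \<union> (\<lambda>s. v \<otimes> inv s) ` T"
    proof
      fix w assume "w \<in> {w. {v, w} \<in> edges ?\<Gamma>}"
      then obtain g s where gs: "{v, w} = {g, g \<otimes> s}" "g \<in> carrier A" "s \<in> T"
        by (auto simp: cayley_graph_def)
      have sc: "s \<in> carrier A" using gs T by blast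
      have "w = v \<otimes> s \<or> w = v \<otimes> inv s"
        using gs sc by (auto simp: doubleton_eq_iff m_assoc)
      then show "w \<in> (\<lambda>s. v \<otimes> s) ` T \<union> (\<lambda>s. v \<otimes> inv s) ` T" using gs by blast
    qed
    then show "finite {w. {v, w} \<in> edges ?\<Gamma>}" using T(2) finite_subset by blast
  next
    fix c n
    show "{R c n, R c (n + 1)} \<in> edges ?\<Gamma>"
      using R_step[of c n] edgeI[of "R c n" "R c (n + 1)"] edgeI[of "R c (n + 1)" "R c n"] R_carrier R_ne[of c n]
      by (auto simp: insert_commute)
  next
    fix c m d n assume "R c m = R d n"
    then show "c = d \<and> m = n" by (rule R_inject)
  next
    fix v assume "v \<in> verts ?\<Gamma>"
    then have v: "v \<in> carrier A" by (simp add: cayley_graph_def)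
    show "\<exists>c n. v = R c n"
    proof (cases "0 \<le> level v")
      case True
      then show ?thesis using \<rho>(7)[OF v] R_nonneg by metis
    next
      case False
      let ?u = "inv b \<otimes> v"
      have u: "?u \<in> carrier A" "b \<otimes> ?u = v" using v b_carrier by simp_all
      then have "0 \<le> level ?u" using flip[OF u(1)] False by simp
      then show ?thesis using \<pi>(7)[OF u(1)] R_neg u(2) by metis
    qed
  next
    fix N :: int
    obtain i j where ij: "i \<ge> nat N" "j \<ge> nat N" "step S (\<rho> True i) (\<rho> False j)" using \<rho>(8) by blast
    have "\<rho> True i \<noteq> \<rho> False j" using \<rho>(4) by blast
    then have "{R True (int i), R False (int j)} \<in> edges ?\<Gamma>"
      using edgeI[OF TI(2)[OF ij(3)]] \<rho>(5) by (simp add: R_nonneg)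
    then show "\<exists>i\<ge>N. \<exists>j\<ge>N. {R True i, R False j} \<in> edges ?\<Gamma>"
      using ij by (intro exI[of _ "int i"] conjI exI[of _ "int j"]) auto
  next
    fix N :: int
    obtain i j where ij: "i \<ge> nat (- N)" "j \<ge> nat (- N)" "step S (\<pi> True i) (\<pi> False j)" using \<pi>(8) by blast
    have "step S (b \<otimes> \<pi> True i) (b \<otimes> \<pi> False j)"
      by (rule step_translate[OF b_carrier \<pi>(5) S_carrier ij(3)])
    moreover have "b \<otimes> \<pi> True i \<noteq> b \<otimes> \<pi> False j" using \<pi>(4,5) b_carrier by fastforce
    ultimately have "{R True (- 1 - int i), R False (- 1 - int j)} \<in> edges ?\<Gamma>"
      using edgeI[OF TI(2)] \<pi>(5) b_carrier by (simp add: R_neg)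
    then show "\<exists>i\<le>N. \<exists>j\<le>N. {R True i, R False j} \<in> edges ?\<Gamma>"
      using ij by (intro exI[of _ "- 1 - int i"] conjI exI[of _ "- 1 - int j"]) auto
  next
    fix u v assume "{u, v} \<in> edges ?\<Gamma>"
    then obtain g s where gs: "{u, v} = {g, g \<otimes> s}" "g \<in> carrier A" "s \<in> T"
      by (auto simp: cayley_graph_def)
    have "\<bar>level g - level (g \<otimes> s)\<bar> \<le> 1"
      using gs T level_T[OF gs(3)] by (auto simp: level_mult subset_iff)
    then show "\<bar>level u - level v\<bar> \<le> 1" using gs(1) by (auto simp: doubleton_eq_iff abs_minus_commute)
  next
    have "{v \<in> verts ?\<Gamma>. level v = 0} \<subseteq> H"
      using level_eq_imp_H[OF one_closed] level_one by (auto simp: cayley_graph_def)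
    then show fin: "finite {v \<in> verts ?\<Gamma>. level v = 0}"
      using H_sub finite_G by (meson finite_subset)
    \<comment> \<open>Only finitely many indices have level 0; beyond them, non-negative levels are
      positive.\<close>
    have "finite (R True -` {v \<in> verts ?\<Gamma>. level v = 0})"
      using fin R_inject by (intro finite_vimageI) (auto intro: injI)
    then obtain N where N: "\<forall>n\<in>R True -` {v \<in> verts ?\<Gamma>. level v = 0}. n \<le> N"
      using finite_imp_Sup_less bdd_above_finite unfolding bdd_above_def by blast
    have "0 < level (R True n)" if "n \<ge> max 0 (N + 1)" for n
    proof -
      have "level (R True n) \<noteq> 0" using N that R_carrier by (force simp: cayley_graph_def)
      moreover have "0 \<le> level (R True n)" using R_level that by simp
      ultimately show ?thesis by simp
    qed
    then show "\<exists>N. \<forall>n\<ge>N. 0 < level (R True n)" by blast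
    show "\<exists>N. \<forall>n\<le>N. level (R True n) < 0"
      by (intro exI[of _ "- 1"]) (use R_level in \<open>auto simp: not_le[symmetric]\<close>)
  qed
  show ?thesis using hamilton_circle_of_double_rays by blast
qed

end

section \<open>The amalgam along subgroups of index two\<close>

text \<open>Besides \<open>H\<close> there is only one right coset, and it contains both
  \<open>x\<close> and the inverse of \<open>y\<close>; so \<open>x = h y^-1\<close> for some
  \<open>h\<close> in \<open>H\<close>.\<close>

lemma (in group) index_two_mult:
  assumes H: "subgroup H G" and index: "card (rcosets H) = 2"
    and xy: "x \<in> carrier G" "x \<notin> H" "y \<in> carrier G" "y \<notin> H"
  shows "x \<otimes> y \<in> H"
proof -
  have Hc: "H \<subseteq> carrier G" using H by (rule subgroup.subset)
  have one: "H #> \<one> = H" using Hc by (rule coset_mult_one)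
  have iy: "inv y \<in> carrier G" "inv y \<notin> H" using xy subgroup.m_inv_closed[OF H, of "inv y"] by auto
  have ne: "H #> z \<noteq> H" if "z \<in> carrier G" "z \<notin> H" for z
    using that rcos_self[OF _ H] by blast
  have mem: "H #> z \<in> rcosets H" if "z \<in> carrier G" for z
    using that Hc by (rule rcosetsI[rotated])
  obtain C D where CD: "rcosets H = {C, D}" using index card_2_iff by metis
  have "H \<in> rcosets H" using mem[OF one_closed] one by simp
  then have "H #> x = H #> inv y"
    using mem[OF xy(1)] mem[OF iy(1)] ne[OF xy(1,2)] ne[OF iy] unfolding CD by auto
  then have "x \<in> H #> inv y" using rcos_self[OF xy(1) H] by simp
  then obtain h where h: "h \<in> H" "x = h \<otimes> inv y" by (auto simp: r_coset_def)
  then have "x \<otimes> y = h" using xy Hc by (simp add: m_assoc subset_iff)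
  with h show ?thesis by simp
qed

lemma (in group) index_two_mult_iff:
  assumes H: "subgroup H G" and index: "card (rcosets H) = 2" and xy: "x \<in> carrier G" "y \<in> carrier G"
  shows "x \<otimes> y \<in> H \<longleftrightarrow> (x \<in> H \<longleftrightarrow> y \<in> H)"
proof -
  have "y \<in> H" if "x \<in> H" "x \<otimes> y \<in> H"
  proof -
    have "inv x \<otimes> (x \<otimes> y) \<in> H" using that H by (simp add: subgroup.m_closed subgroup.m_inv_closed)
    then show ?thesis using xy by simp
  qed
  moreover have "x \<in> H" if "y \<in> H" "x \<otimes> y \<in> H"
  proof -
    have "(x \<otimes> y) \<otimes> inv y \<in> H" using that H by (simp add: subgroup.m_closed subgroup.m_inv_closed)
    then show ?thesis using xy by (simp add: m_assoc)
  qed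
  ultimately show ?thesis using index_two_mult[OF H index xy(1) _ xy(2)] subgroup.m_closed[OF H] by blast
qed

lemma (in group) subgroup_inv_iff:
  assumes H: "subgroup H G" and x: "x \<in> carrier G"
  shows "inv x \<in> H \<longleftrightarrow> x \<in> H"
  using subgroup.m_inv_closed[OF H] x inv_inv by metis

lemma (in group) index_two_proper:
  assumes H: "subgroup H G" and index: "card (rcosets H) = 2"
  shows "\<exists>a\<in>carrier G. a \<notin> H"
proof (rule ccontr)
  assume "\<not> ?thesis"
  then have "H = carrier G" using subgroup.subset[OF H] by blast
  then have "C = carrier G" if "C \<in> rcosets H" for C
    using that coset_join2[OF _ H] by (auto simp: RCOSETS_def)
  then have "rcosets H \<subseteq> {carrier G}" by blast
  then have "card (rcosets H) \<le> 1" using card_mono[of "{carrier G}" "rcosets H"] by simp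
  with index show False by simp
qed

lemma group_int_dihedral: "group int_dihedral"
proof (rule groupI)
  fix x :: int
  \<comment> \<open>Odd elements are reflections and hence their own inverses.\<close>
  show "\<exists>y\<in>carrier int_dihedral. y \<otimes>\<^bsub>int_dihedral\<^esub> x = \<one>\<^bsub>int_dihedral\<^esub>"
    by (rule bexI[of _ "if even x then - x else x"]) (auto simp: int_dihedral_def)
qed (auto simp: int_dihedral_def)

text \<open>Both groups act on the set \<open>carrier G\<close>, the second one by its regular action transported along
  \<open>\<theta>\<close>. As the action of \<open>G\<close> is faithful, \<open>G\<close> embeds into the amalgam.\<close>

lemma compatible_actions:
  assumes G: "group G" and G': "group G'"
    and \<theta>: "bij_betw \<theta> (carrier G) (carrier G')"
    and H: "H \<subseteq> carrier G"
    and equivariant: "\<And>h z. h \<in> H \<Longrightarrow> z \<in> carrier G \<Longrightarrow> \<theta> (h \<otimes>\<^bsub>G\<^esub> z) = \<phi> h \<otimes>\<^bsub>G'\<^esub> \<theta> z"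
  shows "\<exists>f g. f \<in> hom G (BijGroup (carrier G)) \<and> g \<in> hom G' (BijGroup (carrier G)) \<and>
    inj_on f (carrier G) \<and> (\<forall>h\<in>H. f h = g (\<phi> h))"
proof -
  interpret G: group G by (fact G)
  interpret G': group G' by (fact G')
  let ?C = "carrier G"
  define \<psi> where "\<psi> = inv_into ?C \<theta>"
  have \<theta>c: "\<theta> z \<in> carrier G'" if "z \<in> ?C" for z using \<theta> that by (auto simp: bij_betw_def)
  have \<psi>c: "\<psi> w \<in> ?C" if "w \<in> carrier G'" for w using \<theta> that by (auto simp: \<psi>_def bij_betw_def inv_into_into)
  have \<psi>\<theta>: "\<psi> (\<theta> z) = z" if "z \<in> ?C" for z using \<theta> that by (auto simp: \<psi>_def bij_betw_def)
  have \<theta>\<psi>: "\<theta> (\<psi> w) = w" if "w \<in> carrier G'" for w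
    using \<theta> that by (auto simp: \<psi>_def bij_betw_def f_inv_into_f)
  define f where "f x = (\<lambda>z\<in>?C. x \<otimes>\<^bsub>G\<^esub> z)" for x
  define g where "g y = (\<lambda>z\<in>?C. \<psi> (y \<otimes>\<^bsub>G'\<^esub> \<theta> z))" for y
  have fB: "f x \<in> Bij ?C" if x: "x \<in> ?C" for x
  proof -
    have "bij_betw (f x) ?C ?C"
      by (rule bij_betwI[where g = "\<lambda>z. inv\<^bsub>G\<^esub> x \<otimes>\<^bsub>G\<^esub> z"])
        (use x in \<open>auto simp: f_def G.m_assoc[symmetric]\<close>)
    then show ?thesis by (simp add: Bij_def f_def)
  qed
  have gB: "g y \<in> Bij ?C" if y: "y \<in> carrier G'" for y
  proof -
    have "bij_betw (g y) ?C ?C"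
      by (rule bij_betwI[where g = "\<lambda>z. \<psi> (inv\<^bsub>G'\<^esub> y \<otimes>\<^bsub>G'\<^esub> \<theta> z)"])
        (use y in \<open>auto simp: g_def \<psi>c \<theta>c \<psi>\<theta> \<theta>\<psi> G'.m_assoc[symmetric]\<close>)
    then show ?thesis by (simp add: Bij_def g_def)
  qed
  have BG: "carrier (BijGroup ?C) = Bij ?C"
      "p \<in> Bij ?C \<Longrightarrow> q \<in> Bij ?C \<Longrightarrow> p \<otimes>\<^bsub>BijGroup ?C\<^esub> q = compose ?C p q" for p q
    by (simp_all add: BijGroup_def)
  have "f \<in> hom G (BijGroup ?C)"
  proof (rule homI)
    fix x y assume xy: "x \<in> ?C" "y \<in> ?C"
    have "f (x \<otimes>\<^bsub>G\<^esub> y) = compose ?C (f x) (f y)"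
      using xy by (auto simp: f_def compose_def restrict_def G.m_assoc fun_eq_iff)
    then show "f (x \<otimes>\<^bsub>G\<^esub> y) = f x \<otimes>\<^bsub>BijGroup ?C\<^esub> f y" using xy by (simp add: BG fB)
  qed (simp add: BG fB)
  moreover have "g \<in> hom G' (BijGroup ?C)"
  proof (rule homI)
    fix x y assume xy: "x \<in> carrier G'" "y \<in> carrier G'"
    have "g (x \<otimes>\<^bsub>G'\<^esub> y) = compose ?C (g x) (g y)"
      using xy by (auto simp: g_def compose_def restrict_def \<psi>c \<theta>c \<theta>\<psi> G'.m_assoc fun_eq_iff)
    then show "g (x \<otimes>\<^bsub>G'\<^esub> y) = g x \<otimes>\<^bsub>BijGroup ?C\<^esub> g y" using xy by (simp add: BG gB)
  qed (simp add: BG gB)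
  moreover have "inj_on f ?C"
  proof (rule inj_onI)
    fix x y assume xy: "x \<in> ?C" "y \<in> ?C" "f x = f y"
    then have "f x \<one>\<^bsub>G\<^esub> = f y \<one>\<^bsub>G\<^esub>" by simp
    then show "x = y" using xy(1,2) by (simp add: f_def)
  qed
  moreover have "f h = g (\<phi> h)" if "h \<in> H" for h
  proof
    fix z
    show "f h z = g (\<phi> h) z"
      using equivariant[OF that, of z] \<psi>\<theta>[of "h \<otimes>\<^bsub>G\<^esub> z"] that H by (auto simp: f_def g_def subset_iff)
  qed
  ultimately show ?thesis by blast
qed

locale index_two_amalgam = G: group G + G': group G'
  for G :: "('a, 'm) monoid_scheme" and G' :: "('b, 'n) monoid_scheme" +
  fixes H :: "'a set" and H' :: "'b set" and \<phi> :: "'a \<Rightarrow> 'b"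
  assumes H: "subgroup H G" and H_index: "card (rcosets\<^bsub>G\<^esub> H) = 2"
    and H': "subgroup H' G'" and H'_index: "card (rcosets\<^bsub>G'\<^esub> H') = 2"
    and \<phi>: "\<phi> \<in> iso (G\<lparr>carrier := H\<rparr>) (G'\<lparr>carrier := H'\<rparr>)"
begin

abbreviation "A \<equiv> amalgam G G' H \<phi>"
abbreviation "inl \<equiv> amalgam_inl G G' H \<phi>"
abbreviation "inr \<equiv> amalgam_inr G G' H \<phi>"

section \<open>The two factors inside the amalgam\<close>

lemma H_carrier: "H \<subseteq> carrier G" and H'_carrier: "H' \<subseteq> carrier G'"
  using H H' by (auto dest: subgroup.subset)

lemma \<phi>_bij: "bij_betw \<phi> H H'"
  using \<phi> by (simp add: iso_def)

lemma \<phi>_mult: "g \<in> H \<Longrightarrow> h \<in> H \<Longrightarrow> \<phi> (g \<otimes>\<^bsub>G\<^esub> h) = \<phi> g \<otimes>\<^bsub>G'\<^esub> \<phi> h"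
  using \<phi> by (auto simp: iso_def hom_def)

lemma \<phi>_H': "h \<in> H \<Longrightarrow> \<phi> h \<in> H'"
  using \<phi>_bij by (auto simp: bij_betw_def)

lemma \<phi>_carrier: "\<phi> ` H \<subseteq> carrier G'"
  using \<phi>_H' H'_carrier by blast

lemmas amalgam_context = G.is_group G'.is_group H_carrier \<phi>_carrier

lemma group_A: "group A"
  by (rule group_amalgam[OF amalgam_context])

lemma inl_hom: "inl \<in> hom G A" and inr_hom: "inr \<in> hom G' A"
  using amalgam_inl_hom[OF amalgam_context] amalgam_inr_hom[OF amalgam_context] by auto

lemma inl_eq_inr: "h \<in> H \<Longrightarrow> inl h = inr (\<phi> h)"
  by (rule amalgam_inl_eq_inr[OF amalgam_context])

text \<open>Index two splits the groups into \<open>H\<close>, \<open>H a\<close> and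
  \<open>H'\<close>, \<open>H' b\<close>, each a free orbit under left multiplication. The bijection
  sends \<open>h\<close> to \<open>\<phi> h\<close> and \<open>h a\<close> to
  \<open>\<phi> h\<close> times \<open>b\<close>.\<close>

lemma equivariant_bijection:
  "\<exists>\<theta>. bij_betw \<theta> (carrier G) (carrier G') \<and>
    (\<forall>h\<in>H. \<forall>z\<in>carrier G. \<theta> (h \<otimes>\<^bsub>G\<^esub> z) = \<phi> h \<otimes>\<^bsub>G'\<^esub> \<theta> z)"
proof -
  obtain a where a: "a \<in> carrier G" "a \<notin> H" using G.index_two_proper[OF H H_index] by blast
  obtain b where b: "b \<in> carrier G'" "b \<notin> H'" using G'.index_two_proper[OF H' H'_index] by blast
  note iff = G.index_two_mult_iff[OF H H_index] and iff' = G'.index_two_mult_iff[OF H' H'_index]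
  have \<phi>c: "\<phi> h \<in> carrier G'" if "h \<in> H" for h using that \<phi>_carrier by blast
  have zH: "z \<otimes>\<^bsub>G\<^esub> inv\<^bsub>G\<^esub> a \<in> H" if "z \<in> carrier G" "z \<notin> H" for z
    using that a by (simp add: iff G.subgroup_inv_iff[OF H])
  have wH: "w \<otimes>\<^bsub>G'\<^esub> inv\<^bsub>G'\<^esub> b \<in> H'" if "w \<in> carrier G'" "w \<notin> H'" for w
    using that b by (simp add: iff' G'.subgroup_inv_iff[OF H'])
  define \<theta> where "\<theta> z = (if z \<in> H then \<phi> z else \<phi> (z \<otimes>\<^bsub>G\<^esub> inv\<^bsub>G\<^esub> a) \<otimes>\<^bsub>G'\<^esub> b)" for z
  have \<theta>H: "\<theta> z \<in> H' \<longleftrightarrow> z \<in> H" if "z \<in> carrier G" for z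
    using that zH[of z] b iff'[of "\<phi> (z \<otimes>\<^bsub>G\<^esub> inv\<^bsub>G\<^esub> a)" b] \<phi>_H' \<phi>c by (auto simp: \<theta>_def)
  have "inj_on \<theta> (carrier G)"
  proof (rule inj_onI)
    fix x y assume *: "x \<in> carrier G" "y \<in> carrier G" "\<theta> x = \<theta> y"
    then have same: "x \<in> H \<longleftrightarrow> y \<in> H" using \<theta>H by metis
    have inj: "inj_on \<phi> H" using \<phi>_bij by (simp add: bij_betw_def)
    show "x = y"
    proof (cases "x \<in> H")
      case True
      then show ?thesis using * same inj by (auto simp: \<theta>_def inj_on_def)
    next
      case False
      then have "\<phi> (x \<otimes>\<^bsub>G\<^esub> inv\<^bsub>G\<^esub> a) = \<phi> (y \<otimes>\<^bsub>G\<^esub> inv\<^bsub>G\<^esub> a)"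
        using * same b zH \<phi>c by (simp add: \<theta>_def)
      then have "x \<otimes>\<^bsub>G\<^esub> inv\<^bsub>G\<^esub> a = y \<otimes>\<^bsub>G\<^esub> inv\<^bsub>G\<^esub> a"
        using inj zH * False same by (auto simp: inj_on_def)
      then show ?thesis using * a by simp
    qed
  qed
  moreover have "\<theta> ` carrier G = carrier G'"
  proof (intro equalityI subsetI)
    fix w assume "w \<in> \<theta> ` carrier G"
    then show "w \<in> carrier G'" using zH b \<phi>c by (auto simp: \<theta>_def split: if_splits)
  next
    fix w assume w: "w \<in> carrier G'"
    have surj: "\<exists>h\<in>H. \<phi> h = v" if "v \<in> H'" for v using \<phi>_bij that by (auto simp: bij_betw_def)
    show "w \<in> \<theta> ` carrier G"
    proof (cases "w \<in> H'")
      case True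
      then obtain h where h: "h \<in> H" "\<phi> h = w" using surj by blast
      then show ?thesis using H_carrier by (intro image_eqI[of _ _ h]) (auto simp: \<theta>_def)
    next
      case False
      then obtain h where h: "h \<in> H" "\<phi> h = w \<otimes>\<^bsub>G'\<^esub> inv\<^bsub>G'\<^esub> b" using surj wH w by blast
      have hc: "h \<in> carrier G" using h H_carrier by blast
      have "h \<otimes>\<^bsub>G\<^esub> a \<notin> H" using iff[OF hc a(1)] h a by simp
      moreover have "h \<otimes>\<^bsub>G\<^esub> a \<otimes>\<^bsub>G\<^esub> inv\<^bsub>G\<^esub> a = h" using hc a by (simp add: G.m_assoc)
      moreover have "\<phi> h \<otimes>\<^bsub>G'\<^esub> b = w" unfolding h(2) using w b by (simp add: G'.m_assoc)
      ultimately have "\<theta> (h \<otimes>\<^bsub>G\<^esub> a) = w" by (simp add: \<theta>_def)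
      then show ?thesis using hc a by (intro image_eqI[of _ _ "h \<otimes>\<^bsub>G\<^esub> a"]) auto
    qed
  qed
  moreover have "\<theta> (h \<otimes>\<^bsub>G\<^esub> z) = \<phi> h \<otimes>\<^bsub>G'\<^esub> \<theta> z" if h: "h \<in> H" and z: "z \<in> carrier G" for h z
  proof -
    have hc: "h \<in> carrier G" using h H_carrier by blast
    have "h \<otimes>\<^bsub>G\<^esub> z \<in> H \<longleftrightarrow> z \<in> H" using iff[OF hc z] h by simp
    then show ?thesis
      using h hc z a b zH[OF z] \<phi>c by (auto simp: \<theta>_def \<phi>_mult G.m_assoc G'.m_assoc)
  qed
  ultimately show ?thesis unfolding bij_betw_def by blast
qed

text \<open>The compatible actions of both groups on \<open>carrier G\<close> extend to the amalgam,
  and composing with \<open>inl\<close> gives back the faithful regular action of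
  \<open>G\<close>.\<close>

lemma inl_inj: "inj_on inl (carrier G)"
proof -
  obtain \<theta> where "bij_betw \<theta> (carrier G) (carrier G')"
      "\<And>h z. h \<in> H \<Longrightarrow> z \<in> carrier G \<Longrightarrow> \<theta> (h \<otimes>\<^bsub>G\<^esub> z) = \<phi> h \<otimes>\<^bsub>G'\<^esub> \<theta> z"
    using equivariant_bijection by blast
  from compatible_actions[OF G.is_group G'.is_group this(1) H_carrier this(2)]
  obtain f g where fg: "f \<in> hom G (BijGroup (carrier G))" "g \<in> hom G' (BijGroup (carrier G))"
      "inj_on f (carrier G)" "\<And>h. h \<in> H \<Longrightarrow> f h = g (\<phi> h)" by blast
  obtain k where "\<forall>x\<in>carrier G. k (inl x) = f x"
    using amalgam_universal[OF amalgam_context group_BijGroup fg(1,2,4)] by blast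
  then show ?thesis using fg(3) unfolding inj_on_def by metis
qed

text \<open>Modulo subgroups of index two both factors become groups of order two. They act as the
  reflections \<open>n \<mapsto> 1 - n\<close> and \<open>n \<mapsto> -1 - n\<close>, while the
  glued subgroups act trivially.\<close>

lemma level_exists:
  "\<exists>level\<in>hom A int_dihedral. (\<forall>x\<in>carrier G. level (inl x) = (if x \<in> H then 0 else 1)) \<and>
    (\<forall>y\<in>carrier G'. level (inr y) = (if y \<in> H' then 0 else - 1))"
proof -
  have "(\<lambda>x. if x \<in> H then 0 else 1) \<in> hom G int_dihedral"
    by (rule homI) (auto simp: int_dihedral_def G.index_two_mult_iff[OF H H_index])
  moreover have "(\<lambda>y. if y \<in> H' then 0 else - 1) \<in> hom G' int_dihedral"
    by (rule homI) (auto simp: int_dihedral_def G'.index_two_mult_iff[OF H' H'_index])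
  ultimately show ?thesis
    by (rule amalgam_universal[OF amalgam_context group_int_dihedral]) (simp add: \<phi>_H')
qed

text \<open>A single \<open>b\<close> suffices because \<open>G'\<close> consists of
  \<open>H'\<close> and \<open>b H'\<close>, and \<open>H'\<close> is identified with a subgroup of
  \<open>G\<close>.\<close>

lemma generate_A:
  assumes b: "b \<in> carrier G'" "b \<notin> H'"
  shows "generate A (insert (inr b) (inl ` carrier G)) = carrier A"
proof
  interpret A: group A by (rule group_A)
  let ?E = "insert (inr b) (inl ` carrier G)"
  have E: "?E \<subseteq> carrier A" using b inl_hom inr_hom by (auto simp: hom_def)
  show "generate A ?E \<subseteq> carrier A" using A.generate_incl[OF E] .
  have sub: "subgroup (generate A ?E) A" using A.generate_is_subgroup[OF E] .
  have inlE: "inl x \<in> generate A ?E" if "x \<in> carrier G" for x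
    using that by (auto intro: generate.incl)
  have inrE: "inr y \<in> generate A ?E" if y: "y \<in> carrier G'" for y
  proof -
    have H'E: "inr z \<in> generate A ?E" if z: "z \<in> H'" for z
    proof -
      obtain h where "h \<in> H" "z = \<phi> h" using \<phi>_bij z by (auto simp: bij_betw_def)
      then show ?thesis using inl_eq_inr[of h] inlE[of h] H_carrier by auto
    qed
    show ?thesis
    proof (cases "y \<in> H'")
      case False
      have "inv\<^bsub>G'\<^esub> b \<otimes>\<^bsub>G'\<^esub> y \<in> H'"
        using False y b by (simp add: G'.index_two_mult_iff[OF H' H'_index] G'.subgroup_inv_iff[OF H'])
      then have "inr b \<otimes>\<^bsub>A\<^esub> inr (inv\<^bsub>G'\<^esub> b \<otimes>\<^bsub>G'\<^esub> y) \<in> generate A ?E"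
        using H'E by (intro subgroup.m_closed[OF sub]) (auto intro: generate.incl)
      moreover have "inr b \<otimes>\<^bsub>A\<^esub> inr (inv\<^bsub>G'\<^esub> b \<otimes>\<^bsub>G'\<^esub> y) = inr y"
        using hom_mult[OF inr_hom, of b "inv\<^bsub>G'\<^esub> b \<otimes>\<^bsub>G'\<^esub> y"] y b by simp
      ultimately show ?thesis by simp
    qed (use H'E in blast)
  qed
  have cls: "amalgam_class G G' H \<phi> w \<in> generate A ?E" if "w \<in> amalgam_words G G'" for w
    using that
  proof (induction w)
    case Nil
    have "amalgam_class G G' H \<phi> [] = \<one>\<^bsub>A\<^esub>" by (simp add: amalgam_def)
    then show ?case using subgroup.one_closed[OF sub] by simp
  next
    case (Cons c w)
    have w: "w \<in> amalgam_words G G'" "[c] \<in> amalgam_words G G'" using Cons.prems by (cases c; simp)+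
    have "amalgam_class G G' H \<phi> (c # w) = amalgam_class G G' H \<phi> [c] \<otimes>\<^bsub>A\<^esub> amalgam_class G G' H \<phi> w"
      using amalgam_mult_class[OF amalgam_context w(2,1)] by simp
    moreover have "amalgam_class G G' H \<phi> [c] \<in> generate A ?E"
      using w(2) inlE inrE by (cases c) (auto simp: amalgam_inl_def amalgam_inr_def)
    ultimately show ?case using Cons.IH[OF w(1)] subgroup.m_closed[OF sub] by simp
  qed
  then show "carrier A \<subseteq> generate A ?E" by (auto simp: amalgam_def)
qed

text \<open>Injectivity of \<open>inl\<close> carries properness and non-triviality of
  \<open>H\<close> over to the amalgam; the conditions on \<open>b\<close> come from
  \<open>G'\<close>, where \<open>H'\<close> is glued to \<open>H\<close>.\<close>

lemma dihedral_extension_amalgam: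
  assumes fin: "finite (carrier G)" and S: "S \<subseteq> carrier G" "generate G S = carrier G"
    and b: "b \<in> carrier G'" "b \<notin> H'" and nontriv: "H \<noteq> {\<one>\<^bsub>G\<^esub>}" and dedekind: "dedekind_group G"
    and level: "level \<in> hom A int_dihedral"
      "\<And>x. x \<in> carrier G \<Longrightarrow> level (inl x) = (if x \<in> H then 0 else 1)"
      "\<And>y. y \<in> carrier G' \<Longrightarrow> level (inr y) = (if y \<in> H' then 0 else - 1)"
  shows "dihedral_extension A (inl ` carrier G) (inl ` H) (inl ` S) (inr b) level"
proof -
  interpret A: group A by (rule group_A)
  interpret inl: group_hom G A inl by (unfold_locales) (rule inl_hom)
  interpret inr: group_hom G' A inr by (unfold_locales) (rule inr_hom)
  have inl_mem: "inl x \<in> inl ` X \<longleftrightarrow> x \<in> X" if "x \<in> carrier G" "X \<subseteq> carrier G" for x X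
    using inj_on_image_mem_iff[OF inl_inj that] .
  have H'_inl: "inr z \<in> inl ` H" if z: "z \<in> H'" for z
  proof -
    obtain h where "h \<in> H" "z = \<phi> h" using \<phi>_bij z by (auto simp: bij_betw_def)
    then show ?thesis using inl_eq_inr[of h] by auto
  qed
  show ?thesis
  proof (intro dihedral_extension.intro dihedral_extension_axioms.intro)
    show "group A" by (rule group_A)
    show "subgroup (inl ` carrier G) A" by (rule inl.subgroup_img_is_subgroup[OF G.subgroup_self])
    show "subgroup (inl ` H) A" by (rule inl.subgroup_img_is_subgroup[OF H])
    show "inl ` H \<subseteq> inl ` carrier G" using H_carrier by blast
    show "finite (inl ` carrier G)" using fin by simp
    show "inl ` S \<subseteq> inl ` carrier G" using S by blast
    show "generate A (inl ` S) = inl ` carrier G" using inl.generate_img[OF S(1)] S(2) by simp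
    show "inl ` H \<noteq> inl ` carrier G"
      using G.index_two_proper[OF H H_index] inl_mem[OF _ H_carrier] by blast
    show "inl ` H \<noteq> {\<one>\<^bsub>A\<^esub>}"
    proof
      assume *: "inl ` H = {\<one>\<^bsub>A\<^esub>}"
      have "x = \<one>\<^bsub>G\<^esub>" if "x \<in> H" for x
      proof -
        have "inl x = inl \<one>\<^bsub>G\<^esub>" using * that by auto
        then show ?thesis using inl_inj that H_carrier by (auto simp: inj_on_def subset_iff)
      qed
      then show False using nontriv subgroup.one_closed[OF H] by blast
    qed
    show "inr b \<in> carrier A" using b by simp
    show "inr b \<otimes>\<^bsub>A\<^esub> inr b \<in> inl ` H"
      using H'_inl[of "b \<otimes>\<^bsub>G'\<^esub> b"] G'.index_two_mult[OF H' H'_index b b] b by simp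
    show "generate A (insert (inr b) (inl ` carrier G)) = carrier A" by (rule generate_A[OF b])
    show "level \<in> hom A int_dihedral" by (rule level)
    show "level (inr b) = - 1" using level(3)[OF b(1)] b by simp
  next
    fix h assume "h \<in> inl ` H"
    then obtain x where x: "x \<in> H" "h = inl x" by blast
    then show "level h = 0" using level(2)[of x] H_carrier by auto
    have \<phi>x: "\<phi> x \<in> H'" "\<phi> x \<in> carrier G'" using x \<phi>_H' H'_carrier by auto
    have "inv\<^bsub>G'\<^esub> b \<otimes>\<^bsub>G'\<^esub> \<phi> x \<otimes>\<^bsub>G'\<^esub> b \<in> H'"
      using \<phi>x b by (simp add: G'.index_two_mult_iff[OF H' H'_index] G'.subgroup_inv_iff[OF H'])
    from H'_inl[OF this]
    show "inv\<^bsub>A\<^esub> inr b \<otimes>\<^bsub>A\<^esub> h \<otimes>\<^bsub>A\<^esub> inr b \<in> inl ` H"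
      using x inl_eq_inr b \<phi>x by simp
  next
    fix g assume "g \<in> inl ` carrier G" "g \<notin> inl ` H"
    then show "level g = 1" using level(2) by auto
  next
    fix K x k assume K: "subgroup K A" "K \<subseteq> inl ` carrier G" and x: "x \<in> inl ` carrier G" and k: "k \<in> K"
    \<comment> \<open>The Dedekind property is available in \<open>G\<close> only, so
      \<open>K\<close> is pulled back along \<open>inl\<close>.\<close>
    define L where "L = {g \<in> carrier G. inl g \<in> K}"
    have "subgroup L G"
      using K(1) by (intro G.subgroupI)
        (auto simp: L_def subgroup.one_closed subgroup.m_closed subgroup.m_inv_closed intro!: exI[of _ "\<one>\<^bsub>G\<^esub>"])
    then have "L \<lhd> G" using dedekind by (simp add: dedekind_group_def)
    obtain y l where y: "y \<in> carrier G" "x = inl y" and l: "l \<in> carrier G" "k = inl l"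
      using x k K(2) by blast
    then have "l \<in> L" using k by (simp add: L_def)
    then have "y \<otimes>\<^bsub>G\<^esub> l \<otimes>\<^bsub>G\<^esub> inv\<^bsub>G\<^esub> y \<in> L"
      using normal.inv_op_closed2[OF \<open>L \<lhd> G\<close> y(1)] by blast
    then show "x \<otimes>\<^bsub>A\<^esub> k \<otimes>\<^bsub>A\<^esub> inv\<^bsub>A\<^esub> x \<in> K" using y l by (simp add: L_def)
  qed
qed

end

theorem theorem3p10:
  fixes G :: "('a, 'm) monoid_scheme" and G' :: "('b, 'n) monoid_scheme"
    and S H :: "'a set" and S' H' :: "'b set" and \<phi> :: "'a \<Rightarrow> 'b"
  assumes "group G" and "finite (carrier G)"
    and "group G'" and "finite (carrier G')"
    and "finite S" and "symmetric_generating_set G S"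
    and "finite S'" and "symmetric_generating_set G' S'"
    and "subgroup H G" and "card (rcosets\<^bsub>G\<^esub> H) = 2" and "H \<noteq> {\<one>\<^bsub>G\<^esub>}"
    and "subgroup H' G'" and "card (rcosets\<^bsub>G'\<^esub> H') = 2" and "H' \<noteq> {\<one>\<^bsub>G'\<^esub>}"
    and "\<phi> \<in> iso (G\<lparr>carrier := H\<rparr>) (G'\<lparr>carrier := H'\<rparr>)"
    and "dedekind_group G"
  shows "\<exists>C. hamilton_circle
    (cayley_graph (amalgam G G' H \<phi>) (amalgam_inl G G' H \<phi> ` S \<union> amalgam_inr G G' H \<phi> ` S')) C"
proof -
  interpret index_two_amalgam G G' H H' \<phi>
    using assms by (intro index_two_amalgam.intro index_two_amalgam_axioms.intro)
  have S: "S \<subseteq> carrier G" "generate G S = carrier G" and S': "S' \<subseteq> carrier G'" "generate G' S' = carrier G'"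
    using assms(6,8) by (auto simp: symmetric_generating_set_def)
  \<comment> \<open>\<open>S'\<close> generates \<open>G'\<close> and so is not contained in a
    proper subgroup. Choosing \<open>b\<close> from \<open>S'\<close> makes right multiplication by
    \<open>b\<close> a step in the Cayley graph.\<close>
  have "\<not> S' \<subseteq> H'"
  proof
    assume "S' \<subseteq> H'"
    then have "carrier G' \<subseteq> H'" using G'.generate_subgroup_incl[OF \<open>S' \<subseteq> H'\<close> H'] S'(2) by simp
    then show False using G'.index_two_proper[OF H' H'_index] by blast
  qed
  then obtain b where b: "b \<in> S'" "b \<notin> H'" by blast
  then have bc: "b \<in> carrier G'" using S' by blast
  obtain level where level: "level \<in> hom A int_dihedral"
      "\<And>x. x \<in> carrier G \<Longrightarrow> level (inl x) = (if x \<in> H then 0 else 1)"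
      "\<And>y. y \<in> carrier G' \<Longrightarrow> level (inr y) = (if y \<in> H' then 0 else - 1)"
    using level_exists by blast
  interpret dihedral_extension A "inl ` carrier G" "inl ` H" "inl ` S" "inr b" level
    by (rule dihedral_extension_amalgam[OF assms(2) S bc b(2) assms(11,16) level])
  show ?thesis
  proof (rule hamilton_circle_cayley)
    show "inl ` S \<union> inr ` S' \<subseteq> carrier A" using S(1) S'(1) inl_hom inr_hom by (auto simp: hom_def)
    show "finite (inl ` S \<union> inr ` S')" using assms(5,7) by simp
    show "insert (inr b) (inl ` S) \<subseteq> inl ` S \<union> inr ` S'" using b by blast
    show "\<bar>level t\<bar> \<le> 1" if "t \<in> inl ` S \<union> inr ` S'" for t
      using that level(2,3) S(1) S'(1) by (auto simp: subset_iff)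
  qed
qed

end
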